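(* Let $A(t)$ be a self-adjoint holomorphic family of type (B) on a complex Hilbert space $\mathcal{H}$, with corresponding family of forms $\mathfrak{a}(t)=\mathfrak{a}_0+t\mathfrak{a}_1+t^2\mathfrak{a}_2+\cdots$. Let $\Sigma(t)=\min\sigma_e(A(t))$ and assume that $\Sigma(0)=0$. Suppose that $\lambda(t)<\Sigma(t)$ is an eigenvalue of $A(t)$ that depends continuously on $t$ when $0<t<\epsilon$, that $\lim_{t\to0^+}\lambda(t)=0$, and that $\liminf_{t\to0^+}(\lambda(t)-\Sigma(t))/t<0$. Suppose in addition that $A=A(0)$ has exactly $m<\infty$ negative eigenvalues counting multiplicity. Let $\omega=\lim_{t\to0^+}\Sigma(t)/t$, let $P$ denote the orthogonal projection onto the kernel of $A$, and let $B_0$ be the bounded self-adjoint operator on $\mathcal{H}$ defined by $\langle B_0x,y\rangle=\mathfrak{a}_1[Px,Py]$ for all $x,y\in\mathcal{H}$. Suppose that the smallest $k+1$ eigenvalues of $B_0$ (counting multiplicity) are all less than $\omega$. Label these eigenvalues $$\mu_0\le\mu_1\le\cdots\le\mu_k,$$ and label the smallest $m+k+1$ eigenvalues of $A(t)$ as $$\lambda_{-m}(t)\le\cdots\le\lambda_0(t)\le\lambda_1(t)\le\cdots\le\lambda_k(t).$$ Then $\lim_{t\to0^+}\lambda_k(t)/t=\mu_k$. Moreover, if $x_k(t)$ is a family of unit eigenvectors of $A(t)$ corresponding to $\lambda_k(t)$ for $0<t<\epsilon$, then for any sequence $t_n\to0^+$, $x_k(t_n)$ has a limit point that is a unit eigenvector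 of $B_0$ corresponding to $\mu_k$.
   Context: For a sesquilinear form $\mathfrak{t}$ on $\mathcal{H}$ with domain $\mathcal{D}(\mathfrak{t})$, write $\mathfrak{t}[x]=\mathfrak{t}[x,x]$, and $W(\mathfrak{t})=\{\mathfrak{t}[x] : x\in\mathcal{D}(\mathfrak{t}),\ \|x\|=1\}$. The form is symmetric if $\mathfrak{t}[x,y]=\overline{\mathfrak{t}[y,x]}$. It is sectorial if there are $v\in\mathbb{C}$ and $\theta<\pi/2$ with $|\arg(z-v)|\le\theta$ for all $z\in W(\mathfrak{t})$. A sectorial form is closed if whenever $x_n\in\mathcal{D}(\mathfrak{t})$, $x_n\to x$ in $\mathcal{H}$ and $\mathfrak{t}[x_n-x_m]\to 0$ as $n,m\to\infty$, then $x\in\mathcal{D}(\mathfrak{t})$ (and $\mathfrak{t}[x_n-x]\to0$). A subspace $V\subseteq\mathcal{D}(\mathfrak{t})$ is a core of a closed form $\mathfrak{t}$ if the closure (smallest closed extension) of $\mathfrak{t}|_V$ is $\mathfrak{t}$. A family $\mathfrak{a}(t)$ of sesquilinear forms, defined for $t$ in a neighborhood of $0$, is holomorphic of type (a) if each $\mathfrak{a}(t)$ is closed and sectorial, the domain $\mathcal{D}(\mathfrak{a}(t))=:\mathcal{D}(\mathfrak{a})$ is independent of $t$ and dense in $\mathcal{H}$, and $t\mapsto\mathfrak{a}(t)[x,y]$ is holomorphic near $0$ for all $x,y\in\mathcal{D}(\mathfrak{a})$. If in addition $\mathfrak{a}(t)$ is symmetric for real $t$, then for each real $t$ near $0$ there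 is a self-adjoint operator $A(t)$, with $\mathcal{D}(A(t))$ a core of $\mathfrak{a}(t)$ and $\langle A(t)x,y\rangle=\mathfrak{a}(t)[x,y]$ for $x,y\in\mathcal{D}(A(t))$; each $A(t)$ is bounded below. Such a family $A(t)$ is called a self-adjoint holomorphic family of type (B), and $\mathfrak{a}(t)$ is the corresponding family of forms. For such a family there is $R>0$ and there are symmetric sesquilinear forms $\mathfrak{a}_k$, defined on $\mathcal{D}(\mathfrak{a})$, with $\mathfrak{a}(t)[x,y]=\sum_{k\ge0}t^k\mathfrak{a}_k[x,y]$ for all $x,y\in\mathcal{D}(\mathfrak{a})$ and $|t|<R$. The form $(x,y)\mapsto\mathfrak{a}_1[Px,Py]$ is bounded and symmetric on $\mathcal{H}$, so $B_0$ is well defined. The limit $\omega$ exists. Limit points of sequences in $\mathcal{H}$ are understood in the norm topology. The essential spectrum of an operator $T$ is $\sigma_e(T)=\{\lambda\in\mathbb{C} : \exists\, x_n\in\mathcal{D}(T),\ \|x_n\|=1,\ x_n\to0 \text{ weakly},\ \|(T-\lambda)x_n\|\to0\}$.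
   Formalization: The eigenvalues μ_i, their multiplicities and the limiting eigenvector are those of B_0 restricted to the kernel of A; on all of H, B_0 has an extra eigenvalue 0 on the orthogonal complement of ker A, and if ω > 0 the statement counting it is false. *)

theory Defs
  imports "HOL-Analysis.Analysis" "HOL-Library.Extended_Nat"
begin

section \<open>Complex Hilbert spaces\<close>

text \<open>The inner product is linear in its first argument. Definiteness of the inner product
  and the compatibility of the norm with scalar multiplication follow from
  \<open>cinner_self\<close> and the axioms of normed spaces.\<close>

class complex_hilbert = banach +
  fixes scaleC :: "complex \<Rightarrow> 'a \<Rightarrow> 'a" (infixr "*\<^sub>C" 75)
    and cinner :: "'a \<Rightarrow> 'a \<Rightarrow> complex"
  assumes scaleC_add_right: "c *\<^sub>C (x + y) = c *\<^sub>C x + c *\<^sub>C y"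
    and scaleC_add_left: "(c + d) *\<^sub>C x = c *\<^sub>C x + d *\<^sub>C x"
    and scaleC_scaleC: "c *\<^sub>C d *\<^sub>C x = (c * d) *\<^sub>C x"
    and scaleC_of_real: "complex_of_real r *\<^sub>C x = r *\<^sub>R x"
    and cinner_commute: "cinner x y = cnj (cinner y x)"
    and cinner_add_left: "cinner (x + y) z = cinner x z + cinner y z"
    and cinner_scaleC_left: "cinner (c *\<^sub>C x) y = c * cinner x y"
    and cinner_self: "cinner x x = complex_of_real ((norm x)\<^sup>2)"

global_interpretation cvec: vector_space "scaleC :: complex \<Rightarrow> 'a \<Rightarrow> 'a::complex_hilbert"
proof
  show "1 *\<^sub>C x = x" for x :: 'a
    using scaleC_of_real[of 1 x] by simp
qed (simp_all add: scaleC_add_right scaleC_add_left scaleC_scaleC)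

section \<open>Sesquilinear forms\<close>

text \<open>A form is given by its domain \<open>D\<close> and a function \<open>t\<close> of which only the values on
  \<open>D \<times> D\<close> matter.\<close>

definition sesquilinear_form ::
    "'a::complex_hilbert set \<Rightarrow> ('a \<Rightarrow> 'a \<Rightarrow> complex) \<Rightarrow> bool" where
  "sesquilinear_form D t \<longleftrightarrow> cvec.subspace D \<and>
     (\<forall>x\<in>D. \<forall>y\<in>D. \<forall>z\<in>D. \<forall>c.
        t (x + y) z = t x z + t y z \<and> t (c *\<^sub>C x) z = c * t x z \<and>
        t z (x + y) = t z x + t z y \<and> t z (c *\<^sub>C x) = cnj c * t z x)"

definition symmetric_form ::
    "'a::complex_hilbert set \<Rightarrow> ('a \<Rightarrow> 'a \<Rightarrow> complex) \<Rightarrow> bool" where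
  "symmetric_form D t \<longleftrightarrow> sesquilinear_form D t \<and> (\<forall>x\<in>D. \<forall>y\<in>D. t x y = cnj (t y x))"

definition numerical_range ::
    "'a::complex_hilbert set \<Rightarrow> ('a \<Rightarrow> 'a \<Rightarrow> complex) \<Rightarrow> complex set" where
  "numerical_range D t = {t x x | x. x \<in> D \<and> norm x = 1}"

text \<open>\<open>Arg\<close> takes values in \<open>(-pi, pi]\<close> and \<open>Arg 0 = 0\<close>, so the vertex \<open>v\<close> belongs to the
  sector.\<close>

definition sectorial_form ::
    "'a::complex_hilbert set \<Rightarrow> ('a \<Rightarrow> 'a \<Rightarrow> complex) \<Rightarrow> bool" where
  "sectorial_form D t \<longleftrightarrow> sesquilinear_form D t \<and>
     (\<exists>v \<theta>. \<theta> < pi / 2 \<and> (\<forall>z\<in>numerical_range D t. \<bar>Arg (z - v)\<bar> \<le> \<theta>))"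

definition closed_sectorial_form ::
    "'a::complex_hilbert set \<Rightarrow> ('a \<Rightarrow> 'a \<Rightarrow> complex) \<Rightarrow> bool" where
  "closed_sectorial_form D t \<longleftrightarrow> sectorial_form D t \<and>
     (\<forall>x l. (\<forall>n. x n \<in> D) \<longrightarrow> x \<longlonglongrightarrow> l \<longrightarrow>
        ((\<lambda>(n, m). t (x n - x m) (x n - x m)) \<longlongrightarrow> 0) (sequentially \<times>\<^sub>F sequentially) \<longrightarrow>
        l \<in> D \<and> (\<lambda>n. t (x n - l) (x n - l)) \<longlonglongrightarrow> 0)"

definition form_extends ::
    "'a::complex_hilbert set \<Rightarrow> ('a \<Rightarrow> 'a \<Rightarrow> complex) \<Rightarrow>
     'a set \<Rightarrow> ('a \<Rightarrow> 'a \<Rightarrow> complex) \<Rightarrow> bool" where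
  "form_extends D t E s \<longleftrightarrow> E \<subseteq> D \<and> (\<forall>x\<in>E. \<forall>y\<in>E. t x y = s x y)"

definition is_form_closure ::
    "'a::complex_hilbert set \<Rightarrow> ('a \<Rightarrow> 'a \<Rightarrow> complex) \<Rightarrow>
     'a set \<Rightarrow> ('a \<Rightarrow> 'a \<Rightarrow> complex) \<Rightarrow> bool" where
  "is_form_closure D t E s \<longleftrightarrow> closed_sectorial_form D t \<and> form_extends D t E s \<and>
     (\<forall>D' t'. closed_sectorial_form D' t' \<and> form_extends D' t' E s \<longrightarrow> form_extends D' t' D t)"

definition form_core ::
    "'a::complex_hilbert set \<Rightarrow> ('a \<Rightarrow> 'a \<Rightarrow> complex) \<Rightarrow> 'a set \<Rightarrow> bool" where
  "form_core D t V \<longleftrightarrow> cvec.subspace V \<and> V \<subseteq> D \<and> is_form_closure D t V t"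

section \<open>Unbounded operators\<close>

text \<open>An operator is given by its domain \<open>D\<close> and a function \<open>T\<close> of which only the values on
  \<open>D\<close> matter. Real spectral parameters are embedded by \<open>complex_of_real\<close>.\<close>

definition linear_operator ::
    "'a::complex_hilbert set \<Rightarrow> ('a \<Rightarrow> 'a) \<Rightarrow> bool" where
  "linear_operator D T \<longleftrightarrow> cvec.subspace D \<and>
     (\<forall>x\<in>D. \<forall>y\<in>D. \<forall>c. T (x + y) = T x + T y \<and> T (c *\<^sub>C x) = c *\<^sub>C T x)"

definition adjoint_graph ::
    "'a::complex_hilbert set \<Rightarrow> ('a \<Rightarrow> 'a) \<Rightarrow> ('a \<times> 'a) set" where
  "adjoint_graph D T = {(y, z). \<forall>x\<in>D. cinner (T x) y = cinner x z}"

definition self_adjoint_operator ::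
    "'a::complex_hilbert set \<Rightarrow> ('a \<Rightarrow> 'a) \<Rightarrow> bool" where
  "self_adjoint_operator D T \<longleftrightarrow> linear_operator D T \<and> closure D = UNIV \<and>
     adjoint_graph D T = {(x, T x) | x. x \<in> D}"

definition operator_kernel ::
    "'a::complex_hilbert set \<Rightarrow> ('a \<Rightarrow> 'a) \<Rightarrow> 'a set" where
  "operator_kernel D T = {x \<in> D. T x = 0}"

definition orthogonal_projection ::
    "('a::complex_hilbert \<Rightarrow> 'a) \<Rightarrow> 'a set \<Rightarrow> bool" where
  "orthogonal_projection P V \<longleftrightarrow> (\<forall>x. P x \<in> V \<and> (\<forall>v\<in>V. cinner (x - P x) v = 0))"

definition essential_spectrum ::
    "'a::complex_hilbert set \<Rightarrow> ('a \<Rightarrow> 'a) \<Rightarrow> complex set" where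
  "essential_spectrum D T = {z. \<exists>x :: nat \<Rightarrow> 'a.
     (\<forall>n. x n \<in> D \<and> norm (x n) = 1) \<and>
     (\<forall>y. (\<lambda>n. cinner (x n) y) \<longlonglongrightarrow> 0) \<and>
     (\<lambda>n. norm (T (x n) - z *\<^sub>C x n)) \<longlonglongrightarrow> 0}"

definition is_min_essential_spectrum ::
    "'a::complex_hilbert set \<Rightarrow> ('a \<Rightarrow> 'a) \<Rightarrow> real \<Rightarrow> bool" where
  "is_min_essential_spectrum D T s \<longleftrightarrow>
     complex_of_real s \<in> essential_spectrum D T \<and>
     (\<forall>z\<in>essential_spectrum D T. z \<in> \<real> \<and> s \<le> Re z)"

definition eigenspace ::
    "'a::complex_hilbert set \<Rightarrow> ('a \<Rightarrow> 'a) \<Rightarrow> real \<Rightarrow> 'a set" where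
  "eigenspace D T r = {x \<in> D. T x = complex_of_real r *\<^sub>C x}"

definition is_eigenvalue ::
    "'a::complex_hilbert set \<Rightarrow> ('a \<Rightarrow> 'a) \<Rightarrow> real \<Rightarrow> bool" where
  "is_eigenvalue D T r \<longleftrightarrow> (\<exists>x\<in>eigenspace D T r. x \<noteq> 0)"

text \<open>\<open>cvec.dim\<close> is \<open>0\<close> on infinite-dimensional subspaces, so infinite multiplicity has to be
  treated separately.\<close>

definition eigenvalue_mult ::
    "'a::complex_hilbert set \<Rightarrow> ('a \<Rightarrow> 'a) \<Rightarrow> real \<Rightarrow> enat" where
  "eigenvalue_mult D T r =
     (if \<exists>B. finite B \<and> eigenspace D T r \<subseteq> cvec.span B
      then enat (cvec.dim (eigenspace D T r)) else \<infinity>)"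

definition num_negative_eigenvalues ::
    "'a::complex_hilbert set \<Rightarrow> ('a \<Rightarrow> 'a) \<Rightarrow> nat \<Rightarrow> bool" where
  "num_negative_eigenvalues D T m \<longleftrightarrow>
     finite {r. r < 0 \<and> is_eigenvalue D T r} \<and>
     (\<Sum>r | r < 0 \<and> is_eigenvalue D T r. eigenvalue_mult D T r) = enat m"

text \<open>\<open>\<nu> l \<le> \<dots> \<le> \<nu> u\<close> are the smallest \<open>u - l + 1\<close> eigenvalues of \<open>T\<close>, counted with
  multiplicity: every value below \<open>\<nu> u\<close> is listed as often as its multiplicity (not at all if it
  is no eigenvalue), and \<open>\<nu> u\<close> itself at most that often. For \<open>D\<close> an invariant subspace this
  refers to the restriction of \<open>T\<close> to \<open>D\<close>.\<close>

definition smallest_eigenvalues ::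
    "'a::complex_hilbert set \<Rightarrow> ('a \<Rightarrow> 'a) \<Rightarrow> int \<Rightarrow> int \<Rightarrow> (int \<Rightarrow> real) \<Rightarrow> bool" where
  "smallest_eigenvalues D T l u \<nu> \<longleftrightarrow>
     mono_on {l..u} \<nu> \<and>
     (\<forall>r. enat (card {i \<in> {l..u}. \<nu> i = r}) \<le> eigenvalue_mult D T r) \<and>
     (\<forall>r < \<nu> u. enat (card {i \<in> {l..u}. \<nu> i = r}) = eigenvalue_mult D T r)"

section \<open>Holomorphic families\<close>

text \<open>\<open>U\<close> is the neighbourhood of \<open>0\<close> on which the family is defined; that the form domain does
  not depend on the parameter is expressed by the single set \<open>D\<close>.\<close>

definition holomorphic_type_a ::
    "complex set \<Rightarrow> 'a::complex_hilbert set \<Rightarrow> (complex \<Rightarrow> 'a \<Rightarrow> 'a \<Rightarrow> complex) \<Rightarrow> bool" where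
  "holomorphic_type_a U D a \<longleftrightarrow> open U \<and> 0 \<in> U \<and> closure D = UNIV \<and>
     (\<forall>t\<in>U. closed_sectorial_form D (a t)) \<and>
     (\<forall>x\<in>D. \<forall>y\<in>D. (\<lambda>t. a t x y) analytic_on {0})"

definition self_adjoint_type_B ::
    "complex set \<Rightarrow> 'a::complex_hilbert set \<Rightarrow> (complex \<Rightarrow> 'a \<Rightarrow> 'a \<Rightarrow> complex) \<Rightarrow>
     (real \<Rightarrow> 'a set) \<Rightarrow> (real \<Rightarrow> 'a \<Rightarrow> 'a) \<Rightarrow> bool" where
  "self_adjoint_type_B U D a DA A \<longleftrightarrow> holomorphic_type_a U D a \<and>
     (\<forall>t::real. complex_of_real t \<in> U \<longrightarrow>
        symmetric_form D (a t) \<and> self_adjoint_operator (DA t) (A t) \<and>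
        form_core D (a t) (DA t) \<and>
        (\<forall>x\<in>DA t. \<forall>y\<in>DA t. cinner (A t x) y = a t x y))"

definition form_expansion ::
    "'a::complex_hilbert set \<Rightarrow> (complex \<Rightarrow> 'a \<Rightarrow> 'a \<Rightarrow> complex) \<Rightarrow>
     (nat \<Rightarrow> 'a \<Rightarrow> 'a \<Rightarrow> complex) \<Rightarrow> bool" where
  "form_expansion D a ak \<longleftrightarrow> (\<forall>j. symmetric_form D (ak j)) \<and>
     (\<exists>R>0. \<forall>x\<in>D. \<forall>y\<in>D. \<forall>t. norm t < R \<longrightarrow> (\<lambda>j. t ^ j * ak j x y) sums a t x y)"

text \<open>The first-order operator \<open>B\<close> vanishes on the orthogonal complement of the kernel of
  \<open>A(0)\<close>, so as an operator on the whole space it has a spurious eigenvalue \<open>0\<close> there. Its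
  eigenvalues are therefore counted on the kernel, which it leaves invariant. For eigenvalues
  other than \<open>0\<close> this makes no difference.\<close>

definition first_order_operator ::
    "('a::complex_hilbert \<Rightarrow> 'a \<Rightarrow> complex) \<Rightarrow> ('a \<Rightarrow> 'a) \<Rightarrow> ('a \<Rightarrow> 'a) \<Rightarrow> bool" where
  "first_order_operator a1 P B \<longleftrightarrow> bounded_linear B \<and> self_adjoint_operator UNIV B \<and>
     (\<forall>x y. cinner (B x) y = a1 (P x) (P y))"

end

theory Submission
  imports Defs "HOL-Complex_Analysis.Great_Picard" "HOL-Real_Asymp.Real_Asymp"
begin

text \<open>
  Let \<open>K\<close> be the kernel of \<open>A(0)\<close> and \<open>N\<close> the span of its \<open>m\<close> negative eigenvectors. By the Baire
  category theorem, \<open>a(t) = a\<^sub>0 + t a\<^sub>1 + O(t\<^sup>2)\<close> holds uniformly with respect to the form norm of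
  \<open>a\<^sub>0\<close>. Testing \<open>a(t)\<close> on the sum of \<open>N\<close> and the eigenvectors of \<open>B\<^sub>0\<close> for \<open>\<mu>\<^sub>0, \<dots>, \<mu>\<^sub>k\<close> gives
  \<open>\<lambda>\<^sub>k(t) \<le> t \<mu>\<^sub>k + O(t\<^sup>2)\<close>, which is below \<open>\<Sigma>(t)\<close>, and nonnegativity of \<open>a\<^sub>0\<close> on the orthogonal
  complement of \<open>N\<close> gives \<open>\<lambda>\<^sub>0(t) \<ge> -C t\<close>.

  Let \<open>x\<^sub>n\<close> be unit eigenvectors of \<open>A(t\<^sub>n)\<close> whose eigenvalues divided by \<open>t\<^sub>n\<close> tend to \<open>\<nu> < \<omega>\<close>. A weak
  limit \<open>p\<close> of them lies in \<open>K\<close> and satisfies \<open>B\<^sub>0 p = \<nu> p\<close>. The differences \<open>w\<^sub>n = x\<^sub>n - p\<close> are weakly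
  null with \<open>a\<^sub>0[w\<^sub>n] \<rightarrow> 0\<close>, so for every fixed small \<open>t\<close> the form \<open>a(t)[w\<^sub>n]\<close> is asymptotically at least
  \<open>\<Sigma>(t) \<parallel>w\<^sub>n\<parallel>\<^sup>2\<close>, whence \<open>liminf a\<^sub>1[w\<^sub>n] \<ge> \<omega> lim \<parallel>w\<^sub>n\<parallel>\<^sup>2\<close>. Comparing energies yields
  \<open>\<nu> \<ge> \<nu> \<parallel>p\<parallel>\<^sup>2 + \<omega> (1 - \<parallel>p\<parallel>\<^sup>2)\<close>, hence \<open>\<parallel>p\<parallel> = 1\<close> and the convergence is strong. If the quotients
  for \<open>\<lambda>\<^sub>k\<close> stayed below some \<open>y < \<mu>\<^sub>k\<close> along a sequence, the limits of the eigenvectors for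
  \<open>\<lambda>\<^sub>0, \<dots>, \<lambda>\<^sub>k\<close> would give \<open>B\<^sub>0\<close> too many eigenvalues below \<open>\<mu>\<^sub>k\<close>.
\<close>

section \<open>Hermitian forms\<close>

text \<open>The operator domains \<open>DA t\<close> vary with \<open>t\<close>; only the form
  domain is shared. Eigenvalue equations for different \<open>t\<close> are therefore compared
  through the forms, tested on fixed vectors. Holomorphy is known only for each fixed pair of
  vectors, and this is why Baire enters: closed forms are lower semicontinuous, so two of them with
  a common domain bound each other, and then the quotients of the increment by \<open>t\<close> and
  of the second-order remainder by \<open>t^2\<close>, bounded for each vector, are bounded
  uniformly. The threshold \<open>\<Sigma> t\<close> controls \<open>a t\<close> on a weakly null
  sequence only asymptotically, with no uniformity in \<open>t\<close>. So a small \<open>t\<close>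
  is fixed first, depending only on the tolerance, and the index of the sequence tends to infinity
  afterwards. Dividing the energy balance by \<open>t\<close> could let the negative part of
  \<open>a 0\<close> blow up; it does not, since the overlap of an eigenvector with \<open>N\<close>
  is itself of order \<open>t\<close>. Strong convergence is essential for the final count: only
  then do the limits of orthonormal eigenvectors remain orthonormal.\<close>

locale hermitian_form =
  fixes D :: "'a::complex_hilbert set" and q :: "'a \<Rightarrow> 'a \<Rightarrow> complex"
  assumes symmetric: "symmetric_form D q"
begin

lemma subspace: "cvec.subspace D"
  using symmetric by (auto simp: symmetric_form_def sesquilinear_form_def)

lemmas zero_mem = cvec.subspace_0[OF subspace]
  and add_mem = cvec.subspace_add[OF subspace]
  and diff_mem = cvec.subspace_diff[OF subspace]
  and scale_mem = cvec.subspace_scale[OF subspace]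
  and sum_mem = cvec.subspace_sum[OF subspace]

lemma
  assumes "x \<in> D" "y \<in> D" "z \<in> D"
  shows add_left: "q (x + y) z = q x z + q y z"
    and add_right: "q z (x + y) = q z x + q z y"
  using symmetric assms unfolding symmetric_form_def sesquilinear_form_def by blast+

lemma
  assumes "x \<in> D" "z \<in> D"
  shows scale_left: "q (c *\<^sub>C x) z = c * q x z"
    and scale_right: "q z (c *\<^sub>C x) = cnj c * q z x"
  using symmetric assms unfolding symmetric_form_def sesquilinear_form_def by blast+

lemma sym: "x \<in> D \<Longrightarrow> y \<in> D \<Longrightarrow> q x y = cnj (q y x)"
  using symmetric unfolding symmetric_form_def by blast

lemma self_real: "x \<in> D \<Longrightarrow> q x x = of_real (Re (q x x))"
  using sym[of x x] by (simp add: complex_eq_iff)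

lemma
  assumes "x \<in> D" "y \<in> D" "z \<in> D"
  shows diff_left: "q (x - y) z = q x z - q y z"
    and diff_right: "q z (x - y) = q z x - q z y"
  using add_left[of "x - y" y z] add_right[of "x - y" y z] diff_mem assms by auto

lemma
  assumes "z \<in> D"
  shows zero_left: "q 0 z = 0" and zero_right: "q z 0 = 0"
  using diff_left[of z z z] diff_right[of z z z] assms by auto

lemma
  assumes "z \<in> D" "\<And>i. i \<in> I \<Longrightarrow> f i \<in> D"
  shows sum_left: "q (\<Sum>i\<in>I. f i) z = (\<Sum>i\<in>I. q (f i) z)"
    and sum_right: "q z (\<Sum>i\<in>I. f i) = (\<Sum>i\<in>I. q z (f i))"
  using assms
  by (induction I rule: infinite_finite_induct)
    (auto simp: zero_left zero_right add_left add_right sum_mem)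

lemma quad_scale: "x \<in> D \<Longrightarrow> Re (q (c *\<^sub>C x) (c *\<^sub>C x)) = (cmod c)\<^sup>2 * Re (q x x)"
proof -
  assume x: "x \<in> D"
  have "q (c *\<^sub>C x) (c *\<^sub>C x) = (c * cnj c) * q x x"
    using x scale_mem by (simp add: scale_left scale_right)
  then show ?thesis
    using self_real[OF x] by (simp add: complex_norm_square[symmetric] del: of_real_power)
qed

lemma quad_add:
  assumes "x \<in> D" "y \<in> D"
  shows "Re (q (x + y) (x + y)) = Re (q x x) + 2 * Re (q x y) + Re (q y y)"
  using assms add_mem sym[of y x] by (simp add: add_left add_right)

lemma quad_diff:
  assumes "x \<in> D" "y \<in> D"
  shows "Re (q (x - y) (x - y)) = Re (q x x) - 2 * Re (q x y) + Re (q y y)"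
  using assms diff_mem sym[of y x] by (simp add: diff_left diff_right)

lemma quad_minus_commute:
  assumes "x \<in> D" "y \<in> D"
  shows "Re (q (x - y) (x - y)) = Re (q (y - x) (y - x))"
  using assms sym[of y x] by (simp add: quad_diff)

end

lemma hermitian_form_sub:
  assumes "hermitian_form D q" "cvec.subspace E" "E \<subseteq> D"
  shows "hermitian_form E q"
  using assms unfolding hermitian_form_def symmetric_form_def sesquilinear_form_def
  by (meson subsetD)

text \<open>AM-GM read backwards: the infimum over \<open>s\<close> of
  \<open>(s * u + v / s) / 2\<close> is \<open>sqrt u * sqrt v\<close>. The optimal
  \<open>s = sqrt (v / u)\<close> degenerates if \<open>u\<close> or \<open>v\<close> vanishes,
  hence the perturbation by \<open>e\<close> and the limit.\<close>

lemma geometric_mean_bound: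
  fixes A C u v :: real
  assumes "\<And>s. s > 0 \<Longrightarrow> A \<le> C * (s * u + v / s) / 2" "u \<ge> 0" "v \<ge> 0" "C \<ge> 0"
  shows "A \<le> C * (sqrt u * sqrt v)"
proof (rule tendsto_lowerbound)
  show "((\<lambda>e. C * (sqrt (u + e) * sqrt (v + e))) \<longlongrightarrow> C * (sqrt u * sqrt v)) (at_right 0)"
    by (auto intro!: tendsto_eq_intros)
  show "\<forall>\<^sub>F e in at_right 0. A \<le> C * (sqrt (u + e) * sqrt (v + e))"
    using eventually_at_right_less
  proof (rule eventually_mono)
    fix e :: real assume e: "0 < e"
    define a b where "a = sqrt (u + e)" and "b = sqrt (v + e)"
    have ab: "a > 0" "b > 0" "u \<le> a\<^sup>2" "v \<le> b\<^sup>2" using e assms by (auto simp: a_def b_def)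
    have "A \<le> C * ((b / a) * u + v / (b / a)) / 2" using ab by (intro assms(1)) auto
    also have "\<dots> \<le> C * ((b / a) * a\<^sup>2 + b\<^sup>2 / (b / a)) / 2"
      using ab assms by (intro divide_right_mono mult_left_mono add_mono) auto
    also have "\<dots> = C * (a * b)" using ab by (simp add: field_simps power2_eq_square)
    finally show "A \<le> C * (sqrt (u + e) * sqrt (v + e))" by (simp add: a_def b_def)
  qed
qed simp

locale positive_form = hermitian_form +
  assumes nonneg: "x \<in> D \<Longrightarrow> 0 \<le> Re (q x x)"
begin

text \<open>Off-diagonal values obey the diagonal bound with the same constant. A phase makes
  \<open>F x y\<close> real, polarization expresses it by two diagonal values, the parallelogram law
  for \<open>q\<close> adds their bounds, and optimising the weights \<open>sqrt s\<close> and
  \<open>1 / sqrt s\<close> turns the sum of squares into a product.\<close>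

lemma form_bound_polarize:
  assumes "hermitian_form D F" and C: "\<And>x. x \<in> D \<Longrightarrow> \<bar>Re (F x x)\<bar> \<le> C * Re (q x x)" "C \<ge> 0"
    and x: "x \<in> D" and y: "y \<in> D"
  shows "cmod (F x y) \<le> C * (sqrt (Re (q x x)) * sqrt (Re (q y y)))"
proof -
  interpret F: hermitian_form D F by fact
  have "cmod (F x y) \<le> C * (s * Re (q x x) + Re (q y y) / s) / 2" if s: "s > 0" for s
  proof -
    obtain u where u: "cmod u = 1" "u * F x y = of_real (cmod (F x y))"
    proof (cases "F x y = 0")
      case True then show ?thesis using that[of 1] by simp
    next
      case False
      then show ?thesis
        using that[of "cnj (F x y) / of_real (cmod (F x y))"]
        by (simp add: norm_divide complex_norm_square[symmetric] power2_eq_square mult.commute)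
    qed
    define X Y where "X = (of_real (sqrt s) * u) *\<^sub>C x" and "Y = complex_of_real (1 / sqrt s) *\<^sub>C y"
    have XY: "X \<in> D" "Y \<in> D" using x y scale_mem by (auto simp: X_def Y_def)
    have "F X Y = of_real (sqrt s) * of_real (1 / sqrt s) * (u * F x y)"
      unfolding X_def Y_def using x y XY scale_mem by (simp add: F.scale_left F.scale_right)
    also have "\<dots> = of_real (cmod (F x y))" using s u by simp
    finally have "4 * cmod (F x y) = Re (F (X + Y) (X + Y)) - Re (F (X - Y) (X - Y))"
      using XY by (simp add: F.quad_add F.quad_diff)
    also have "\<dots> \<le> C * Re (q (X + Y) (X + Y)) + C * Re (q (X - Y) (X - Y))"
      using C(1)[of "X + Y"] C(1)[of "X - Y"] XY add_mem diff_mem by (auto simp: abs_le_iff)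
    also have "\<dots> = 2 * C * (Re (q X X) + Re (q Y Y))"
      using XY by (simp add: quad_add quad_diff algebra_simps)
    also have "Re (q X X) = s * Re (q x x)"
      using x u s unfolding X_def by (subst quad_scale) (auto simp: norm_mult)
    also have "Re (q Y Y) = Re (q y y) / s"
      using y u s unfolding Y_def by (subst quad_scale) (auto simp: norm_divide power_divide)
    finally show ?thesis by simp
  qed
  then show ?thesis by (rule geometric_mean_bound) (use nonneg x y C in auto)
qed

lemma Cauchy_Schwarz:
  assumes "x \<in> D" "y \<in> D"
  shows "cmod (q x y) \<le> sqrt (Re (q x x)) * sqrt (Re (q y y))"
  using form_bound_polarize[of q 1 x y] assms nonneg hermitian_form_axioms by simp

lemma triangle:
  assumes "x \<in> D" "y \<in> D"
  shows "sqrt (Re (q (x + y) (x + y))) \<le> sqrt (Re (q x x)) + sqrt (Re (q y y))"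
proof (rule real_le_lsqrt)
  have "Re (q x y) \<le> sqrt (Re (q x x)) * sqrt (Re (q y y))"
    using Cauchy_Schwarz[OF assms] complex_Re_le_cmod order_trans by blast
  then show "Re (q (x + y) (x + y)) \<le> (sqrt (Re (q x x)) + sqrt (Re (q y y)))\<^sup>2"
    using assms nonneg by (simp add: quad_add power2_sum)
qed (use assms nonneg add_mem in auto)

lemma triangle_diff:
  assumes "x \<in> D" "y \<in> D" "z \<in> D"
  shows "sqrt (Re (q (x - z) (x - z))) \<le> sqrt (Re (q (x - y) (x - y))) + sqrt (Re (q (y - z) (y - z)))"
  using triangle[of "x - y" "y - z"] assms diff_mem by simp

lemma tendsto_form_left:
  assumes "\<And>n. x n \<in> D" "l \<in> D" "y \<in> D" "(\<lambda>n. Re (q (x n - l) (x n - l))) \<longlonglongrightarrow> 0"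
  shows "(\<lambda>n. q (x n) y) \<longlonglongrightarrow> q l y"
proof -
  have "(\<lambda>n. sqrt (Re (q (x n - l) (x n - l))) * sqrt (Re (q y y))) \<longlonglongrightarrow> sqrt 0 * sqrt (Re (q y y))"
    by (intro tendsto_intros assms)
  then have lim: "(\<lambda>n. sqrt (Re (q (x n - l) (x n - l))) * sqrt (Re (q y y))) \<longlonglongrightarrow> 0" by simp
  have "norm (q (x n) y - q l y) \<le> sqrt (Re (q (x n - l) (x n - l))) * sqrt (Re (q y y))" for n
    using assms diff_mem[of "x n" l] Cauchy_Schwarz[of "x n - l" y] by (simp add: diff_left)
  then have "(\<lambda>n. q (x n) y - q l y) \<longlonglongrightarrow> 0"
    by (intro Lim_null_comparison[OF _ lim] always_eventually allI)
  then show ?thesis by (simp add: LIM_zero_iff)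
qed

lemma tendsto_quad:
  assumes F: "hermitian_form D F" and C: "\<And>x. x \<in> D \<Longrightarrow> \<bar>Re (F x x)\<bar> \<le> C * Re (q x x)"
    and x: "\<And>n. x n \<in> D" "l \<in> D" "(\<lambda>n. Re (q (x n - l) (x n - l))) \<longlonglongrightarrow> 0"
  shows "(\<lambda>n. Re (F (x n) (x n))) \<longlonglongrightarrow> Re (F l l)"
proof -
  interpret F: hermitian_form D F by fact
  \<comment> \<open>No sign of \<open>C\<close> is assumed, while the polarized bound needs a
    nonnegative constant.\<close>
  define K where "K = max C 0"
  have K: "\<bar>Re (F x x)\<bar> \<le> K * Re (q x x)" if "x \<in> D" for x
    using C[OF that] nonneg[OF that] mult_right_mono[of C K] unfolding K_def by fastforce
  define e where "e n = Re (q (x n - l) (x n - l))" for n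
  have "(\<lambda>n. K * e n + 2 * (K * (sqrt (e n) * sqrt (Re (q l l))))) \<longlonglongrightarrow>
      K * 0 + 2 * (K * (sqrt 0 * sqrt (Re (q l l))))"
    unfolding e_def by (intro tendsto_intros x)
  then have lim: "(\<lambda>n. K * e n + 2 * (K * (sqrt (e n) * sqrt (Re (q l l))))) \<longlonglongrightarrow> 0" by simp
  have "norm (Re (F (x n) (x n)) - Re (F l l)) \<le> K * e n + 2 * (K * (sqrt (e n) * sqrt (Re (q l l))))" for n
  proof -
    define w where "w = x n - l"
    have w: "w \<in> D" "x n = w + l" using x diff_mem by (auto simp: w_def)
    have "\<bar>Re (F w l)\<bar> \<le> K * (sqrt (e n) * sqrt (Re (q l l)))"
      using form_bound_polarize[OF F K _ w(1) x(2)] abs_Re_le_cmod[of "F w l"]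
      by (auto simp: K_def e_def w_def)
    moreover have "\<bar>Re (F w w)\<bar> \<le> K * e n" using K[OF w(1)] by (simp add: e_def w_def)
    ultimately show ?thesis using w x by (simp add: F.quad_add)
  qed
  then have "(\<lambda>n. Re (F (x n) (x n)) - Re (F l l)) \<longlonglongrightarrow> 0"
    by (intro Lim_null_comparison[OF _ lim] always_eventually allI)
  then show ?thesis by (simp add: LIM_zero_iff)
qed

end

text \<open>\<open>D\<close> with inner product \<open>q\<close> is a Hilbert space continuously
  embedded in the ambient one. It is kept as a set with a completeness clause for sequences, so that
  form domains and closed subspaces become instances over one type.\<close>

locale hilbert_form = hermitian_form +
  assumes norm_le: "x \<in> D \<Longrightarrow> (norm x)\<^sup>2 \<le> Re (q x x)"
    and complete: "(\<And>n. u n \<in> D) \<Longrightarrow>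
      (\<And>e. e > 0 \<Longrightarrow> \<exists>N. \<forall>m\<ge>N. \<forall>n\<ge>N. Re (q (u m - u n) (u m - u n)) < e) \<Longrightarrow>
      \<exists>l\<in>D. (\<lambda>n. Re (q (u n - l) (u n - l))) \<longlonglongrightarrow> 0"
begin

sublocale positive_form
  by unfold_locales (meson norm_le order_trans zero_le_power2)

text \<open>Dirichlet's principle: the representing vector minimises
  \<open>Re (q x x) - 2 * Re (f x)\<close>, and the parallelogram law makes minimising sequences
  Cauchy.\<close>

lemma Riesz:
  assumes add: "\<And>x y. x \<in> D \<Longrightarrow> y \<in> D \<Longrightarrow> f (x + y) = f x + f y"
    and scale: "\<And>c x. x \<in> D \<Longrightarrow> f (c *\<^sub>C x) = c * f x"
    and bound: "\<And>x. x \<in> D \<Longrightarrow> cmod (f x) \<le> C * sqrt (Re (q x x))"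
  shows "\<exists>g\<in>D. \<forall>x\<in>D. f x = q x g"
proof -
  define J where "J x = Re (q x x) - 2 * Re (f x)" for x
  have J_lower: "J x \<ge> - C\<^sup>2" if "x \<in> D" for x
  proof -
    have "0 \<le> (sqrt (Re (q x x)) - C)\<^sup>2" by simp
    also have "\<dots> = Re (q x x) - 2 * (C * sqrt (Re (q x x))) + C\<^sup>2"
      using nonneg[OF that] by (simp add: power2_diff)
    finally show ?thesis using bound[OF that] complex_Re_le_cmod[of "f x"] by (simp add: J_def)
  qed
  define j where "j = Inf (J ` D)"
  have bdd: "bdd_below (J ` D)" using J_lower by (intro bdd_belowI) auto
  have j_le: "j \<le> J x" if "x \<in> D" for x
    unfolding j_def using bdd that by (intro cInf_lower) auto
  have "\<exists>x\<in>D. J x < j + 1 / Suc n" for n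
    using cInf_lessD[of "J ` D" "j + 1 / Suc n"] zero_mem by (auto simp: j_def)
  then obtain x where x: "\<And>n. x n \<in> D" "\<And>n. J (x n) < j + 1 / Suc n" by metis
  have J_lim: "(\<lambda>n. J (x n)) \<longlonglongrightarrow> j"
  proof (rule tendsto_sandwich[of "\<lambda>_. j" _ _ "\<lambda>n. j + 1 / Suc n"])
    show "(\<lambda>n. j + 1 / Suc n) \<longlonglongrightarrow> j"
      using tendsto_add[OF tendsto_const LIMSEQ_inverse_real_of_nat, of j] by (simp add: field_simps)
    show "\<forall>\<^sub>F n in sequentially. J (x n) \<le> j + 1 / Suc n"
      using x(2) by (intro always_eventually allI less_imp_le)
    show "\<forall>\<^sub>F n in sequentially. j \<le> J (x n)" using j_le x(1) by auto
  qed simp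
  \<comment> \<open>Comparison with the midpoint \<open>w\<close>, where \<open>J w\<close> is at
    least \<open>j\<close>; the linear parts of \<open>J\<close> cancel.\<close>
  have para: "Re (q (u - v) (u - v)) \<le> 2 * (J u - j) + 2 * (J v - j)" if "u \<in> D" "v \<in> D" for u v
  proof -
    define w where "w = complex_of_real (1/2) *\<^sub>C (u + v)"
    have w: "w \<in> D" using that add_mem scale_mem by (auto simp: w_def)
    have "Re (q w w) = Re (q (u + v) (u + v)) / 4"
      unfolding w_def using that add_mem by (subst quad_scale) (auto simp: power2_eq_square)
    moreover have "Re (f w) = (Re (f u) + Re (f v)) / 2" using that add_mem by (simp add: w_def scale add)
    ultimately have "4 * J w = Re (q (u + v) (u + v)) - 4 * Re (f u) - 4 * Re (f v)"
      unfolding J_def by argo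
    then show ?thesis
      using j_le[OF w] quad_add[OF that] quad_diff[OF that] unfolding J_def
      by (smt (verit))
  qed
  have "\<exists>N. \<forall>m\<ge>N. \<forall>n\<ge>N. Re (q (x m - x n) (x m - x n)) < e" if "e > 0" for e
  proof -
    have "\<forall>\<^sub>F n in sequentially. J (x n) < j + e / 4"
      by (rule order_tendstoD[OF J_lim]) (use that in auto)
    then obtain N where N: "\<And>n. n \<ge> N \<Longrightarrow> J (x n) < j + e / 4"
      by (auto simp: eventually_sequentially)
    have "Re (q (x m - x n) (x m - x n)) < e" if "m \<ge> N" "n \<ge> N" for m n
      using para[OF x(1) x(1), of m n] N[OF that(1)] N[OF that(2)] by argo
    then show ?thesis by blast
  qed
  from complete[of x, OF x(1) this] obtain g
    where g: "g \<in> D" "(\<lambda>n. Re (q (x n - g) (x n - g))) \<longlonglongrightarrow> 0" by blast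
  have Re_eq: "Re (q g h) = Re (f h)" if h: "h \<in> D" for h
  proof -
    define b where "b = Re (q g h) - Re (f h)"
    \<comment> \<open>First variation in direction \<open>h\<close>: \<open>J\<close> at
      \<open>x n + s h\<close> is at least \<open>j\<close>, and \<open>n\<close> tends to infinity.
      Validity for all real \<open>s\<close> forces the linear coefficient \<open>b\<close> to
      vanish.\<close>
    have main: "0 \<le> 2 * s * b + s\<^sup>2 * Re (q h h)" for s :: real
    proof (rule tendsto_lowerbound)
      show "\<forall>\<^sub>F n in sequentially. 0 \<le> J (x n) - j + 2 * s * (Re (q (x n) h) - Re (f h)) + s\<^sup>2 * Re (q h h)"
      proof (intro always_eventually allI)
        fix n
        define w where "w = complex_of_real s *\<^sub>C h"
        have w: "w \<in> D" using h scale_mem by (auto simp: w_def)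
        have "J (x n + w) = J (x n) + 2 * s * (Re (q (x n) h) - Re (f h)) + s\<^sup>2 * Re (q h h)"
          using w x(1)[of n] h quad_scale[OF h, of "of_real s"]
          by (simp add: J_def quad_add add)
             (simp add: w_def scale scale_right algebra_simps)
        with j_le[of "x n + w"] w x(1)[of n] add_mem
        show "0 \<le> J (x n) - j + 2 * s * (Re (q (x n) h) - Re (f h)) + s\<^sup>2 * Re (q h h)" by auto
      qed
      have "(\<lambda>n. J (x n) - j + 2 * s * (Re (q (x n) h) - Re (f h)) + s\<^sup>2 * Re (q h h)) \<longlonglongrightarrow>
          j - j + 2 * s * (Re (q g h) - Re (f h)) + s\<^sup>2 * Re (q h h)"
        by (intro tendsto_intros J_lim tendsto_form_left x g h)
      then show "(\<lambda>n. J (x n) - j + 2 * s * (Re (q (x n) h) - Re (f h)) + s\<^sup>2 * Re (q h h)) \<longlonglongrightarrow>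
          2 * s * b + s\<^sup>2 * Re (q h h)" by (simp add: b_def)
    qed simp
    \<comment> \<open>The inequality is used at \<open>s = - b / c\<close>; the \<open>+ 1\<close>
      keeps the division legitimate when \<open>q h h\<close> is zero.\<close>
    define c where "c = Re (q h h) + 1"
    have c: "c > 0" using nonneg[OF h] by (simp add: c_def)
    have "0 \<le> 2 * (- b / c) * b + (- b / c)\<^sup>2 * Re (q h h)" by (rule main)
    also have "\<dots> \<le> 2 * (- b / c) * b + (- b / c)\<^sup>2 * c"
      by (intro add_left_mono mult_left_mono) (auto simp: c_def)
    also have "\<dots> = - (b\<^sup>2 / c)" using c by (simp add: field_simps power2_eq_square)
    finally have "b\<^sup>2 / c \<le> 0" by simp
    then have "b = 0" using c by (simp add: divide_le_0_iff)
    then show ?thesis by (simp add: b_def)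
  qed
  have "f h = q h g" if h: "h \<in> D" for h
  proof -
    have ih: "\<i> *\<^sub>C h \<in> D" using h scale_mem by blast
    have "Im (q g h) = - Im (f h)"
      using Re_eq[OF ih] h g by (simp add: scale scale_right)
    then show ?thesis using Re_eq[OF h] sym[OF h g(1)] by (simp add: complex_eq_iff)
  qed
  with g show ?thesis by blast
qed

end

section \<open>Complex Hilbert spaces\<close>

lemma tendsto_if_norm_squared:
  fixes x :: "nat \<Rightarrow> 'a::real_normed_vector"
  assumes "(\<lambda>n. (norm (x n - l))\<^sup>2) \<longlonglongrightarrow> 0"
  shows "x \<longlonglongrightarrow> l"
proof -
  have "(\<lambda>n. sqrt ((norm (x n - l))\<^sup>2)) \<longlonglongrightarrow> sqrt 0" using assms by (rule tendsto_real_sqrt)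
  then show ?thesis by (simp add: LIM_zero_iff tendsto_norm_zero_iff)
qed

text \<open>Stated for closed subspaces and not just for the whole space, since Riesz is applied
  inside one in the weak compactness argument.\<close>

lemma closed_subspace_hilbert_form:
  assumes G: "cvec.subspace G" "closed G"
  shows "hilbert_form (G :: 'a::complex_hilbert set) cinner"
proof
  have "cinner (z::'a) (x + y) = cinner z x + cinner z y" for x y z
    by (subst (1 2 3) cinner_commute) (simp add: cinner_add_left)
  moreover have "cinner (z::'a) (c *\<^sub>C x) = cnj c * cinner z x" for x z c
    by (subst (1 2) cinner_commute) (simp add: cinner_scaleC_left)
  ultimately show "symmetric_form G cinner"
    using G(1) unfolding symmetric_form_def sesquilinear_form_def
    by (auto simp: cinner_add_left cinner_scaleC_left intro: cinner_commute)
  show "(norm x)\<^sup>2 \<le> Re (cinner x x)" for x :: 'a by (simp add: cinner_self)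
  fix u :: "nat \<Rightarrow> 'a"
  assume u: "\<And>n. u n \<in> G"
    and C: "\<And>e. e > 0 \<Longrightarrow> \<exists>N. \<forall>m\<ge>N. \<forall>n\<ge>N. Re (cinner (u m - u n) (u m - u n)) < e"
  have "Cauchy u"
  proof (rule metric_CauchyI)
    fix e :: real assume e: "0 < e"
    from C[of "e\<^sup>2"] e obtain N where N: "\<And>m n. m \<ge> N \<Longrightarrow> n \<ge> N \<Longrightarrow> (norm (u m - u n))\<^sup>2 < e\<^sup>2"
      by (auto simp: cinner_self)
    have "dist (u m) (u n) < e" if "m \<ge> N" "n \<ge> N" for m n
      using power_less_imp_less_base[OF N[OF that]] e by (simp add: dist_norm)
    then show "\<exists>N. \<forall>m\<ge>N. \<forall>n\<ge>N. dist (u m) (u n) < e" by blast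
  qed
  then obtain l where l: "u \<longlonglongrightarrow> l" using Cauchy_convergent convergent_def by blast
  then have "l \<in> G" using G(2) u closed_sequentially by blast
  moreover have "(\<lambda>n. (norm (u n - l))\<^sup>2) \<longlonglongrightarrow> 0"
    using l by (auto intro!: tendsto_eq_intros)
  ultimately show "\<exists>l\<in>G. (\<lambda>n. Re (cinner (u n - l) (u n - l))) \<longlonglongrightarrow> 0"
    by (auto simp: cinner_self)
qed

interpretation ip: hilbert_form UNIV "cinner :: 'a::complex_hilbert \<Rightarrow> _"
  by (rule closed_subspace_hilbert_form) auto

lemmas cinner_add_right = ip.add_right[OF UNIV_I UNIV_I UNIV_I]
  and cinner_scaleC_right = ip.scale_right[OF UNIV_I UNIV_I]
  and cinner_diff_left = ip.diff_left[OF UNIV_I UNIV_I UNIV_I]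
  and cinner_diff_right = ip.diff_right[OF UNIV_I UNIV_I UNIV_I]
  and cinner_zero_left [simp] = ip.zero_left[OF UNIV_I]
  and cinner_zero_right [simp] = ip.zero_right[OF UNIV_I]
  and cinner_sum_left = ip.sum_left[OF UNIV_I UNIV_I]
  and cinner_sum_right = ip.sum_right[OF UNIV_I UNIV_I]

lemma cinner_CS: "cmod (cinner x y) \<le> norm x * norm (y::'a::complex_hilbert)"
  using ip.Cauchy_Schwarz[of x y] by (simp add: cinner_self)

lemma cinner_self_eq_0 [simp]: "cinner x x = 0 \<longleftrightarrow> x = (0::'a::complex_hilbert)"
  by (simp add: cinner_self)

lemma norm_scaleC [simp]: "norm (c *\<^sub>C x) = cmod c * norm (x::'a::complex_hilbert)"
proof -
  have "(norm (c *\<^sub>C x))\<^sup>2 = (cmod c * norm x)\<^sup>2"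
    using ip.quad_scale[of x c] by (simp add: cinner_self power_mult_distrib)
  then show ?thesis by (simp add: power2_eq_iff_nonneg)
qed

lemma cinner_eq_imp_eq: "(\<And>y. cinner x y = cinner z y) \<Longrightarrow> x = (z::'a::complex_hilbert)"
  using cinner_self_eq_0[of "x - z"] by (simp add: cinner_diff_left)

lemma norm_diff_squared:
  "(norm (x - y::'a::complex_hilbert))\<^sup>2 = (norm x)\<^sup>2 - 2 * Re (cinner x y) + (norm y)\<^sup>2"
  using ip.quad_diff[of x y] by (simp add: cinner_self)

lemma norm_add_squared:
  "(norm (x + y::'a::complex_hilbert))\<^sup>2 = (norm x)\<^sup>2 + 2 * Re (cinner x y) + (norm y)\<^sup>2"
  using ip.quad_add[of x y] by (simp add: cinner_self)

lemma tendsto_cinner_left: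
  assumes "x \<longlonglongrightarrow> (l::'a::complex_hilbert)"
  shows "(\<lambda>n. cinner (x n) y) \<longlonglongrightarrow> cinner l y"
proof (rule ip.tendsto_form_left)
  show "(\<lambda>n. Re (cinner (x n - l) (x n - l))) \<longlonglongrightarrow> 0"
    using assms by (auto simp: cinner_self intro!: tendsto_eq_intros)
qed auto

lemma tendsto_cinner:
  assumes "x \<longlonglongrightarrow> (l::'a::complex_hilbert)" "y \<longlonglongrightarrow> m"
  shows "(\<lambda>n. cinner (x n) (y n)) \<longlonglongrightarrow> cinner l m"
proof -
  have "(\<lambda>n. norm (x n) * norm (y n - m)) \<longlonglongrightarrow> norm l * 0"
    by (intro tendsto_mult tendsto_norm assms tendsto_norm_zero LIM_zero)
  then have "(\<lambda>n. cinner (x n) (y n - m)) \<longlonglongrightarrow> 0"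
    by (intro Lim_null_comparison[OF always_eventually, OF allI, OF cinner_CS]) simp
  then have "(\<lambda>n. cinner (x n) (y n - m) + cinner (x n) m) \<longlonglongrightarrow> 0 + cinner l m"
    by (intro tendsto_add tendsto_cinner_left assms)
  then show ?thesis by (simp add: cinner_diff_right)
qed

section \<open>Weak sequential compactness\<close>

definition weakly_convergent_to :: "(nat \<Rightarrow> 'a::complex_hilbert) \<Rightarrow> 'a \<Rightarrow> bool" where
  "weakly_convergent_to x l \<longleftrightarrow> (\<forall>y. (\<lambda>n. cinner (x n) y) \<longlonglongrightarrow> cinner l y)"

text \<open>The space may be nonseparable. A diagonal subsequence makes the inner products with
  every \<open>x m\<close> converge, and the vectors \<open>y\<close> for which the inner products
  converge form a closed subspace \<open>G\<close> containing all \<open>x m\<close>. An arbitrary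
  \<open>y\<close> has a Riesz representative in \<open>G\<close> with the same inner products
  against the sequence, so \<open>G\<close> is everything.\<close>

lemma bounded_weakly_convergent_subsequence:
  fixes x :: "nat \<Rightarrow> 'a::complex_hilbert"
  assumes B: "\<And>n. norm (x n) \<le> B"
  obtains r l where "strict_mono r" "weakly_convergent_to (x \<circ> r) l"
proof -
  have B0: "B \<ge> 0" using B[of 0] norm_ge_zero order_trans by blast
  obtain r :: "nat \<Rightarrow> nat" where r: "strict_mono r"
    and conv: "\<And>m. m \<in> UNIV \<Longrightarrow> \<exists>l. (\<lambda>n. cinner (x (r n)) (x m)) \<longlonglongrightarrow> l"
  proof (rule function_convergent_subsequence[of UNIV "\<lambda>n m. cinner (x n) (x m)" "B * B"])
    show "norm (cinner (x n) (x m)) \<le> B * B" for n m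
      using cinner_CS[of "x n" "x m"] mult_mono[OF B[of n] B[of m]] B0 by auto
  qed auto
  define G where "G = {y. convergent (\<lambda>n. cinner (x (r n)) y)}"
  have xG: "x m \<in> G" for m using conv by (auto simp: G_def convergent_def)
  have subspace: "cvec.subspace G"
    by (auto simp: cvec.subspace_def G_def cinner_add_right cinner_scaleC_right
        intro!: convergent_const convergent_add convergent_mult)
  have "closed G"
    unfolding closed_sequential_limits
  proof (intro allI impI, elim conjE)
    fix y l assume y: "\<forall>j. y j \<in> G" "y \<longlonglongrightarrow> l"
    have "Cauchy (\<lambda>n. cinner (x (r n)) l)"
    proof (rule metric_CauchyI)
      fix e :: real assume e: "e > 0"
      then have "e / (4 * (B + 1)) > 0" using B0 by simp
      then obtain j where j: "norm (y j - l) < e / (4 * (B + 1))"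
        using y(2) LIMSEQ_iff by (metis order_refl)
      have "Cauchy (\<lambda>n. cinner (x (r n)) (y j))"
        using y(1) by (simp add: G_def Cauchy_convergent_iff)
      from metric_CauchyD[OF this, of "e/2"] e obtain N where
        N: "\<And>m n. m \<ge> N \<Longrightarrow> n \<ge> N \<Longrightarrow> dist (cinner (x (r m)) (y j)) (cinner (x (r n)) (y j)) < e / 2" by auto
      have est: "dist (cinner (x (r n)) (y j)) (cinner (x (r n)) l) < e / 4" for n
      proof -
        have "dist (cinner (x (r n)) (y j)) (cinner (x (r n)) l) \<le> norm (x (r n)) * norm (y j - l)"
          unfolding dist_norm cinner_diff_right[symmetric] by (rule cinner_CS)
        also have "\<dots> \<le> (B + 1) * norm (y j - l)"
          by (intro mult_right_mono) (use B[of "r n"] in auto)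
        also have "\<dots> < (B + 1) * (e / (4 * (B + 1)))"
          by (intro mult_strict_left_mono j) (use B0 in auto)
        also have "\<dots> = e / 4" using B0 by (simp add: field_simps)
        finally show ?thesis .
      qed
      have "dist (cinner (x (r m)) l) (cinner (x (r n)) l) < e" if "m \<ge> N" "n \<ge> N" for m n
        using N[OF that] est[of m] est[of n]
          dist_triangle2[of "cinner (x (r m)) l" "cinner (x (r n)) l" "cinner (x (r m)) (y j)"]
          dist_triangle2[of "cinner (x (r m)) (y j)" "cinner (x (r n)) l" "cinner (x (r n)) (y j)"]
        by (simp add: dist_commute)
      then show "\<exists>N. \<forall>m\<ge>N. \<forall>n\<ge>N. dist (cinner (x (r m)) l) (cinner (x (r n)) l) < e" by blast
    qed
    then show "l \<in> G" by (simp add: G_def Cauchy_convergent_iff)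
  qed
  interpret G: hilbert_form G cinner by (rule closed_subspace_hilbert_form) fact+
  have "y \<in> G" for y
  proof -
    have "\<exists>g\<in>G. \<forall>v\<in>G. cinner v y = cinner v g"
      by (rule G.Riesz[where C = "norm y"])
        (use cinner_CS[of _ y] in \<open>auto simp: cinner_add_left cinner_scaleC_left cinner_self mult.commute\<close>)
    then obtain g where "g \<in> G" "\<And>n. cinner (x n) y = cinner (x n) g" using xG by blast
    then show ?thesis by (simp add: G_def)
  qed
  then have conv: "convergent (\<lambda>n. cinner (x (r n)) y)" for y by (simp add: G_def)
  \<comment> \<open>Conjugation makes the limit functional linear in \<open>y\<close>, as Riesz
    requires.\<close>
  define f where "f y = cnj (lim (\<lambda>n. cinner (x (r n)) y))" for y
  have f: "(\<lambda>n. cinner y (x (r n))) \<longlonglongrightarrow> f y" for y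
    using tendsto_cnj[OF conv[THEN convergent_LIMSEQ_iff[THEN iffD1]], of y]
    by (simp add: f_def cinner_commute[of y])
  have "\<exists>l\<in>UNIV. \<forall>y\<in>UNIV. f y = cinner y l"
  proof (rule ip.Riesz[where C = B])
    show "f (y + z) = f y + f z" for y z
      using tendsto_add[OF f[of y] f[of z]] f[of "y + z"] LIMSEQ_unique
      by (auto simp: cinner_add_left)
    show "f (c *\<^sub>C y) = c * f y" for c y
      using tendsto_mult_left[OF f[of y], of c] f[of "c *\<^sub>C y"] LIMSEQ_unique
      by (auto simp: cinner_scaleC_left)
    show "cmod (f y) \<le> B * sqrt (Re (cinner y y))" for y
    proof (rule tendsto_upperbound[OF tendsto_norm[OF f[of y]]])
      have "cmod (cinner y (x (r n))) \<le> norm y * B" for n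
        using cinner_CS[of y "x (r n)"] mult_left_mono[OF B[of "r n"], of "norm y"] by simp
      then show "\<forall>\<^sub>F n in sequentially. cmod (cinner y (x (r n))) \<le> B * sqrt (Re (cinner y y))"
        by (simp add: cinner_self mult.commute)
    qed simp
  qed
  then obtain l where l: "\<And>y. f y = cinner y l" by auto
  have "weakly_convergent_to (x \<circ> r) l"
    unfolding weakly_convergent_to_def
  proof
    fix y
    show "(\<lambda>n. cinner ((x \<circ> r) n) y) \<longlonglongrightarrow> cinner l y"
      using tendsto_cnj[OF f[of y]] by (simp add: l cinner_commute[of _ y])
  qed
  with r that show ?thesis by blast
qed

lemma weakly_convergent_to_subseq:
  "weakly_convergent_to x l \<Longrightarrow> strict_mono r \<Longrightarrow> weakly_convergent_to (x \<circ> r) l"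
  unfolding weakly_convergent_to_def
  using LIMSEQ_subseq_LIMSEQ by (fastforce simp: o_def)

section \<open>Orthonormal sets\<close>

definition orthonormal :: "'a::complex_hilbert set \<Rightarrow> bool" where
  "orthonormal S \<longleftrightarrow> (\<forall>x\<in>S. \<forall>y\<in>S. cinner x y = (if x = y then 1 else 0))"

definition orth_compl :: "'a::complex_hilbert set \<Rightarrow> 'a set" where
  "orth_compl S = {x. \<forall>e\<in>S. cinner x e = 0}"

definition oproj :: "'a::complex_hilbert set \<Rightarrow> 'a \<Rightarrow> 'a" where
  "oproj S x = (\<Sum>e\<in>S. cinner x e *\<^sub>C e)"

lemma orthonormal_norm: "orthonormal S \<Longrightarrow> e \<in> S \<Longrightarrow> norm e = 1"
proof -
  assume "orthonormal S" "e \<in> S"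
  then have "complex_of_real ((norm e)\<^sup>2) = 1" using cinner_self[of e] by (simp add: orthonormal_def)
  then have "(norm e)\<^sup>2 = 1" unfolding of_real_eq_1_iff .
  then show ?thesis by (simp add: power2_eq_1_iff) (use norm_ge_zero[of e] in linarith)
qed

lemma orthonormal_subset: "orthonormal S \<Longrightarrow> T \<subseteq> S \<Longrightarrow> orthonormal T"
  unfolding orthonormal_def by blast

lemma orthonormal_insert:
  assumes "orthonormal S" "norm x = 1" "x \<in> orth_compl S"
  shows "orthonormal (insert x S)" "x \<notin> S"
proof -
  have "cinner e x = 0" if "e \<in> S" for e
    using assms(3) that cinner_commute[of e x] by (simp add: orth_compl_def)
  then show "orthonormal (insert x S)"
    using assms unfolding orthonormal_def orth_compl_def by (auto simp: cinner_self)
  show "x \<notin> S" using assms unfolding orth_compl_def by (auto simp: cinner_self)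
qed

lemma subspace_orth_compl: "cvec.subspace (orth_compl S)"
  by (auto simp: orth_compl_def cvec.subspace_def cinner_add_left cinner_scaleC_left)

lemma closed_orth_compl: "closed (orth_compl S)"
  unfolding closed_sequential_limits
proof (intro allI impI, elim conjE)
  fix x l assume x: "\<forall>n. x n \<in> orth_compl S" "x \<longlonglongrightarrow> l"
  show "l \<in> orth_compl S"
    unfolding orth_compl_def
  proof (intro CollectI ballI)
    fix e assume "e \<in> S"
    then have "(\<lambda>n. cinner (x n) e) = (\<lambda>n. 0)" using x by (auto simp: orth_compl_def)
    then show "cinner l e = 0"
      using tendsto_cinner_left[OF x(2), of e] LIMSEQ_unique tendsto_const by metis
  qed
qed

lemma cinner_oproj:
  assumes "orthonormal S" "finite S" "e \<in> S"
  shows "cinner (oproj S x) e = cinner x e"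
proof -
  have "cinner (oproj S x) e = (\<Sum>f\<in>S. if f = e then cinner x f else 0)"
    unfolding oproj_def cinner_sum_left cinner_scaleC_left
    using assms by (intro sum.cong) (auto simp: orthonormal_def)
  then show ?thesis using assms by simp
qed

lemma diff_oproj_mem:
  assumes "orthonormal S" "finite S"
  shows "x - oproj S x \<in> orth_compl S"
  using cinner_oproj[OF assms] by (simp add: orth_compl_def cinner_diff_left)

lemma oproj_in_span: "oproj S x \<in> cvec.span S"
  unfolding oproj_def by (intro cvec.span_sum cvec.span_scale cvec.span_base)

lemma oproj_add: "oproj S (x + y) = oproj S x + oproj S y"
  by (simp add: oproj_def cinner_add_left scaleC_add_left sum.distrib)

lemma oproj_scale: "oproj S (c *\<^sub>C x) = c *\<^sub>C oproj S x"
  by (simp add: oproj_def cinner_scaleC_left cvec.scale_sum_right)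

lemma orth_compl_span:
  assumes "x \<in> orth_compl S" "y \<in> cvec.span S"
  shows "cinner x y = 0"
  using assms(2)
proof (induction rule: cvec.span_induct_alt)
  case (step c u v)
  then show ?case using assms(1) by (simp add: orth_compl_def cinner_add_right cinner_scaleC_right)
qed simp

lemma oproj_span:
  assumes "orthonormal S" "finite S" "x \<in> cvec.span S"
  shows "oproj S x = x"
proof -
  have "x - oproj S x \<in> cvec.span S" using assms oproj_in_span cvec.span_diff by blast
  then have "cinner (x - oproj S x) (x - oproj S x) = 0"
    using orth_compl_span diff_oproj_mem assms by blast
  then show ?thesis by simp
qed

lemma orthonormal_independent:
  assumes "orthonormal S"
  shows "cvec.independent S"
proof
  assume "cvec.dependent S"
  then obtain t u v where t: "finite t" "t \<subseteq> S" "(\<Sum>v\<in>t. u v *\<^sub>C v) = 0" "v \<in> t" "u v \<noteq> 0"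
    unfolding cvec.dependent_explicit by blast
  have "cinner (\<Sum>v\<in>t. u v *\<^sub>C v) v = (\<Sum>w\<in>t. if w = v then u w else 0)"
    unfolding cinner_sum_left cinner_scaleC_left
  proof (intro sum.cong refl)
    fix w assume "w \<in> t"
    then have "w \<in> S" "v \<in> S" using t by auto
    then show "u w * cinner w v = (if w = v then u w else 0)"
      using assms by (simp add: orthonormal_def)
  qed
  then show False using t by simp
qed

interpretation cvec_pair: vector_space_pair
  "scaleC :: complex \<Rightarrow> 'a \<Rightarrow> 'a::complex_hilbert" "scaleC :: complex \<Rightarrow> 'a \<Rightarrow> 'a"
  by unfold_locales

text \<open>Dimension count: \<open>oproj T\<close> maps the span of \<open>S\<close> into a space
  spanned by fewer vectors, so it is not injective there; the difference of two vectors with equal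
  image is orthogonal to \<open>T\<close>.\<close>

lemma exists_orthogonal_vector:
  assumes S: "cvec.independent S" and T: "orthonormal T" "finite T" and card: "card T < card S"
  obtains x where "x \<in> cvec.span S" "norm x = 1" "x \<in> orth_compl T"
proof -
  have "\<exists>x\<in>cvec.span S. x \<noteq> 0 \<and> x \<in> orth_compl T"
  proof (rule ccontr)
    assume no: "\<not> ?thesis"
    have lin: "Vector_Spaces.linear scaleC scaleC (oproj T)"
      unfolding Vector_Spaces.linear_iff
      using cvec.vector_space_axioms by (auto simp: oproj_add oproj_scale)
    have inj: "inj_on (oproj T) (cvec.span S)"
    proof (rule inj_onI)
      fix x y assume xy: "x \<in> cvec.span S" "y \<in> cvec.span S" "oproj T x = oproj T y"
      have "cinner (x - y) e = 0" if "e \<in> T" for e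
        using cinner_oproj[OF T that, of x] cinner_oproj[OF T that, of y] xy(3) by (simp add: cinner_diff_left)
      then show "x = y" using no cvec.span_diff[OF xy(1,2)] by (auto simp: orth_compl_def)
    qed
    have "cvec.independent (oproj T ` S)"
      by (rule cvec_pair.linear_independent_injective_image[OF lin S inj])
    moreover have "oproj T ` S \<subseteq> cvec.span T" using oproj_in_span by blast
    ultimately have "card (oproj T ` S) \<le> card T"
      using cvec.independent_span_bound T(2) by blast
    moreover have "card (oproj T ` S) = card S"
      by (intro card_image inj_on_subset[OF inj] cvec.span_superset)
    ultimately show False using card by simp
  qed
  then obtain x where x: "x \<in> cvec.span S" "x \<noteq> 0" "x \<in> orth_compl T" by blast
  show ?thesis
  proof
    show "complex_of_real (1 / norm x) *\<^sub>C x \<in> cvec.span S"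
      using x by (intro cvec.span_scale)
    show "norm (complex_of_real (1 / norm x) *\<^sub>C x) = 1" using x by (simp add: norm_divide)
    show "complex_of_real (1 / norm x) *\<^sub>C x \<in> orth_compl T"
      using x cvec.subspace_scale[OF subspace_orth_compl] by blast
  qed
qed

lemma exists_orthonormal_subset:
  assumes V: "cvec.subspace V" and B: "cvec.independent B" "B \<subseteq> V" and n: "n \<le> card B"
  obtains S where "S \<subseteq> V" "orthonormal S" "finite S" "card S = n"
proof -
  have "\<exists>S\<subseteq>V. orthonormal S \<and> finite S \<and> card S = n"
    using n
  proof (induction n)
    case 0 show ?case by (intro exI[of _ "{}"]) (auto simp: orthonormal_def)
  next
    case (Suc n)
    then obtain S where S: "S \<subseteq> V" "orthonormal S" "finite S" "card S = n" by auto
    then have "card S < card B" using Suc by simp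
    from exists_orthogonal_vector[OF B(1) S(2,3) this]
    obtain x where x: "x \<in> cvec.span B" "norm x = 1" "x \<in> orth_compl S" .
    have "x \<in> V" using x(1) B(2) V cvec.span_minimal by blast
    then show ?case
      using S orthonormal_insert[OF S(2) x(2,3)] by (intro exI[of _ "insert x S"]) auto
  qed
  with that show ?thesis by blast
qed

lemma norm_squared_oproj:
  assumes "orthonormal S" "finite S"
  shows "(norm (oproj S x))\<^sup>2 = (\<Sum>e\<in>S. (cmod (cinner x e))\<^sup>2)"
    and "(norm x)\<^sup>2 = (norm (oproj S x))\<^sup>2 + (norm (x - oproj S x))\<^sup>2"
proof -
  have "cinner (oproj S x) (oproj S x) = (\<Sum>e\<in>S. cnj (cinner x e) * cinner (oproj S x) e)"
    by (subst (2) oproj_def) (simp add: cinner_sum_right cinner_scaleC_right)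
  also have "\<dots> = (\<Sum>e\<in>S. of_real ((cmod (cinner x e))\<^sup>2))"
    using cinner_oproj[OF assms] by (intro sum.cong) (auto simp: complex_norm_square mult.commute simp del: of_real_power)
  also have "\<dots> = of_real (\<Sum>e\<in>S. (cmod (cinner x e))\<^sup>2)" by simp
  finally show "(norm (oproj S x))\<^sup>2 = (\<Sum>e\<in>S. (cmod (cinner x e))\<^sup>2)"
    unfolding cinner_self of_real_eq_iff .
  have "cinner (x - oproj S x) (oproj S x) = 0"
    using orth_compl_span diff_oproj_mem[OF assms] oproj_in_span by blast
  then show "(norm x)\<^sup>2 = (norm (oproj S x))\<^sup>2 + (norm (x - oproj S x))\<^sup>2"
    using norm_add_squared[of "x - oproj S x" "oproj S x"] by simp
qed

lemma Bessel_tendsto_0: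
  fixes e :: "nat \<Rightarrow> 'a::complex_hilbert"
  assumes e: "\<And>i j. cinner (e i) (e j) = (if i = j then 1 else 0)"
  shows "weakly_convergent_to e 0"
  unfolding weakly_convergent_to_def
proof
  fix y
  have inj: "inj e" by (rule injI) (metis e zero_neq_one)
  have on: "orthonormal (e ` {..<n})" for n
    using e inj by (auto simp: orthonormal_def dest: injD)
  have "(\<Sum>i<n. (cmod (cinner y (e i)))\<^sup>2) \<le> (norm y)\<^sup>2" for n
  proof -
    have "(\<Sum>i<n. (cmod (cinner y (e i)))\<^sup>2) = (norm (oproj (e ` {..<n}) y))\<^sup>2"
      using norm_squared_oproj(1)[OF on[of n]] inj by (simp add: sum.reindex inj_on_def)
    also have "\<dots> \<le> (norm y)\<^sup>2" using norm_squared_oproj(2)[OF on[of n], of y] by simp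
    finally show ?thesis .
  qed
  then have "summable (\<lambda>i. (cmod (cinner y (e i)))\<^sup>2)"
    by (intro summableI_nonneg_bounded) auto
  then have "(\<lambda>i. (cmod (cinner y (e i)))\<^sup>2) \<longlonglongrightarrow> 0" by (rule summable_LIMSEQ_zero)
  then have "(\<lambda>i. sqrt ((cmod (cinner y (e i)))\<^sup>2)) \<longlonglongrightarrow> sqrt 0" by (rule tendsto_real_sqrt)
  then have "(\<lambda>i. cmod (cinner (e i) y)) \<longlonglongrightarrow> 0" by (simp add: cinner_commute[of _ y])
  then show "(\<lambda>n. cinner (e n) y) \<longlonglongrightarrow> cinner 0 y" by (simp add: tendsto_norm_zero_iff)
qed

section \<open>Counting eigenvalues\<close>

locale symmetric_operator =
  fixes D :: "'a::complex_hilbert set" and T :: "'a \<Rightarrow> 'a"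
  assumes linear: "linear_operator D T"
    and symm: "x \<in> D \<Longrightarrow> y \<in> D \<Longrightarrow> cinner (T x) y = cinner x (T y)"
begin

lemma subspace_eigenspaces: "cvec.subspace (eigenspace D T r)"
proof -
  have D: "cvec.subspace D" and add: "\<And>x y. x \<in> D \<Longrightarrow> y \<in> D \<Longrightarrow> T (x + y) = T x + T y"
    and scale: "\<And>x c. x \<in> D \<Longrightarrow> T (c *\<^sub>C x) = c *\<^sub>C T x"
    using linear unfolding linear_operator_def by blast+
  have "T 0 = 0" using scale[OF cvec.subspace_0[OF D], of 0] by simp
  then show ?thesis
    using D unfolding cvec.subspace_def eigenspace_def
    by (auto simp: add scale scaleC_add_right mult.commute)
qed

lemma eigenvectors_orthogonal:
  assumes "x \<in> eigenspace D T r" "y \<in> eigenspace D T s" "r \<noteq> s"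
  shows "cinner x y = 0"
proof -
  have "of_real r * cinner x y = of_real s * cinner x y"
    using assms symm[of x y] by (simp add: eigenspace_def cinner_scaleC_left cinner_scaleC_right)
  with assms(3) show ?thesis by simp
qed

lemma le_eigenvalue_mult_imp_orthonormal:
  assumes "enat n \<le> eigenvalue_mult D T r"
  obtains S where "S \<subseteq> eigenspace D T r" "orthonormal S" "finite S" "card S = n"
proof (cases "\<exists>B. finite B \<and> eigenspace D T r \<subseteq> cvec.span B")
  case True
  then have n: "n \<le> cvec.dim (eigenspace D T r)" using assms by (simp add: eigenvalue_mult_def)
  obtain B where B: "B \<subseteq> eigenspace D T r" "cvec.independent B" "card B = cvec.dim (eigenspace D T r)"
    by (rule cvec.basis_exists)
  show ?thesis
    by (rule exists_orthonormal_subset[OF subspace_eigenspaces B(2,1)]) (use n B(3) that in auto)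
next
  case False
  obtain B where B: "B \<subseteq> eigenspace D T r" "cvec.independent B" "eigenspace D T r \<subseteq> cvec.span B"
    using cvec.maximal_independent_subset by blast
  then have "infinite B" using False by blast
  then obtain C where C: "C \<subseteq> B" "card C = n" using infinite_arbitrarily_large by blast
  then have "cvec.independent C" "C \<subseteq> eigenspace D T r" using B(1,2) cvec.independent_mono by blast+
  from exists_orthonormal_subset[OF subspace_eigenspaces this, of n] C(2) that show ?thesis
    by (metis order_refl)
qed

lemma orthonormal_le_eigenvalue_mult:
  assumes S: "S \<subseteq> eigenspace D T r" "orthonormal S" "finite S"
  shows "enat (card S) \<le> eigenvalue_mult D T r"
proof (cases "\<exists>B. finite B \<and> eigenspace D T r \<subseteq> cvec.span B")
  case True
  then obtain B where B: "finite B" "eigenspace D T r \<subseteq> cvec.span B" by blast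
  obtain C where C: "C \<subseteq> eigenspace D T r" "cvec.independent C" "eigenspace D T r \<subseteq> cvec.span C"
    "card C = cvec.dim (eigenspace D T r)"
    using cvec.basis_exists by blast
  have "finite C" using cvec.independent_span_bound[OF B(1) C(2)] C(1) B(2) by blast
  then have "card S \<le> card C"
    using cvec.independent_span_bound[OF _ orthonormal_independent[OF S(2)], of C] C(3) S(1) by blast
  then show ?thesis using True C(4) by (simp add: eigenvalue_mult_def)
next
  case False
  then have "eigenvalue_mult D T r = \<infinity>" unfolding eigenvalue_mult_def by (rule if_not_P)
  then show ?thesis by simp
qed

lemma eigenvalue_mult_eq_card:
  assumes S: "S \<subseteq> eigenspace D T r" "orthonormal S" "finite S"
    and complete: "\<And>x. x \<in> eigenspace D T r \<Longrightarrow> x \<in> orth_compl S \<Longrightarrow> x = 0"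
  shows "eigenvalue_mult D T r = enat (card S)"
proof (rule ccontr)
  assume "\<not> ?thesis"
  then have "enat (card S) < eigenvalue_mult D T r"
    using orthonormal_le_eigenvalue_mult[OF S] by (simp add: order_less_le)
  then have "enat (Suc (card S)) \<le> eigenvalue_mult D T r" by (simp add: Suc_ile_eq)
  then obtain R where R: "R \<subseteq> eigenspace D T r" "orthonormal R" "finite R" "card R = Suc (card S)"
    using le_eigenvalue_mult_imp_orthonormal by blast
  obtain x where x: "x \<in> cvec.span R" "norm x = 1" "x \<in> orth_compl S"
    using exists_orthogonal_vector[OF orthonormal_independent[OF R(2)] S(2,3)] R(4) by auto
  have "x \<in> eigenspace D T r" using x(1) R(1) subspace_eigenspaces cvec.span_minimal by blast
  with x complete show False by fastforce
qed

text \<open>Indices sharing a value are matched bijectively with an orthonormal subset of that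
  eigenspace of the same size; between different values orthogonality is automatic.\<close>

lemma smallest_eigenvalues_orthonormal:
  assumes "smallest_eigenvalues D T l u \<nu>"
  obtains e where "\<And>i. i \<in> {l..u} \<Longrightarrow> e i \<in> eigenspace D T (\<nu> i)"
    "\<And>i j. i \<in> {l..u} \<Longrightarrow> j \<in> {l..u} \<Longrightarrow> cinner (e i) (e j) = (if i = j then 1 else 0)"
proof -
  define I where "I r = {i \<in> {l..u}. \<nu> i = r}" for r
  have fI: "finite (I r)" for r unfolding I_def by (rule finite_subset[of _ "{l..u}"]) auto
  have "\<exists>S. S \<subseteq> eigenspace D T r \<and> orthonormal S \<and> finite S \<and> card S = card (I r)" for r
    using assms le_eigenvalue_mult_imp_orthonormal[of "card (I r)" r]
    unfolding smallest_eigenvalues_def I_def by metis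
  then obtain S where S: "\<And>r. S r \<subseteq> eigenspace D T r" "\<And>r. orthonormal (S r)" "\<And>r. finite (S r)"
    "\<And>r. card (S r) = card (I r)" by metis
  have "\<exists>b. bij_betw b (I r) (S r)" for r
    using S(3,4)[of r] fI by (intro finite_same_card_bij) auto
  then obtain b where b: "\<And>r. bij_betw (b r) (I r) (S r)" by metis
  define e where "e i = b (\<nu> i) i" for i
  have eS: "e i \<in> S (\<nu> i)" if "i \<in> {l..u}" for i
    using b[of "\<nu> i"] that unfolding e_def I_def bij_betw_def by blast
  show ?thesis
  proof
    show eig: "e i \<in> eigenspace D T (\<nu> i)" if "i \<in> {l..u}" for i using eS[OF that] S(1) by blast
    fix i j assume ij: "i \<in> {l..u}" "j \<in> {l..u}"
    show "cinner (e i) (e j) = (if i = j then 1 else 0)"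
    proof (cases "\<nu> i = \<nu> j")
      case True
      then have "e i = e j \<longleftrightarrow> i = j"
        using bij_betw_imp_inj_on[OF b[of "\<nu> i"]] ij by (auto simp: e_def I_def inj_on_def)
      moreover have "cinner (e i) (e j) = (if e i = e j then 1 else 0)"
        using S(2)[of "\<nu> i"] eS[OF ij(1)] eS[OF ij(2)] True unfolding orthonormal_def by metis
      ultimately show ?thesis by simp
    next
      case False
      then show ?thesis using eigenvectors_orthogonal[OF eig[OF ij(1)] eig[OF ij(2)]] by auto
    qed
  qed
qed

text \<open>Values below \<open>\<nu> u\<close> are listed with their full multiplicity, so each
  eigenspace involved holds at most as many orthonormal vectors as there are indices for it. Index
  \<open>u\<close> is never among these, which gives \<open>u - l\<close> instead of
  \<open>u - l + 1\<close>.\<close>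

lemma card_eigenvectors_below:
  assumes \<nu>: "smallest_eigenvalues D T l u \<nu>" and S: "orthonormal S" "finite S"
    and \<rho>: "\<And>e. e \<in> S \<Longrightarrow> e \<in> eigenspace D T (\<rho> e)" "\<And>e. e \<in> S \<Longrightarrow> \<rho> e < \<nu> u"
  shows "card S \<le> nat (u - l)"
proof -
  define I where "I r = {i \<in> {l..u}. \<nu> i = r}" for r
  have fI: "finite (I r)" for r unfolding I_def by (rule finite_subset[of _ "{l..u}"]) auto
  have "card S = (\<Sum>e\<in>S. 1)" by simp
  also have "\<dots> = (\<Sum>r\<in>\<rho> ` S. \<Sum>e | e \<in> S \<and> \<rho> e = r. 1)" by (rule sum.image_gen[OF S(2)])
  also have "\<dots> \<le> (\<Sum>r\<in>\<rho> ` S. card (I r))"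
  proof (rule sum_mono)
    fix r assume r: "r \<in> \<rho> ` S"
    have "enat (card {e \<in> S. \<rho> e = r}) \<le> eigenvalue_mult D T r"
      using \<rho>(1) S by (intro orthonormal_le_eigenvalue_mult orthonormal_subset[OF S(1)]) auto
    also have "\<dots> = enat (card (I r))"
      using \<nu> r \<rho>(2) unfolding smallest_eigenvalues_def I_def by auto
    finally show "(\<Sum>e | e \<in> S \<and> \<rho> e = r. 1) \<le> card (I r)" by simp
  qed
  also have "\<dots> = card (\<Union>r\<in>\<rho> ` S. I r)"
    using S(2) fI by (intro card_UN_disjoint[symmetric]) (auto simp: I_def)
  also have "\<dots> \<le> card {l..<u}"
  proof (rule card_mono)
    have "i < u" if "i \<in> {l..u}" "\<nu> i < \<nu> u" for i using that by (cases "i = u") auto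
    then show "(\<Union>r\<in>\<rho> ` S. I r) \<subseteq> {l..<u}" using \<rho>(2) by (auto simp: I_def)
  qed simp
  finally show ?thesis by simp
qed

text \<open>\<open>E\<close> exhausts the eigenspaces below \<open>s\<close>, so multiplicities
  there are the sizes of the fibres \<open>Er r\<close>, and the list is read off the first entries
  of \<open>E\<close> sorted by eigenvalue.\<close>

lemma smallest_eigenvalues_exist:
  assumes E: "orthonormal E" "finite E" "\<And>e. e \<in> E \<Longrightarrow> e \<in> eigenspace D T (\<rho> e)" "\<And>e. e \<in> E \<Longrightarrow> \<rho> e < s"
    and complete: "\<And>r x. r < s \<Longrightarrow> x \<in> eigenspace D T r \<Longrightarrow> x \<in> orth_compl E \<Longrightarrow> x = 0"
    and card: "nat (u - l + 1) \<le> card E" and lu: "l \<le> u"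
  shows "\<exists>\<nu>. smallest_eigenvalues D T l u \<nu>"
proof -
  define Er where "Er r = {e \<in> E. \<rho> e = r}" for r
  have fEr: "finite (Er r)" for r using E(2) by (simp add: Er_def)
  have mult: "eigenvalue_mult D T r = enat (card (Er r))" if r: "r < s" for r
  proof (rule eigenvalue_mult_eq_card)
    show "Er r \<subseteq> eigenspace D T r" "orthonormal (Er r)" "finite (Er r)"
      using E orthonormal_subset[OF E(1)] by (auto simp: Er_def)
    fix x assume x: "x \<in> eigenspace D T r" "x \<in> orth_compl (Er r)"
    have "cinner x e = 0" if "e \<in> E" for e
      using x eigenvectors_orthogonal[OF x(1) E(3)[OF that]] that
      by (cases "\<rho> e = r") (auto simp: Er_def orth_compl_def)
    then show "x = 0" using complete[OF r x(1)] by (simp add: orth_compl_def)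
  qed
  obtain ys where ys: "set ys = E" "distinct ys" using finite_distinct_list[OF E(2)] by blast
  define xs where "xs = sort_key \<rho> ys"
  have xs: "set xs = E" "distinct xs" "sorted (map \<rho> xs)" "length xs = card E"
    using ys by (auto simp: xs_def distinct_card[symmetric])
  define j where "j i = nat (i - l)" for i
  have j: "j i < length xs" if "i \<in> {l..u}" for i using that card xs(4) by (auto simp: j_def)
  define \<nu> where "\<nu> i = \<rho> (xs ! j i)" for i
  have xsE: "xs ! j i \<in> E" if "i \<in> {l..u}" for i using j[OF that] xs(1) nth_mem by blast
  have mono: "\<rho> (xs ! p) \<le> \<rho> (xs ! q)" if "p \<le> q" "q < length xs" for p q
    using sorted_nth_mono[OF xs(3), of p q] that by simp
  have inj: "inj_on (\<lambda>i. xs ! j i) {l..u}"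
    using xs(2) j by (auto simp: inj_on_def nth_eq_iff_index_eq j_def)
  have le: "card {i \<in> {l..u}. \<nu> i = r} \<le> card (Er r)" for r
    by (rule card_inj_on_le[where f = "\<lambda>i. xs ! j i"])
      (use inj xsE fEr in \<open>auto simp: Er_def \<nu>_def inj_on_def\<close>)
  show ?thesis
    unfolding smallest_eigenvalues_def
  proof (intro exI[of _ \<nu>] conjI allI impI)
    show "mono_on {l..u} \<nu>"
      using mono j by (auto simp: mono_on_def \<nu>_def j_def)
    show "enat (card {i \<in> {l..u}. \<nu> i = r}) \<le> eigenvalue_mult D T r" for r
    proof (cases "r < s")
      case True then show ?thesis using le mult by simp
    next
      case False
      then have empty: "{i \<in> {l..u}. \<nu> i = r} = {}" using E(4) xsE by (force simp: \<nu>_def)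
      show ?thesis unfolding empty by (simp flip: zero_enat_def)
    qed
    fix r assume r: "r < \<nu> u"
    have "\<nu> u < s" using E(4) xsE lu by (simp add: \<nu>_def)
    moreover have "Er r \<subseteq> (\<lambda>i. xs ! j i) ` {i \<in> {l..u}. \<nu> i = r}"
    proof
      fix e assume e: "e \<in> Er r"
      then have "e \<in> set xs" using xs(1) by (simp add: Er_def)
      then obtain p where p: "p < length xs" "xs ! p = e" by (auto simp: in_set_conv_nth)
      have "p < j u"
      proof (rule ccontr)
        assume "\<not> p < j u"
        then have "\<nu> u \<le> \<rho> e" using mono[of "j u" p] p by (simp add: \<nu>_def)
        then show False using e r by (simp add: Er_def)
      qed
      then have "l + int p \<in> {l..u}" "j (l + int p) = p" by (auto simp: j_def)
      then show "e \<in> (\<lambda>i. xs ! j i) ` {i \<in> {l..u}. \<nu> i = r}"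
        using p e by (intro image_eqI[of _ _ "l + int p"]) (auto simp: \<nu>_def Er_def)
    qed
    then have "card (Er r) \<le> card {i \<in> {l..u}. \<nu> i = r}"
      by (rule surj_card_le[rotated]) (rule finite_subset[of _ "{l..u}"], auto)
    ultimately show "enat (card {i \<in> {l..u}. \<nu> i = r}) = eigenvalue_mult D T r"
      using le[of r] mult[of r] r by simp
  qed
qed

text \<open>A finite sum in \<open>enat\<close> forces every negative eigenvalue to have finite
  multiplicity, so bases of the eigenspaces can be collected in one finite set. The last conclusion
  says that this set is complete: one more orthogonal eigenvector would exceed a
  multiplicity.\<close>

lemma negative_eigenvectors:
  assumes "num_negative_eigenvalues D T m"
  obtains N \<rho> where "orthonormal N" "finite N" "card N = m"
    "\<And>e. e \<in> N \<Longrightarrow> e \<in> eigenspace D T (\<rho> e)" "\<And>e. e \<in> N \<Longrightarrow> \<rho> e < 0"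
    "\<And>r x. r < 0 \<Longrightarrow> x \<in> eigenspace D T r \<Longrightarrow> x \<in> orth_compl N \<Longrightarrow> x = 0"
proof -
  define R where "R = {r. r < 0 \<and> is_eigenvalue D T r}"
  have R: "finite R" "(\<Sum>r\<in>R. eigenvalue_mult D T r) = enat m"
    using assms by (auto simp: num_negative_eigenvalues_def R_def)
  have "\<exists>n. eigenvalue_mult D T r = enat n" if "r \<in> R" for r
  proof -
    have "eigenvalue_mult D T r \<le> enat m"
      unfolding R(2)[symmetric] using R(1) that by (intro member_le_sum) auto
    then show ?thesis by (cases "eigenvalue_mult D T r") auto
  qed
  then obtain n where n: "\<And>r. r \<in> R \<Longrightarrow> eigenvalue_mult D T r = enat (n r)" by metis
  have "\<forall>r\<in>R. \<exists>S. S \<subseteq> eigenspace D T r \<and> orthonormal S \<and> finite S \<and> card S = n r"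
    using n le_eigenvalue_mult_imp_orthonormal by (metis order_refl)
  then obtain S where S: "\<And>r. r \<in> R \<Longrightarrow> S r \<subseteq> eigenspace D T r \<and> orthonormal (S r) \<and> finite (S r) \<and> card (S r) = n r"
    by metis
  define N where "N = (\<Union>r\<in>R. S r)"
  have ons: "orthonormal N"
    unfolding orthonormal_def
  proof (intro ballI)
    fix x y assume "x \<in> N" "y \<in> N"
    then obtain r s where rs: "r \<in> R" "s \<in> R" "x \<in> S r" "y \<in> S s" by (auto simp: N_def)
    show "cinner x y = (if x = y then 1 else 0)"
    proof (cases "r = s")
      case True
      then show ?thesis using S rs unfolding orthonormal_def by blast
    next
      case False
      have "cinner x x = 1" using S[OF rs(1)] rs unfolding orthonormal_def by auto
      moreover have "cinner x y = 0"
        using eigenvectors_orthogonal[of x r y s] S rs False by blast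
      ultimately show ?thesis by auto
    qed
  qed
  have disj: "S r \<inter> S s = {}" if "r \<in> R" "s \<in> R" "r \<noteq> s" for r s
  proof (rule ccontr)
    assume "S r \<inter> S s \<noteq> {}"
    then obtain x where x: "x \<in> S r" "x \<in> S s" by blast
    have "cinner x x = 1" using S[OF that(1)] x unfolding orthonormal_def by auto
    moreover have "cinner x x = 0" using eigenvectors_orthogonal[of x r x s] S that x by blast
    ultimately show False by simp
  qed
  have "card N = (\<Sum>r\<in>R. card (S r))"
    unfolding N_def using R(1) S disj by (intro card_UN_disjoint) auto
  also have "\<dots> = (\<Sum>r\<in>R. n r)" using S by (intro sum.cong) auto
  also have "\<dots> = m"
  proof -
    have "enat (\<Sum>r\<in>R. n r) = (\<Sum>r\<in>R. enat (n r))"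
      by (induction R rule: infinite_finite_induct) (auto simp: zero_enat_def simp flip: plus_enat_simps)
    also have "\<dots> = enat m" unfolding R(2)[symmetric] using n by (intro sum.cong) auto
    finally show ?thesis by simp
  qed
  finally have card: "card N = m" .
  have "\<forall>e\<in>N. \<exists>r. r < 0 \<and> e \<in> eigenspace D T r" using S by (auto simp: N_def R_def)
  then obtain \<rho> where \<rho>: "\<And>e. e \<in> N \<Longrightarrow> \<rho> e < 0 \<and> e \<in> eigenspace D T (\<rho> e)" by metis
  show ?thesis
  proof (rule that[OF ons _ card])
    show "finite N" using R(1) S by (auto simp: N_def)
    fix r :: real and x
    assume x: "r < 0" "x \<in> eigenspace D T r" "x \<in> orth_compl N"
    show "x = 0"
    proof (rule ccontr)
      assume x0: "x \<noteq> 0"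
      then have r: "r \<in> R" using x by (auto simp: R_def is_eigenvalue_def)
      define u where "u = complex_of_real (1 / norm x) *\<^sub>C x"
      have u: "u \<in> eigenspace D T r" "norm u = 1" "u \<in> orth_compl (S r)"
        using x x0 r cvec.subspace_scale[OF subspace_eigenspaces]
          cvec.subspace_scale[OF subspace_orth_compl, of x N]
        by (auto simp: u_def norm_divide N_def orth_compl_def)
      note ins = orthonormal_insert[OF _ u(2,3)]
      have "enat (card (insert u (S r))) \<le> eigenvalue_mult D T r"
        using S[OF r] u(1) ins by (intro orthonormal_le_eigenvalue_mult) auto
      then show False using S[OF r] ins n[OF r] by simp
    qed
  qed (use \<rho> in auto)
qed

end

section \<open>Self-adjoint operators and their forms\<close>

text \<open>The representation is assumed only with both arguments in the operator domain;
  \<open>represents\<close> extends the second argument to \<open>D\<close> by means of the core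
  property.\<close>

locale form_operator = hermitian_form D a for D :: "'a::complex_hilbert set" and a +
  fixes DA :: "'a set" and T :: "'a \<Rightarrow> 'a"
  assumes closed_form: "closed_sectorial_form D a"
    and self_adjoint: "self_adjoint_operator DA T"
    and core: "form_core D a DA"
    and represents_on_core: "x \<in> DA \<Longrightarrow> y \<in> DA \<Longrightarrow> cinner (T x) y = a x y"
begin

lemma domain_subset: "x \<in> DA \<Longrightarrow> x \<in> D"
  using core unfolding form_core_def by blast

lemma subspace_domain: "cvec.subspace DA"
  using core unfolding form_core_def by blast

lemma
  shows T_add: "x \<in> DA \<Longrightarrow> y \<in> DA \<Longrightarrow> T (x + y) = T x + T y"
    and T_scale: "x \<in> DA \<Longrightarrow> T (c *\<^sub>C x) = c *\<^sub>C T x"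
  using self_adjoint unfolding self_adjoint_operator_def linear_operator_def by blast+

lemma adjoint_imp:
  assumes "\<And>u. u \<in> DA \<Longrightarrow> cinner (T u) x = cinner u z"
  shows "x \<in> DA" "T x = z"
proof -
  have "(x, z) \<in> adjoint_graph DA T" using assms by (simp add: adjoint_graph_def)
  then have "(x, z) \<in> {(x, T x) | x. x \<in> DA}"
    using self_adjoint by (simp add: self_adjoint_operator_def)
  then show "x \<in> DA" "T x = z" by auto
qed

lemma T_symmetric: "x \<in> DA \<Longrightarrow> y \<in> DA \<Longrightarrow> cinner (T x) y = cinner x (T y)"
  using represents_on_core[of x y] represents_on_core[of y x] sym[of x y] domain_subset
    cinner_commute[of x "T y"] by simp

sublocale operator: symmetric_operator DA T
  using self_adjoint T_symmetric by unfold_locales (auto simp: self_adjoint_operator_def)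

text \<open>A sector of half-angle below \<open>pi / 2\<close> lies to the right of its vertex. The
  bound is normalised so that the shifted form dominates the squared norm, as
  \<open>hilbert_form\<close> demands.\<close>

lemma bounded_below:
  obtains b where "b \<ge> 0" "\<And>x. x \<in> D \<Longrightarrow> (norm x)\<^sup>2 \<le> Re (a x x) + b * (norm x)\<^sup>2"
proof -
  from closed_form obtain v \<theta> where \<theta>: "\<theta> < pi / 2"
    and sector: "\<And>z. z \<in> numerical_range D a \<Longrightarrow> \<bar>Arg (z - v)\<bar> \<le> \<theta>"
    unfolding closed_sectorial_form_def sectorial_form_def by blast
  have Re_ge: "Re v \<le> Re z" if "z \<in> numerical_range D a" for z
  proof -
    have "cos (Arg (z - v)) \<ge> 0" using sector[OF that] \<theta> by (intro cos_ge_zero) auto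
    then have "Re (rcis (cmod (z - v)) (Arg (z - v))) \<ge> 0" by simp
    then show ?thesis by (simp add: rcis_cmod_Arg)
  qed
  have lower: "Re v * (norm x)\<^sup>2 \<le> Re (a x x)" if x: "x \<in> D" for x
  proof (cases "x = 0")
    case True then show ?thesis using zero_left[OF zero_mem] by simp
  next
    case False
    define u where "u = complex_of_real (1 / norm x) *\<^sub>C x"
    have "u \<in> D" "norm u = 1" using x False scale_mem by (auto simp: u_def norm_divide)
    then have "Re v \<le> Re (a u u)" by (intro Re_ge) (auto simp: numerical_range_def)
    also have "Re (a u u) = Re (a x x) / (norm x)\<^sup>2"
      unfolding u_def using x by (subst quad_scale) (auto simp: norm_divide power_divide)
    finally show ?thesis using False by (simp add: field_simps)
  qed
  show ?thesis
  proof
    show "0 \<le> max 0 (1 - Re v)" by simp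
    fix x assume x: "x \<in> D"
    have "(1 - Re v) * (norm x)\<^sup>2 \<le> max 0 (1 - Re v) * (norm x)\<^sup>2"
      by (intro mult_right_mono) auto
    then show "(norm x)\<^sup>2 \<le> Re (a x x) + max 0 (1 - Re v) * (norm x)\<^sup>2"
      using lower[OF x] by (simp add: algebra_simps)
  qed
qed

text \<open>The lower bound is required only on \<open>G\<close>. For \<open>G\<close> the
  orthogonal complement of finitely many eigenvectors this admits shifts that may be too small on
  all of \<open>D\<close>.\<close>

lemma shifted_hilbert_form:
  assumes G: "cvec.subspace G" "closed G"
    and lower: "\<And>x. x \<in> D \<Longrightarrow> x \<in> G \<Longrightarrow> (norm x)\<^sup>2 \<le> Re (a x x) + s * (norm x)\<^sup>2"
  shows "hilbert_form (D \<inter> G) (\<lambda>x y. a x y + complex_of_real s * cinner x y)"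
    (is "hilbert_form ?E ?q")
proof
  have E: "cvec.subspace ?E" using subspace G(1) by (rule cvec.subspace_inter)
  show "symmetric_form ?E ?q"
    unfolding symmetric_form_def sesquilinear_form_def
  proof (intro conjI ballI allI)
    fix x y assume "x \<in> ?E" "y \<in> ?E"
    then show "a x y + complex_of_real s * cinner x y = cnj (a y x + complex_of_real s * cinner y x)"
      using sym[of x y] cinner_commute[of x y] by simp
  qed (use E in \<open>auto simp: add_left add_right scale_left scale_right cinner_add_left cinner_add_right
      cinner_scaleC_left cinner_scaleC_right algebra_simps\<close>)
  have Re_q: "Re (?q x x) = Re (a x x) + s * (norm x)\<^sup>2" for x by (simp add: cinner_self)
  show le: "(norm x)\<^sup>2 \<le> Re (?q x x)" if "x \<in> ?E" for x
    unfolding Re_q using lower that by auto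
  fix u :: "nat \<Rightarrow> 'a"
  assume u: "\<And>n. u n \<in> ?E"
    and C: "\<And>e. e > 0 \<Longrightarrow> \<exists>N. \<forall>m\<ge>N. \<forall>n\<ge>N. Re (?q (u m - u n) (u m - u n)) < e"
  have diff: "u m - u n \<in> ?E" for m n using E u cvec.subspace_diff by blast
  interpret G: hilbert_form G cinner by (rule closed_subspace_hilbert_form) fact+
  have "\<exists>l\<in>G. (\<lambda>n. Re (cinner (u n - l) (u n - l))) \<longlonglongrightarrow> 0"
  proof (rule G.complete)
    fix e :: real assume "e > 0"
    from C[OF this] obtain N where N: "\<And>m n. m \<ge> N \<Longrightarrow> n \<ge> N \<Longrightarrow> Re (?q (u m - u n) (u m - u n)) < e"
      by blast
    show "\<exists>N. \<forall>m\<ge>N. \<forall>n\<ge>N. Re (cinner (u m - u n) (u m - u n)) < e"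
      using le_less_trans[OF le[OF diff] N] by (auto simp: cinner_self intro!: exI[of _ N])
  qed (use u in auto)
  then obtain l where l: "l \<in> G" "(\<lambda>n. (norm (u n - l))\<^sup>2) \<longlonglongrightarrow> 0"
    by (auto simp: cinner_self)
  have ul: "u \<longlonglongrightarrow> l" using l(2) by (rule tendsto_if_norm_squared)
  have "((\<lambda>(n, m). a (u n - u m) (u n - u m)) \<longlongrightarrow> 0) (sequentially \<times>\<^sub>F sequentially)"
  proof (rule tendstoI)
    fix e :: real assume e: "0 < e"
    then have "e / (1 + \<bar>s\<bar>) > 0" by simp
    from C[OF this] obtain N where
      N: "\<And>m n. m \<ge> N \<Longrightarrow> n \<ge> N \<Longrightarrow> Re (?q (u m - u n) (u m - u n)) < e / (1 + \<bar>s\<bar>)" by blast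
    have "dist (a (u n - u m) (u n - u m)) 0 < e" if "m \<ge> N" "n \<ge> N" for m n
    proof -
      define w where "w = u n - u m"
      have w: "w \<in> ?E" unfolding w_def by (rule diff)
      have "cmod (a w w) = \<bar>Re (a w w)\<bar>" using self_real[of w] w by (metis IntD1 norm_of_real)
      also have "\<dots> \<le> Re (?q w w) + \<bar>s\<bar> * (norm w)\<^sup>2"
      proof -
        have "0 \<le> Re (a w w) + s * (norm w)\<^sup>2"
          using order_trans[OF zero_le_power2 le[OF w]] unfolding Re_q .
        moreover have "\<bar>s * (norm w)\<^sup>2\<bar> = \<bar>s\<bar> * (norm w)\<^sup>2" by (simp add: abs_mult)
        ultimately show ?thesis unfolding Re_q by (smt (verit))
      qed
      also have "\<dots> \<le> Re (?q w w) + \<bar>s\<bar> * Re (?q w w)"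
        by (intro add_left_mono mult_left_mono le w) auto
      also have "\<dots> = (1 + \<bar>s\<bar>) * Re (?q w w)" by (simp add: algebra_simps)
      also have "\<dots> < (1 + \<bar>s\<bar>) * (e / (1 + \<bar>s\<bar>))"
        by (intro mult_strict_left_mono) (use N[OF that(2,1)] in \<open>auto simp: w_def\<close>)
      finally show ?thesis by (simp add: w_def)
    qed
    then show "\<forall>\<^sub>F x in sequentially \<times>\<^sub>F sequentially.
        dist (case x of (n, m) \<Rightarrow> a (u n - u m) (u n - u m)) 0 < e"
      unfolding eventually_prod_sequentially by auto
  qed
  then have la: "l \<in> D" "(\<lambda>n. a (u n - l) (u n - l)) \<longlonglongrightarrow> 0"
    using closed_form u ul unfolding closed_sectorial_form_def by blast+
  have "(\<lambda>n. Re (a (u n - l) (u n - l)) + s * (norm (u n - l))\<^sup>2) \<longlonglongrightarrow> Re 0 + s * 0"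
    by (intro tendsto_add tendsto_mult tendsto_const tendsto_Re la l(2))
  moreover have "l \<in> ?E" using la l by blast
  ultimately have "l \<in> ?E" "(\<lambda>n. Re (a (u n - l) (u n - l)) + s * (norm (u n - l))\<^sup>2) \<longlonglongrightarrow> 0"
    by auto
  then show "\<exists>l\<in>?E. (\<lambda>n. Re (?q (u n - l) (u n - l))) \<longlonglongrightarrow> 0"
    unfolding Re_q by auto
qed

text \<open>One admissible shift is fixed by choice, so that the energy becomes a single reference
  norm in which all perturbations are measured.\<close>

definition shift :: real where
  "shift = (SOME b. b \<ge> 0 \<and> (\<forall>x\<in>D. (norm x)\<^sup>2 \<le> Re (a x x) + b * (norm x)\<^sup>2))"

lemma
  shows shift_nonneg: "shift \<ge> 0"
    and norm_le_shift: "x \<in> D \<Longrightarrow> (norm x)\<^sup>2 \<le> Re (a x x) + shift * (norm x)\<^sup>2"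
proof -
  have "\<exists>b. b \<ge> 0 \<and> (\<forall>x\<in>D. (norm x)\<^sup>2 \<le> Re (a x x) + b * (norm x)\<^sup>2)"
    using bounded_below by metis
  from someI_ex[OF this] show "shift \<ge> 0" "x \<in> D \<Longrightarrow> (norm x)\<^sup>2 \<le> Re (a x x) + shift * (norm x)\<^sup>2"
    by (auto simp: shift_def)
qed

definition energy_form :: "'a \<Rightarrow> 'a \<Rightarrow> complex" where
  "energy_form x y = a x y + complex_of_real shift * cinner x y"

definition energy :: "'a \<Rightarrow> real" where
  "energy x = Re (a x x) + shift * (norm x)\<^sup>2"

lemma Re_energy_form: "Re (energy_form x x) = energy x"
  by (simp add: energy_form_def energy_def cinner_self)

sublocale energy: hilbert_form D energy_form
  using shifted_hilbert_form[of UNIV shift] norm_le_shift by (simp add: energy_form_def[abs_def])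

lemma norm_le_energy: "x \<in> D \<Longrightarrow> (norm x)\<^sup>2 \<le> energy x"
  using energy.norm_le by (simp add: Re_energy_form)

lemma energy_nonneg: "x \<in> D \<Longrightarrow> 0 \<le> energy x"
  using energy.nonneg by (simp add: Re_energy_form)

lemma abs_form_le_energy: "x \<in> D \<Longrightarrow> \<bar>Re (a x x)\<bar> \<le> (1 + shift) * energy x"
proof -
  assume x: "x \<in> D"
  have "shift * (norm x)\<^sup>2 \<le> shift * energy x" by (intro mult_left_mono norm_le_energy x shift_nonneg)
  moreover have "0 \<le> shift * (norm x)\<^sup>2" using shift_nonneg by simp
  ultimately show ?thesis using energy_nonneg[OF x] by (auto simp: energy_def algebra_simps abs_le_iff)
qed

lemma energy_tendsto_0_imp_tendsto:
  assumes "\<And>n. x n \<in> D" "l \<in> D" "(\<lambda>n. energy (x n - l)) \<longlonglongrightarrow> 0"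
  shows "x \<longlonglongrightarrow> l"
proof -
  have "(\<lambda>n. (norm (x n - l))\<^sup>2) \<longlonglongrightarrow> 0"
    by (rule tendsto_sandwich[OF _ _ tendsto_const assms(3)])
      (use assms norm_le_energy diff_mem in \<open>auto intro!: always_eventually\<close>)
  then show ?thesis by (rule tendsto_if_norm_squared)
qed

lemma energy_triangle:
  assumes "x \<in> D" "y \<in> D" "z \<in> D"
  shows "sqrt (energy (x - z)) \<le> sqrt (energy (x - y)) + sqrt (energy (y - z))"
  using energy.triangle_diff[OF assms] by (simp add: Re_energy_form)

text \<open>The closure of \<open>DA\<close> in the energy norm carries a closed form that extends the restriction
  of \<open>a\<close> to the core \<open>DA\<close>, so it contains \<open>D\<close>.\<close>

lemma domain_energy_dense:
  assumes "l \<in> D"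
  shows "\<exists>x. (\<forall>n. x n \<in> DA) \<and> (\<lambda>n. energy (x n - l)) \<longlonglongrightarrow> 0"
proof -
  define V where "V = {l \<in> D. \<forall>e>0. \<exists>x\<in>DA. sqrt (energy (x - l)) < e}"
  have VD: "V \<subseteq> D" by (auto simp: V_def)
  have energy_scale: "sqrt (energy (c *\<^sub>C x)) = cmod c * sqrt (energy x)" if "x \<in> D" for c x
    using energy.quad_scale[OF that, of c] by (simp add: Re_energy_form real_sqrt_mult)
  have energy_0: "energy 0 = 0" using zero_left[OF zero_mem] by (simp add: energy_def)
  have DAV: "DA \<subseteq> V"
    using domain_subset by (auto simp: V_def energy_0 intro!: bexI)
  have subV: "cvec.subspace V"
    unfolding cvec.subspace_def
  proof (intro conjI ballI allI)
    show "0 \<in> V" using DAV cvec.subspace_0[OF subspace_domain] by blast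
    show "x + y \<in> V" if x: "x \<in> V" and y: "y \<in> V" for x y
      unfolding V_def
    proof (intro CollectI conjI allI impI)
      show "x + y \<in> D" using x y VD add_mem by blast
      fix e :: real assume "e > 0"
      then have "e / 2 > 0" by simp
      with x y obtain x' y' where *: "x' \<in> DA" "y' \<in> DA" "sqrt (energy (x' - x)) < e / 2" "sqrt (energy (y' - y)) < e / 2"
        unfolding V_def by blast
      have "sqrt (energy ((x' - x) + (y' - y))) \<le> sqrt (energy (x' - x)) + sqrt (energy (y' - y))"
        using energy.triangle[of "x' - x" "y' - y"] * x y VD domain_subset diff_mem
        by (auto simp: Re_energy_form)
      then have "sqrt (energy ((x' + y') - (x + y))) < e" using * by (simp add: algebra_simps)
      moreover have "x' + y' \<in> DA" using * cvec.subspace_add subspace_domain by blast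
      ultimately show "\<exists>z\<in>DA. sqrt (energy (z - (x + y))) < e" by blast
    qed
    show "c *\<^sub>C x \<in> V" if x: "x \<in> V" for c x
      unfolding V_def
    proof (intro CollectI conjI allI impI)
      show "c *\<^sub>C x \<in> D" using x VD scale_mem by blast
      fix e :: real assume e: "e > 0"
      then have "e / (cmod c + 1) > 0" by (simp add: add_nonneg_pos)
      with x obtain x' where x': "x' \<in> DA" "sqrt (energy (x' - x)) < e / (cmod c + 1)"
        unfolding V_def by blast
      have "sqrt (energy (c *\<^sub>C x' - c *\<^sub>C x)) = cmod c * sqrt (energy (x' - x))"
        using x x' VD domain_subset diff_mem energy_scale[of "x' - x" c]
        by (auto simp: cvec.scale_right_diff_distrib)
      also have "\<dots> \<le> cmod c * (e / (cmod c + 1))" using x' by (intro mult_left_mono) auto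
      also have "\<dots> < e" using e by (simp add: divide_simps add_nonneg_pos)
      finally show "\<exists>z\<in>DA. sqrt (energy (z - c *\<^sub>C x)) < e"
        using x' cvec.subspace_scale[OF subspace_domain] by blast
    qed
  qed
  have "closed_sectorial_form V a"
    unfolding closed_sectorial_form_def sectorial_form_def
  proof (intro conjI allI impI)
    show "sesquilinear_form V a"
      using hermitian_form_sub[OF hermitian_form_axioms subV VD]
      by (simp add: hermitian_form_def symmetric_form_def)
    have "numerical_range V a \<subseteq> numerical_range D a" using VD by (auto simp: numerical_range_def)
    then show "\<exists>v \<theta>. \<theta> < pi / 2 \<and> (\<forall>z\<in>numerical_range V a. \<bar>Arg (z - v)\<bar> \<le> \<theta>)"
      using closed_form unfolding closed_sectorial_form_def sectorial_form_def by (meson subsetD)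
    fix x l assume x: "\<forall>n. x n \<in> V" "x \<longlonglongrightarrow> l"
      "((\<lambda>(n, m). a (x n - x m) (x n - x m)) \<longlongrightarrow> 0) (sequentially \<times>\<^sub>F sequentially)"
    then have l: "l \<in> D" "(\<lambda>n. a (x n - l) (x n - l)) \<longlonglongrightarrow> 0"
      using closed_form VD unfolding closed_sectorial_form_def by (meson subsetD)+
    show "(\<lambda>n. a (x n - l) (x n - l)) \<longlonglongrightarrow> 0" by fact
    have "(\<lambda>n. norm (x n - l)) \<longlonglongrightarrow> 0" using x(2) by (simp add: LIM_zero tendsto_norm_zero)
    then have "(\<lambda>n. sqrt (energy (x n - l))) \<longlonglongrightarrow> sqrt (Re 0 + shift * 0\<^sup>2)"
      unfolding energy_def by (intro tendsto_intros l)
    then have lim: "(\<lambda>n. sqrt (energy (x n - l))) \<longlonglongrightarrow> 0" by simp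
    show "l \<in> V"
      unfolding V_def
    proof (intro CollectI conjI allI impI l)
      fix e :: real assume "e > 0"
      then have e: "e / 2 > 0" by simp
      then obtain n where n: "sqrt (energy (x n - l)) < e / 2"
        using order_tendstoD(2)[OF lim e] eventually_happens' trivial_limit_sequentially by blast
      obtain y where y: "y \<in> DA" "sqrt (energy (y - x n)) < e / 2"
        using x(1) e unfolding V_def by blast
      have "sqrt (energy (y - l)) < e"
        using energy_triangle[of y "x n" l] n y l x(1) VD domain_subset by (fastforce)
      then show "\<exists>z\<in>DA. sqrt (energy (z - l)) < e" using y by blast
    qed
  qed
  moreover have "form_extends V a DA a" using DAV by (auto simp: form_extends_def)
  ultimately have "form_extends V a D a"
    using core unfolding form_core_def is_form_closure_def by blast
  then have "l \<in> V" using assms unfolding form_extends_def by blast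
  then have "\<exists>x\<in>DA. sqrt (energy (x - l)) < 1 / Suc n" for n
    unfolding V_def by simp
  then obtain x where x: "\<And>n. x n \<in> DA" "\<And>n. sqrt (energy (x n - l)) < 1 / Suc n" by metis
  have "(\<lambda>n. sqrt (energy (x n - l))) \<longlonglongrightarrow> 0"
  proof (rule tendsto_sandwich[of "\<lambda>_. 0" _ _ "\<lambda>n. 1 / real (Suc n)"])
    show "(\<lambda>n. 1 / real (Suc n)) \<longlonglongrightarrow> 0" by (rule LIMSEQ_Suc[OF lim_1_over_n])
    show "\<forall>\<^sub>F n in sequentially. 0 \<le> sqrt (energy (x n - l))"
      using x(1) assms domain_subset diff_mem energy_nonneg by simp
    show "\<forall>\<^sub>F n in sequentially. sqrt (energy (x n - l)) \<le> 1 / real (Suc n)"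
      using x(2) by (intro always_eventually allI less_imp_le)
  qed simp
  then have "(\<lambda>n. (sqrt (energy (x n - l)))\<^sup>2) \<longlonglongrightarrow> 0\<^sup>2" by (intro tendsto_power)
  then show ?thesis
    using x(1) assms domain_subset diff_mem energy_nonneg by (intro exI[of _ x]) simp
qed

text \<open>Both sides are continuous in \<open>y\<close> for the energy norm, in which
  \<open>DA\<close> is dense in \<open>D\<close>.\<close>

lemma represents:
  assumes "x \<in> DA" "y \<in> D"
  shows "a x y = cinner (T x) y"
proof -
  obtain u where u: "\<And>n. u n \<in> DA" "(\<lambda>n. energy (u n - y)) \<longlonglongrightarrow> 0"
    using domain_energy_dense[OF assms(2)] by blast
  have uD: "u n \<in> D" for n using u domain_subset by blast
  have lim: "u \<longlonglongrightarrow> y" using energy_tendsto_0_imp_tendsto uD assms u(2) by blast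
  have "(\<lambda>n. energy_form (u n) x - complex_of_real shift * cinner (u n) x) \<longlonglongrightarrow>
      energy_form y x - complex_of_real shift * cinner y x"
    using uD assms domain_subset u(2) lim
    by (intro tendsto_intros energy.tendsto_form_left tendsto_cinner_left) (auto simp: Re_energy_form)
  then have "(\<lambda>n. a (u n) x) \<longlonglongrightarrow> a y x" by (simp add: energy_form_def)
  moreover have "a (u n) x = cinner (u n) (T x)" for n
    using u(1)[of n] assms(1) represents_on_core[of "u n" x] T_symmetric[of "u n" x] by simp
  ultimately have "(\<lambda>n. cinner (u n) (T x)) \<longlonglongrightarrow> a y x" by simp
  then have "a y x = cinner y (T x)"
    using tendsto_cinner_left[OF lim] LIMSEQ_unique by blast
  then show ?thesis
    using assms domain_subset sym[of x y] cinner_commute[of "T x" y] by simp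
qed

text \<open>Tested on \<open>DA\<close> alone, the weak equation already says that
  \<open>(x, z)\<close> lies in the adjoint graph, and self-adjointness does the rest.\<close>

lemma represented_imp:
  assumes "x \<in> D" "\<And>y. y \<in> D \<Longrightarrow> a x y = cinner z y"
  shows "x \<in> DA" "T x = z"
proof -
  have "cinner (T u) x = cinner u z" if "u \<in> DA" for u
    using represents[OF that assms(1)] assms(2)[of u] that domain_subset sym[of u x] assms(1)
      cinner_commute[of u z] by simp
  then show "x \<in> DA" "T x = z" using adjoint_imp by blast+
qed

lemma eigenvector_form:
  assumes "e \<in> eigenspace DA T r" "y \<in> D"
  shows "a e y = of_real r * cinner e y" "a y e = of_real r * cinner y e"
proof -
  show *: "a e y = of_real r * cinner e y"
    using assms represents[of e y] by (simp add: eigenspace_def cinner_scaleC_left)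
  show "a y e = of_real r * cinner y e"
    using * assms domain_subset sym[of y e] cinner_commute[of y e] by (simp add: eigenspace_def)
qed

lemma eigenspace_subset: "e \<in> eigenspace DA T r \<Longrightarrow> e \<in> D"
  using domain_subset by (simp add: eigenspace_def)

text \<open>On an eigenvector the form is a multiple of the inner product, so the cross terms vanish
  by orthogonality.\<close>

lemma form_oproj:
  assumes E: "orthonormal E" "finite E" "\<And>e. e \<in> E \<Longrightarrow> e \<in> eigenspace DA T (\<rho> e)" and x: "x \<in> D"
  shows "oproj E x \<in> D" "x - oproj E x \<in> D"
    and "Re (a x x) = (\<Sum>e\<in>E. \<rho> e * (cmod (cinner x e))\<^sup>2) + Re (a (x - oproj E x) (x - oproj E x))"
proof -
  have ED: "e \<in> D" if "e \<in> E" for e using E(3) eigenspace_subset that by blast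
  show p: "oproj E x \<in> D" unfolding oproj_def using ED scale_mem by (intro sum_mem) auto
  show w: "x - oproj E x \<in> D" using p x diff_mem by blast
  have form_p: "a (oproj E x) y = (\<Sum>e\<in>E. of_real (\<rho> e) * cinner x e * cinner e y)" if y: "y \<in> D" for y
  proof -
    have "a (oproj E x) y = (\<Sum>e\<in>E. a (cinner x e *\<^sub>C e) y)"
      unfolding oproj_def using y ED scale_mem by (intro sum_left) auto
    also have "\<dots> = (\<Sum>e\<in>E. of_real (\<rho> e) * cinner x e * cinner e y)"
      using y ED E(3) by (intro sum.cong) (auto simp: scale_left eigenvector_form)
    finally show ?thesis .
  qed
  have "cinner e (x - oproj E x) = 0" if "e \<in> E" for e
    using diff_oproj_mem[OF E(1,2), of x] that cinner_commute[of e "x - oproj E x"]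
    by (simp add: orth_compl_def)
  then have "a (oproj E x) (x - oproj E x) = 0" using form_p[OF w] by simp
  moreover have "a (oproj E x) (oproj E x) = (\<Sum>e\<in>E. of_real (\<rho> e * (cmod (cinner x e))\<^sup>2))"
    unfolding form_p[OF p]
  proof (intro sum.cong refl)
    fix e assume e: "e \<in> E"
    have "cinner e (oproj E x) = cnj (cinner x e)"
      using cinner_oproj[OF E(1,2) e, of x] cinner_commute[of e "oproj E x"] by simp
    then show "of_real (\<rho> e) * cinner x e * cinner e (oproj E x) = of_real (\<rho> e * (cmod (cinner x e))\<^sup>2)"
      by (simp add: mult.assoc complex_norm_square del: of_real_power)
  qed
  ultimately have *: "Re (a (oproj E x) (x - oproj E x)) = 0"
    "Re (a (oproj E x) (oproj E x)) = (\<Sum>e\<in>E. \<rho> e * (cmod (cinner x e))\<^sup>2)"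
    by (auto simp del: of_real_mult)
  have "Re (a x x) = Re (a (oproj E x + (x - oproj E x)) (oproj E x + (x - oproj E x)))" by simp
  also have "\<dots> = Re (a (oproj E x) (oproj E x)) + 2 * Re (a (oproj E x) (x - oproj E x))
      + Re (a (x - oproj E x) (x - oproj E x))"
    using p w by (rule quad_add)
  finally show "Re (a x x) = (\<Sum>e\<in>E. \<rho> e * (cmod (cinner x e))\<^sup>2) + Re (a (x - oproj E x) (x - oproj E x))"
    using * by simp
qed

text \<open>This inverts \<open>T + s\<close> on the orthogonal complement of \<open>E\<close>,
  using Riesz for the shifted form there. The weak equation obtained is tested only on that
  complement; along \<open>E\<close> both sides vanish, as \<open>E\<close> consists of eigenvectors
  and \<open>f\<close> and \<open>g\<close> are orthogonal to it.\<close>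

lemma restricted_resolvent:
  assumes E: "orthonormal E" "finite E" "\<And>e. e \<in> E \<Longrightarrow> e \<in> eigenspace DA T (\<rho> e)"
    and lower: "\<And>x. x \<in> D \<Longrightarrow> x \<in> orth_compl E \<Longrightarrow> (norm x)\<^sup>2 \<le> Re (a x x) + s * (norm x)\<^sup>2"
    and f: "f \<in> orth_compl E"
  shows "\<exists>g\<in>DA. g \<in> orth_compl E \<and> T g = f - of_real s *\<^sub>C g"
proof -
  define q where "q x y = a x y + complex_of_real s * cinner x y" for x y
  interpret R: hilbert_form "D \<inter> orth_compl E" q
    using shifted_hilbert_form[OF subspace_orth_compl closed_orth_compl lower] by (simp add: q_def[abs_def])
  have "\<exists>g\<in>D \<inter> orth_compl E. \<forall>h\<in>D \<inter> orth_compl E. cinner h f = q h g"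
  proof (rule R.Riesz[where C = "norm f"])
    show "cmod (cinner h f) \<le> norm f * sqrt (Re (q h h))" if "h \<in> D \<inter> orth_compl E" for h
    proof -
      have "norm h \<le> sqrt (Re (q h h))" using R.norm_le[OF that] by (simp add: real_le_rsqrt)
      then show ?thesis using cinner_CS[of h f] mult_right_mono[of "norm h" _ "norm f"]
        by (fastforce simp: mult.commute)
    qed
  qed (auto simp: cinner_add_left cinner_scaleC_left)
  then obtain g where g: "g \<in> D" "g \<in> orth_compl E"
    and rep: "\<And>h. h \<in> D \<Longrightarrow> h \<in> orth_compl E \<Longrightarrow> cinner h f = q h g" by auto
  have ED: "e \<in> D" if "e \<in> E" for e using E(3) eigenspace_subset that by blast
  have "a g h = cinner (f - of_real s *\<^sub>C g) h" if h: "h \<in> D" for h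
  proof -
    define w where "w = h - oproj E h"
    have w: "w \<in> D" "w \<in> orth_compl E" and pD: "oproj E h \<in> D"
      using form_oproj[OF E h] diff_oproj_mem[OF E(1,2)] by (auto simp: w_def)
    have ge: "cinner g e = 0" "cinner (f - of_real s *\<^sub>C g) e = 0" if "e \<in> E" for e
      using that f g(2) by (auto simp: orth_compl_def cinner_diff_left cinner_scaleC_left)
    have "a g (oproj E h) = (\<Sum>e\<in>E. a g (cinner h e *\<^sub>C e))"
      unfolding oproj_def using g ED scale_mem by (intro sum_right) auto
    also have "\<dots> = 0"
      using ge ED g eigenvector_form(2)[OF E(3) g(1)] by (intro sum.neutral ballI) (simp add: scale_right)
    finally have "a g (oproj E h) = 0" .
    moreover have "cinner (f - of_real s *\<^sub>C g) (oproj E h) = 0"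
      unfolding oproj_def cinner_sum_right using ge by (intro sum.neutral) (auto simp: cinner_scaleC_right)
    moreover have "a g w = cinner (f - of_real s *\<^sub>C g) w"
    proof -
      have "cnj (cinner w f) = cnj (a w g) + of_real s * cnj (cinner w g)"
        using rep[OF w] by (simp add: q_def)
      then show ?thesis
        using sym[OF g(1) w(1)] cinner_commute[of f w] cinner_commute[of g w]
        by (simp add: cinner_diff_left cinner_scaleC_left)
    qed
    moreover have "h = w + oproj E h" by (simp add: w_def)
    ultimately show ?thesis
      using g w pD by (metis add_right cinner_add_right)
  qed
  from represented_imp[OF g(1) this] g show ?thesis by blast
qed

end

section \<open>Eigenvalues below the essential spectrum\<close>

context form_operator
begin

text \<open>Symmetry moves \<open>T\<close> to a fixed test vector, where weak convergence suffices;
  self-adjointness then puts the limit into the domain.\<close>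

lemma weak_limit_eigenvector:
  assumes y: "\<And>n. y n \<in> DA" and weak: "weakly_convergent_to y l"
    and lim: "(\<lambda>n. T (y n) - complex_of_real r *\<^sub>C y n) \<longlonglongrightarrow> 0"
  shows "l \<in> eigenspace DA T r"
proof -
  have "cinner (T u) l = cinner u (complex_of_real r *\<^sub>C l)" if u: "u \<in> DA" for u
  proof -
    have "(\<lambda>n. cinner (T (y n) - complex_of_real r *\<^sub>C y n) u + of_real r * cinner (y n) u)
        \<longlonglongrightarrow> cinner 0 u + of_real r * cinner l u"
      using weak unfolding weakly_convergent_to_def
      by (intro tendsto_add tendsto_mult tendsto_const tendsto_cinner_left[OF lim]) blast
    moreover have "cinner (T (y n) - complex_of_real r *\<^sub>C y n) u + of_real r * cinner (y n) u = cinner (y n) (T u)" for n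
      using T_symmetric[OF y u] by (simp add: cinner_diff_left cinner_scaleC_left)
    moreover have "(\<lambda>n. cinner (y n) (T u)) \<longlonglongrightarrow> cinner l (T u)"
      using weak by (simp add: weakly_convergent_to_def)
    ultimately have "cinner l (T u) = of_real r * cinner l u" using LIMSEQ_unique by auto
    then show ?thesis
      using cinner_commute[of "T u" l] cinner_commute[of u l] by (simp add: cinner_scaleC_right)
  qed
  then show ?thesis using adjoint_imp by (auto simp: eigenspace_def)
qed

lemma Weyl_sequence:
  assumes y: "\<And>n. y n \<in> DA" "\<And>n. norm (y n) \<ge> 1 / 2" and weak: "weakly_convergent_to y 0"
    and lim: "(\<lambda>n. T (y n) - complex_of_real r *\<^sub>C y n) \<longlonglongrightarrow> 0"
  shows "complex_of_real r \<in> essential_spectrum DA T"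
proof -
  define c where "c n = complex_of_real (1 / norm (y n))" for n
  have cb: "cmod (c n) \<le> 2" "y n \<noteq> 0" for n
    using y(2)[of n] by (auto simp: c_def norm_divide divide_simps)
  show ?thesis
    unfolding essential_spectrum_def
  proof (intro CollectI exI[of _ "\<lambda>n. c n *\<^sub>C y n"] conjI allI)
    show "c n *\<^sub>C y n \<in> DA" for n using y(1) cvec.subspace_scale[OF subspace_domain] by blast
    show "norm (c n *\<^sub>C y n) = 1" for n using cb(2)[of n] by (simp add: c_def norm_divide)
    show "(\<lambda>n. cinner (c n *\<^sub>C y n) u) \<longlonglongrightarrow> 0" for u
    proof (rule Lim_null_comparison[OF always_eventually, OF allI])
      show "norm (cinner (c n *\<^sub>C y n) u) \<le> 2 * norm (cinner (y n) u)" for n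
        unfolding cinner_scaleC_left norm_mult by (intro mult_right_mono cb) auto
      have "(\<lambda>n. cinner (y n) u) \<longlonglongrightarrow> 0" using weak by (simp add: weakly_convergent_to_def)
      then show "(\<lambda>n. 2 * norm (cinner (y n) u)) \<longlonglongrightarrow> 0" by (auto intro!: tendsto_eq_intros)
    qed
    show "(\<lambda>n. norm (T (c n *\<^sub>C y n) - complex_of_real r *\<^sub>C c n *\<^sub>C y n)) \<longlonglongrightarrow> 0"
    proof (rule Lim_null_comparison[OF always_eventually, OF allI])
      fix n
      have "T (c n *\<^sub>C y n) - complex_of_real r *\<^sub>C c n *\<^sub>C y n = c n *\<^sub>C (T (y n) - complex_of_real r *\<^sub>C y n)"
        using y(1) by (simp add: T_scale cvec.scale_right_diff_distrib mult.commute)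
      then show "norm (norm (T (c n *\<^sub>C y n) - complex_of_real r *\<^sub>C c n *\<^sub>C y n))
          \<le> 2 * norm (T (y n) - complex_of_real r *\<^sub>C y n)"
        using mult_right_mono[OF cb(1) norm_ge_zero] by simp
      show "(\<lambda>n. 2 * norm (T (y n) - complex_of_real r *\<^sub>C y n)) \<longlonglongrightarrow> 0"
        by (intro tendsto_mult_right_zero tendsto_norm_zero lim)
    qed
  qed
qed

text \<open>If \<open>r\<close> is the infimum of the form on the unit sphere of \<open>E\<^sup>\<bottom>\<close>, then applying
  \<open>(T - r + 1)\<^sup>-\<^sup>1\<close> to a minimising sequence produces approximate eigenvectors. Their weak limit is
  an eigenvector unless it vanishes, in which case \<open>r\<close> is in the essential spectrum.\<close>

lemma infimum_is_eigenvalue: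
  assumes E: "orthonormal E" "finite E" "\<And>e. e \<in> E \<Longrightarrow> e \<in> eigenspace DA T (\<rho> e)"
    and lower: "\<And>x. x \<in> D \<Longrightarrow> x \<in> orth_compl E \<Longrightarrow> r * (norm x)\<^sup>2 \<le> Re (a x x)"
    and approx: "\<And>\<delta>. \<delta> > 0 \<Longrightarrow> \<exists>x\<in>D. x \<in> orth_compl E \<and> norm x = 1 \<and> Re (a x x) < r + \<delta>"
    and ess: "complex_of_real r \<notin> essential_spectrum DA T"
  shows "\<exists>x\<in>eigenspace DA T r. norm x = 1 \<and> x \<in> orth_compl E"
proof -
  \<comment> \<open>With this shift \<open>T + s\<close> is at least 1 on the complement of
    \<open>E\<close>, as \<open>restricted_resolvent\<close> requires.\<close>
  define s where "s = 1 - r"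
  have lower': "(norm x)\<^sup>2 \<le> Re (a x x) + s * (norm x)\<^sup>2" if "x \<in> D" "x \<in> orth_compl E" for x
    using lower[OF that] by (simp add: s_def algebra_simps)
  \<comment> \<open>The \<open>4\<close> makes the distance from \<open>x n\<close> to
    \<open>y n\<close> at most 1/2, so that \<open>norm (y n)\<close> is at least 1/2 for every
    \<open>n\<close>.\<close>
  have "\<exists>x\<in>D. x \<in> orth_compl E \<and> norm x = 1 \<and> Re (a x x) < r + 1 / (real n + 4)" for n :: nat
    by (rule approx) auto
  then obtain x where x: "\<And>n. x n \<in> D" "\<And>n. x n \<in> orth_compl E" "\<And>n. norm (x n) = 1"
    "\<And>n. Re (a (x n) (x n)) < r + 1 / (real n + 4)" by metis
  have "\<exists>y\<in>DA. y \<in> orth_compl E \<and> T y = x n - of_real s *\<^sub>C y" for n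
    by (rule restricted_resolvent[OF E lower' x(2)])
  then obtain y where y: "\<And>n. y n \<in> DA" "\<And>n. y n \<in> orth_compl E"
    "\<And>n. T (y n) = x n - of_real s *\<^sub>C y n" by metis
  \<comment> \<open>Write \<open>q\<close> for \<open>a\<close> shifted by \<open>s\<close>. Since
    \<open>(T + s) y = x\<close> and \<open>norm x = 1\<close>, the value of \<open>q\<close> at
    \<open>x - y\<close> is its value at \<open>x\<close> minus 2 plus
    \<open>Re (cinner x y)\<close>. The first is below \<open>1 + 1 / (n + 4)\<close>, the last at
    most 1.\<close>
  have close: "(norm (x n - y n))\<^sup>2 \<le> 1 / (real n + 4)" and norm_y1: "norm (y n) \<le> 1" for n
  proof -
    have yD: "y n \<in> D" using y domain_subset by blast
    have mem: "x n - y n \<in> D" "x n - y n \<in> orth_compl E"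
      using diff_mem[OF x(1) yD] cvec.subspace_diff[OF subspace_orth_compl x(2) y(2)] by auto
    have form_y: "a (y n) z = cinner (x n) z - of_real s * cinner (y n) z" if "z \<in> D" for z
      using represents[OF y(1) that] y(3) by (simp add: cinner_diff_left cinner_scaleC_left)
    have yx: "Re (a (y n) (x n)) + s * Re (cinner (y n) (x n)) = 1"
      using form_y[OF x(1)] x(3)[of n] by (simp add: cinner_self)
    have yy: "Re (a (y n) (y n)) + s * (norm (y n))\<^sup>2 = Re (cinner (x n) (y n))"
      using form_y[OF yD] by (simp add: cinner_self)
    have "(norm (y n))\<^sup>2 \<le> Re (cinner (x n) (y n))"
      using lower'[OF yD y(2)] yy by simp
    also have xy: "Re (cinner (x n) (y n)) \<le> norm (y n)"
      using cinner_CS[of "x n" "y n"] x(3) complex_Re_le_cmod[of "cinner (x n) (y n)"] by simp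
    finally have "norm (y n) * norm (y n) \<le> norm (y n) * 1" by (simp add: power2_eq_square)
    then show ny: "norm (y n) \<le> 1"
      by (cases "y n = 0") (auto dest: mult_left_le_imp_le)
    have "(norm (x n - y n))\<^sup>2 \<le> Re (a (x n - y n) (x n - y n)) + s * (norm (x n - y n))\<^sup>2"
      by (rule lower'[OF mem])
    also have "\<dots> = (Re (a (x n) (x n)) + s * 1) - 2 * (Re (a (y n) (x n)) + s * Re (cinner (y n) (x n)))
        + (Re (a (y n) (y n)) + s * (norm (y n))\<^sup>2)"
      using x(1,3) yD sym[of "x n" "y n"] cinner_commute[of "x n" "y n"]
      by (simp add: quad_diff norm_diff_squared algebra_simps)
    also have "\<dots> = (Re (a (x n) (x n)) + s) - 2 + Re (cinner (x n) (y n))"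
      unfolding yx yy by simp
    also have "\<dots> \<le> 1 / (real n + 4)"
      using x(4)[of n] xy ny unfolding s_def by linarith
    finally show "(norm (x n - y n))\<^sup>2 \<le> 1 / (real n + 4)" .
  qed
  have close2: "norm (x n - y n) \<le> sqrt (1 / (real n + 4))" for n
    using close[of n] by (simp add: real_le_rsqrt)
  have xy0: "(\<lambda>n. x n - y n) \<longlonglongrightarrow> 0"
  proof (rule Lim_null_comparison[OF always_eventually, OF allI])
    show "norm (x n - y n) \<le> sqrt (1 / (real n + 4))" for n by (rule close2)
    show "(\<lambda>n. sqrt (1 / (real n + 4))) \<longlonglongrightarrow> 0" by real_asymp
  qed
  have norm_y: "1 / 2 \<le> norm (y n)" for n
  proof -
    have "sqrt (1 / (real n + 4)) \<le> 1 / 2" by (rule real_le_lsqrt) (auto simp: power2_eq_square divide_simps)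
    then show ?thesis using close2[of n] x(3)[of n] norm_triangle_ineq2[of "x n" "y n"] by linarith
  qed
  have Ty: "T (y n) - complex_of_real r *\<^sub>C y n = x n - y n" for n
    using y(3)[of n] cvec.scale_left_diff_distrib[of 1 "of_real r" "y n"] by (simp add: s_def algebra_simps)
  obtain k l where k: "strict_mono k" and weak: "weakly_convergent_to (y \<circ> k) l"
    using bounded_weakly_convergent_subsequence[of y 1] norm_y1 by blast
  have limk: "(\<lambda>n. T ((y \<circ> k) n) - complex_of_real r *\<^sub>C (y \<circ> k) n) \<longlonglongrightarrow> 0"
    using LIMSEQ_subseq_LIMSEQ[OF xy0 k] by (simp add: Ty o_def)
  have l: "l \<in> eigenspace DA T r"
    by (rule weak_limit_eigenvector[OF _ weak limk]) (simp add: y)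
  have lE: "l \<in> orth_compl E"
    unfolding orth_compl_def
  proof (intro CollectI ballI)
    fix e assume "e \<in> E"
    then have "(\<lambda>n. cinner ((y \<circ> k) n) e) = (\<lambda>n. 0)" using y(2) by (auto simp: orth_compl_def)
    then show "cinner l e = 0"
      using weak LIMSEQ_unique tendsto_const unfolding weakly_convergent_to_def by metis
  qed
  have "l \<noteq> 0"
    using Weyl_sequence[of "y \<circ> k", OF _ _ _ limk] weak y norm_y ess by auto
  then show ?thesis
    using l lE cvec.subspace_scale[OF operator.subspace_eigenspaces] cvec.subspace_scale[OF subspace_orth_compl]
    by (intro bexI[of _ "complex_of_real (1 / norm l) *\<^sub>C l"]) (auto simp: norm_divide)
qed

text \<open>The vector \<open>x\<close> serves to push the infimum of the Rayleigh quotients on the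
  complement of \<open>E\<close> below \<open>s\<close>, where there is no essential
  spectrum.\<close>

lemma exists_eigenvector_below:
  assumes E: "orthonormal E" "finite E" "\<And>e. e \<in> E \<Longrightarrow> e \<in> eigenspace DA T (\<rho> e)"
    and x: "x \<in> D" "x \<in> orth_compl E" "Re (a x x) < s * (norm x)\<^sup>2"
    and ess: "\<And>r. r < s \<Longrightarrow> complex_of_real r \<notin> essential_spectrum DA T"
  shows "\<exists>r<s. \<exists>e\<in>eigenspace DA T r. norm e = 1 \<and> e \<in> orth_compl E"
proof -
  define N where "N = {Re (a u u) | u. u \<in> D \<and> u \<in> orth_compl E \<and> norm u = 1}"
  have N_norm: "Re (a u u) / (norm u)\<^sup>2 \<in> N" if u: "u \<in> D" "u \<in> orth_compl E" "u \<noteq> 0" for u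
  proof -
    define c where "c = complex_of_real (1 / norm u)"
    have "Re (a (c *\<^sub>C u) (c *\<^sub>C u)) = Re (a u u) / (norm u)\<^sup>2"
      using u by (subst quad_scale) (auto simp: c_def norm_divide power_divide)
    moreover have "c *\<^sub>C u \<in> D" "c *\<^sub>C u \<in> orth_compl E" "norm (c *\<^sub>C u) = 1"
      using u scale_mem cvec.subspace_scale[OF subspace_orth_compl] by (auto simp: c_def norm_divide)
    ultimately show ?thesis unfolding N_def by (intro CollectI exI[of _ "c *\<^sub>C u"]) simp
  qed
  have x0: "x \<noteq> 0" using x zero_left[OF zero_mem] by auto
  have bdd: "bdd_below N"
  proof (rule bdd_belowI)
    fix v assume "v \<in> N"
    then show "1 - shift \<le> v" using norm_le_shift unfolding N_def by fastforce
  qed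
  define r where "r = Inf N"
  have "r \<le> Re (a x x) / (norm x)\<^sup>2" unfolding r_def using N_norm[OF x(1,2) x0] bdd by (intro cInf_lower)
  also have "\<dots> < s" using x x0 by (simp add: divide_simps)
  finally have rs: "r < s" .
  have "\<exists>e\<in>eigenspace DA T r. norm e = 1 \<and> e \<in> orth_compl E"
  proof (rule infimum_is_eigenvalue[OF E])
    show "r * (norm u)\<^sup>2 \<le> Re (a u u)" if u: "u \<in> D" "u \<in> orth_compl E" for u
    proof (cases "u = 0")
      case True then show ?thesis using zero_left[OF zero_mem] by simp
    next
      case False
      then have "r \<le> Re (a u u) / (norm u)\<^sup>2" unfolding r_def using N_norm u bdd by (intro cInf_lower)
      then show ?thesis using False by (simp add: field_simps)
    qed
    fix \<delta> :: real assume "\<delta> > 0"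
    then have "Inf N < r + \<delta>" by (simp add: r_def)
    then obtain v where "v \<in> N" "v < r + \<delta>" using cInf_lessD N_norm[OF x(1,2) x0] by blast
    then show "\<exists>x\<in>D. x \<in> orth_compl E \<and> norm x = 1 \<and> Re (a x x) < r + \<delta>" by (auto simp: N_def)
  qed (use ess rs in auto)
  with rs show ?thesis by blast
qed

text \<open>Eigenvectors below \<open>s\<close> are split off one at a time. If this did not terminate, there would be
  an orthonormal sequence of eigenvectors whose eigenvalues accumulate at a point of the essential
  spectrum in \<open>{..s}\<close>.\<close>

lemma finite_spectral_part:
  assumes ess: "\<And>r. r \<le> s \<Longrightarrow> complex_of_real r \<notin> essential_spectrum DA T"
  obtains E \<rho> where "orthonormal E" "finite E" "\<And>e. e \<in> E \<Longrightarrow> e \<in> eigenspace DA T (\<rho> e)"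
    "\<And>e. e \<in> E \<Longrightarrow> \<rho> e < s"
    "\<And>x. x \<in> D \<Longrightarrow> x \<in> orth_compl E \<Longrightarrow> s * (norm x)\<^sup>2 \<le> Re (a x x)"
proof (rule ccontr)
  assume contra: "\<not> thesis"
  note result = that
  define ok where "ok e \<longleftrightarrow> norm e = 1 \<and> (\<exists>r<s. e \<in> eigenspace DA T r)" for e
  have step: "\<exists>e. ok e \<and> e \<in> orth_compl E" if E: "orthonormal E" "finite E" "\<And>e. e \<in> E \<Longrightarrow> ok e" for E
  proof -
    have "\<forall>e\<in>E. \<exists>r. r < s \<and> e \<in> eigenspace DA T r" using E(3) unfolding ok_def by blast
    then obtain \<rho> where \<rho>: "\<And>e. e \<in> E \<Longrightarrow> \<rho> e < s \<and> e \<in> eigenspace DA T (\<rho> e)" by metis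
    have "\<not> (\<forall>x. x \<in> D \<longrightarrow> x \<in> orth_compl E \<longrightarrow> s * (norm x)\<^sup>2 \<le> Re (a x x))"
      using contra result[OF E(1,2)] \<rho> by blast
    then obtain x where x: "x \<in> D" "x \<in> orth_compl E" "Re (a x x) < s * (norm x)\<^sup>2" by fastforce
    show ?thesis
      using exists_eigenvector_below[OF E(1,2) _ x, of \<rho>] \<rho> ess unfolding ok_def by fastforce
  qed
  have "\<exists>f. \<forall>n::nat. ok (f n) \<and> (\<forall>i<n. cinner (f n) (f i) = 0)"
  proof (rule dependent_wellorder_choice)
    fix n :: nat and f :: "nat \<Rightarrow> 'a"
    assume f: "\<And>i. i < n \<Longrightarrow> ok (f i) \<and> (\<forall>j<i. cinner (f i) (f j) = 0)"
    have "cinner (f i) (f j) = (if f i = f j then 1 else 0)" if "i < n" "j < n" for i j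
    proof (cases i j rule: linorder_cases)
      case less
      then have "cinner (f i) (f j) = 0" using f that cinner_commute[of "f i" "f j"] by simp
      then show ?thesis using f that by (auto simp: cinner_self ok_def)
    next
      case greater
      then have "cinner (f i) (f j) = 0" using f that by simp
      then show ?thesis using f that by (auto simp: cinner_self ok_def)
    qed (use f that in \<open>auto simp: cinner_self ok_def\<close>)
    then have "orthonormal (f ` {..<n})" by (auto simp: orthonormal_def)
    then obtain e where "ok e" "e \<in> orth_compl (f ` {..<n})" using step f by blast
    then show "\<exists>e. ok e \<and> (\<forall>i<n. cinner e (f i) = 0)" by (auto simp: orth_compl_def)
  qed auto
  then obtain f :: "nat \<Rightarrow> 'a" where f: "\<And>n. ok (f n)" "\<And>n i. i < n \<Longrightarrow> cinner (f n) (f i) = 0" by blast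
  have orth: "cinner (f i) (f j) = (if i = j then 1 else 0)" for i j
  proof (cases i j rule: linorder_cases)
    case less then show ?thesis using f(2)[OF less] cinner_commute[of "f i" "f j"] by simp
  next
    case greater then show ?thesis using f(2)[OF greater] by simp
  qed (use f(1) in \<open>auto simp: ok_def cinner_self\<close>)
  have "\<forall>n. \<exists>r. r < s \<and> f n \<in> eigenspace DA T r" using f(1) unfolding ok_def by blast
  then obtain \<rho> where \<rho>: "\<And>n. \<rho> n < s" "\<And>n. f n \<in> eigenspace DA T (\<rho> n)" by metis
  have norm_f: "norm (f n) = 1" for n using f(1) by (simp add: ok_def)
  have "1 - shift \<le> \<rho> n" for n
  proof -
    have "Re (a (f n) (f n)) = \<rho> n"
      using eigenvector_form(1)[OF \<rho>(2) eigenspace_subset[OF \<rho>(2)]] norm_f by (simp add: cinner_self)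
    then show ?thesis using norm_le_shift[OF eigenspace_subset[OF \<rho>(2)], of n] norm_f by simp
  qed
  then have "\<rho> n \<in> {1 - shift..s}" for n using \<rho>(1)[of n] by auto
  \<comment> \<open>The accumulation point may be \<open>s\<close> itself, which is why the
    essential spectrum is excluded for \<open>r \<le> s\<close> and not only for
    \<open>r < s\<close>.\<close>
  then obtain r k where r: "r \<in> {1 - shift..s}" "strict_mono k" "(\<rho> \<circ> k) \<longlonglongrightarrow> r"
    using compact_Icc[of "1 - shift" s] unfolding compact_def by blast
  have "complex_of_real r \<in> essential_spectrum DA T"
  proof (rule Weyl_sequence[of "f \<circ> k"])
    show "(f \<circ> k) n \<in> DA" for n using \<rho>(2) by (simp add: eigenspace_def)
    show "weakly_convergent_to (f \<circ> k) 0"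
      using weakly_convergent_to_subseq[OF Bessel_tendsto_0[OF orth] r(2)] .
    have "norm (T ((f \<circ> k) n) - complex_of_real r *\<^sub>C (f \<circ> k) n) = \<bar>(\<rho> \<circ> k) n - r\<bar>" for n
    proof -
      have "T (f (k n)) - complex_of_real r *\<^sub>C f (k n) = complex_of_real (\<rho> (k n) - r) *\<^sub>C f (k n)"
        using \<rho>(2)[of "k n"] by (simp add: eigenspace_def cvec.scale_left_diff_distrib)
      then show ?thesis by (simp add: norm_f del: of_real_diff)
    qed
    moreover have "(\<lambda>n. \<bar>(\<rho> \<circ> k) n - r\<bar>) \<longlonglongrightarrow> 0"
      by (rule tendsto_rabs_zero[OF LIM_zero[OF r(3)]])
    ultimately have "(\<lambda>n. norm (T ((f \<circ> k) n) - complex_of_real r *\<^sub>C (f \<circ> k) n)) \<longlonglongrightarrow> 0"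
      by simp
    then show "(\<lambda>n. T ((f \<circ> k) n) - complex_of_real r *\<^sub>C (f \<circ> k) n) \<longlonglongrightarrow> 0"
      by (rule tendsto_norm_zero_cancel)
  qed (simp add: norm_f)
  with ess r show False by auto
qed

text \<open>Only finitely many independent eigenvectors belong to eigenvalues below
  \<open>s\<close>, and a weakly null sequence loses its overlap with them; on their complement the
  form is at least \<open>s\<close>.\<close>

lemma weakly_null_form_lower:
  assumes ess: "\<And>r. r \<le> s \<Longrightarrow> complex_of_real r \<notin> essential_spectrum DA T"
    and w: "\<And>n. w n \<in> D" "weakly_convergent_to w 0" and e: "e > 0"
  shows "\<forall>\<^sub>F n in sequentially. s * (norm (w n))\<^sup>2 - e < Re (a (w n) (w n))"
proof -
  obtain E \<rho> where E: "orthonormal E" "finite E" "\<And>e. e \<in> E \<Longrightarrow> e \<in> eigenspace DA T (\<rho> e)"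
    and low: "\<And>x. x \<in> D \<Longrightarrow> x \<in> orth_compl E \<Longrightarrow> s * (norm x)\<^sup>2 \<le> Re (a x x)"
    using finite_spectral_part[OF ess] by metis
  define S where "S n = (\<Sum>e\<in>E. (\<rho> e - s) * (cmod (cinner (w n) e))\<^sup>2)" for n
  have "S \<longlonglongrightarrow> (\<Sum>e\<in>E. (\<rho> e - s) * (cmod (cinner 0 e))\<^sup>2)"
    unfolding S_def using w(2) by (intro tendsto_intros) (auto simp: weakly_convergent_to_def)
  then have "S \<longlonglongrightarrow> 0" by simp
  then have "\<forall>\<^sub>F n in sequentially. - e < S n" using e by (intro order_tendstoD) auto
  then show ?thesis
  proof (rule eventually_mono)
    fix n assume S: "- e < S n"
    note f = form_oproj[OF E w(1)[of n]]
    have "s * (norm (w n - oproj E (w n)))\<^sup>2 \<le> Re (a (w n - oproj E (w n)) (w n - oproj E (w n)))"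
      using f(2) diff_oproj_mem[OF E(1,2)] by (rule low)
    moreover have "s * (norm (w n))\<^sup>2 = s * (\<Sum>e\<in>E. (cmod (cinner (w n) e))\<^sup>2) + s * (norm (w n - oproj E (w n)))\<^sup>2"
      using norm_squared_oproj[OF E(1,2), of "w n"] by (simp add: distrib_left)
    moreover have "S n = (\<Sum>e\<in>E. \<rho> e * (cmod (cinner (w n) e))\<^sup>2) - s * (\<Sum>e\<in>E. (cmod (cinner (w n) e))\<^sup>2)"
      by (simp add: S_def left_diff_distrib sum_subtractf sum_distrib_left)
    ultimately show "s * (norm (w n))\<^sup>2 - e < Re (a (w n) (w n))"
      using f(3) S by linarith
  qed
qed

end

section \<open>The two halves of the min-max principle\<close>

context form_operator
begin

text \<open>Were there fewer than \<open>card S\<close> eigenvectors below \<open>s\<close>, some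
  unit vector of the trial space would be orthogonal to all of them, contradicting the lower bound
  from \<open>finite_spectral_part\<close>. If \<open>\<nu> u\<close> were at least
  \<open>s\<close>, then \<open>card_eigenvectors_below\<close> would leave room for only
  \<open>u - l\<close> of them.\<close>

lemma smallest_eigenvalues_upper:
  assumes ess: "\<And>r. r \<le> s \<Longrightarrow> complex_of_real r \<notin> essential_spectrum DA T"
    and S: "cvec.independent S" "card S = nat (u - l + 1)" "l \<le> u" "S \<subseteq> D"
    and small: "\<And>x. x \<in> cvec.span S \<Longrightarrow> x \<noteq> 0 \<Longrightarrow> Re (a x x) < s * (norm x)\<^sup>2"
  shows "\<exists>\<nu>. smallest_eigenvalues DA T l u \<nu>"
    and "smallest_eigenvalues DA T l u \<nu> \<Longrightarrow> \<nu> u < s"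
proof -
  obtain E \<rho> where E: "orthonormal E" "finite E" "\<And>e. e \<in> E \<Longrightarrow> e \<in> eigenspace DA T (\<rho> e)"
    "\<And>e. e \<in> E \<Longrightarrow> \<rho> e < s"
    and low: "\<And>x. x \<in> D \<Longrightarrow> x \<in> orth_compl E \<Longrightarrow> s * (norm x)\<^sup>2 \<le> Re (a x x)"
    using finite_spectral_part[OF ess] by metis
  have card: "card S \<le> card E"
  proof (rule ccontr)
    assume "\<not> card S \<le> card E"
    then obtain x where x: "x \<in> cvec.span S" "norm x = 1" "x \<in> orth_compl E"
      using exists_orthogonal_vector[OF S(1) E(1,2)] by auto
    have "x \<in> D" using x(1) S(4) subspace cvec.span_minimal by blast
    then show False using low[of x] small[of x] x by fastforce
  qed
  have complete: "x = 0" if x: "r < s" "x \<in> eigenspace DA T r" "x \<in> orth_compl E" for r x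
  proof (rule ccontr)
    assume "x \<noteq> 0"
    have xD: "x \<in> D" using eigenspace_subset x by blast
    have "s * (norm x)\<^sup>2 \<le> Re (a x x)" using low x xD by blast
    also have "\<dots> = r * (norm x)\<^sup>2" using eigenvector_form(1)[OF x(2) xD] by (simp add: cinner_self)
    finally show False using \<open>x \<noteq> 0\<close> x(1) by simp
  qed
  show "\<exists>\<nu>. smallest_eigenvalues DA T l u \<nu>"
    using operator.smallest_eigenvalues_exist[OF E complete] card S by simp
  show "\<nu> u < s" if \<nu>: "smallest_eigenvalues DA T l u \<nu>"
  proof (rule ccontr)
    assume "\<not> \<nu> u < s"
    then have "card E \<le> nat (u - l)"
      using E(4) by (intro operator.card_eigenvectors_below[OF \<nu> E(1-3)]) fastforce+
    then show False using card S by simp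
  qed
qed

text \<open>The eigenvectors with indices \<open>l..j\<close> span \<open>j - l + 1\<close>
  dimensions, more than \<open>card N\<close>, so their span contains a unit vector orthogonal to
  \<open>N\<close>; its form value is at most \<open>\<nu> j\<close>.\<close>

lemma smallest_eigenvalues_lower:
  assumes \<nu>: "smallest_eigenvalues DA T l u \<nu>" and N: "orthonormal N" "finite N" "j \<in> {l..u}" "int (card N) \<le> j - l"
    and low: "\<And>x. x \<in> D \<Longrightarrow> x \<in> orth_compl N \<Longrightarrow> c * (norm x)\<^sup>2 \<le> Re (a x x)"
  shows "c \<le> \<nu> j"
proof -
  obtain e where e: "\<And>i. i \<in> {l..u} \<Longrightarrow> e i \<in> eigenspace DA T (\<nu> i)"
    "\<And>i j. i \<in> {l..u} \<Longrightarrow> j \<in> {l..u} \<Longrightarrow> cinner (e i) (e j) = (if i = j then 1 else 0)"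
    using operator.smallest_eigenvalues_orthonormal[OF \<nu>] by blast
  define S where "S = e ` {l..j}"
  have inj: "inj_on e {l..j}"
    using N(3) by (intro inj_onI) (metis e(2) zero_neq_one atLeastAtMost_iff order_trans)
  have S: "orthonormal S" "finite S" "card S = nat (j - l + 1)"
    using e(2) inj N(3) by (auto simp: S_def orthonormal_def card_image inj_on_def)
  define \<rho> where "\<rho> v = \<nu> (inv_into {l..j} e v)" for v
  have \<rho>: "v \<in> eigenspace DA T (\<rho> v)" "\<rho> v \<le> \<nu> j" if "v \<in> S" for v
  proof -
    from that obtain i where i: "i \<in> {l..j}" "v = e i" by (auto simp: S_def)
    then have "\<rho> v = \<nu> i" using inj by (simp add: \<rho>_def)
    moreover have "\<nu> i \<le> \<nu> j"
      using \<nu> i N(3) unfolding smallest_eigenvalues_def by (auto dest: mono_onD[of _ _ i j])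
    ultimately show "v \<in> eigenspace DA T (\<rho> v)" "\<rho> v \<le> \<nu> j" using i e(1) N(3) by auto
  qed
  obtain x where x: "x \<in> cvec.span S" "norm x = 1" "x \<in> orth_compl N"
  proof (rule exists_orthogonal_vector[OF orthonormal_independent[OF S(1)] N(1,2)])
    show "card N < card S" using S(3) N(4) by linarith
  qed
  have xD: "x \<in> D"
    using x(1) \<rho>(1) eigenspace_subset subspace cvec.span_minimal[of S D] by blast
  have "c \<le> Re (a x x)" using low[OF xD x(3)] x(2) by simp
  also have "\<dots> = (\<Sum>v\<in>S. \<rho> v * (cmod (cinner x v))\<^sup>2)"
    using form_oproj(3)[OF S(1,2) \<rho>(1) xD] oproj_span[OF S(1,2) x(1)] zero_left[OF zero_mem] by simp
  also have "\<dots> \<le> (\<Sum>v\<in>S. \<nu> j * (cmod (cinner x v))\<^sup>2)"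
    by (intro sum_mono mult_right_mono \<rho>) auto
  also have "\<dots> = \<nu> j * (norm (oproj S x))\<^sup>2"
    using norm_squared_oproj(1)[OF S(1,2)] by (simp add: sum_distrib_left)
  also have "\<dots> = \<nu> j" using oproj_span[OF S(1,2) x(1)] x(2) by simp
  finally show ?thesis .
qed

end

section \<open>Uniform boundedness of forms\<close>

lemma hermitian_form_diff:
  assumes "hermitian_form D p" "hermitian_form D q"
  shows "hermitian_form D (\<lambda>x y. p x y - q x y)"
proof -
  interpret p: hermitian_form D p by fact
  interpret q: hermitian_form D q by fact
  show ?thesis
  proof
    have *: "p x y - q x y = cnj (p y x - q y x)" if "x \<in> D" "y \<in> D" for x y
      using p.sym[OF that] q.sym[OF that] by simp
    show "symmetric_form D (\<lambda>x y. p x y - q x y)"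
      unfolding symmetric_form_def sesquilinear_form_def
      by (intro conjI ballI allI p.subspace *)
        (simp_all add: p.add_left p.add_right p.scale_left p.scale_right
          q.add_left q.add_right q.scale_left q.scale_right algebra_simps)
  qed
qed

lemma hermitian_form_scale:
  assumes "hermitian_form D p"
  shows "hermitian_form D (\<lambda>x y. complex_of_real r * p x y)"
proof -
  interpret p: hermitian_form D p by fact
  show ?thesis
  proof
    have *: "complex_of_real r * p x y = cnj (complex_of_real r * p y x)" if "x \<in> D" "y \<in> D" for x y
      using p.sym[OF that] by simp
    show "symmetric_form D (\<lambda>x y. complex_of_real r * p x y)"
      unfolding symmetric_form_def sesquilinear_form_def
      by (intro conjI ballI allI p.subspace *)
        (simp_all add: p.add_left p.add_right p.scale_left p.scale_right algebra_simps)
  qed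
qed

context hilbert_form
begin

text \<open>\<open>Metric_space\<close> asks for nonnegativity and symmetry on the whole type; the
  value 0 outside \<open>D\<close> supplies them.\<close>

definition form_dist :: "'a \<Rightarrow> 'a \<Rightarrow> real" where
  "form_dist x y = (if x \<in> D \<and> y \<in> D then sqrt (Re (q (x - y) (x - y))) else 0)"

lemma quad_eq_0: "x \<in> D \<Longrightarrow> Re (q x x) = 0 \<longleftrightarrow> x = 0"
  using norm_le[of x] zero_left[OF zero_mem] by auto

lemma Metric_space_form_dist: "Metric_space D form_dist"
proof
  show "0 \<le> form_dist x y" for x y using nonneg diff_mem by (simp add: form_dist_def)
  show "form_dist x y = form_dist y x" for x y by (auto simp: form_dist_def quad_minus_commute)
  show "(form_dist x y = 0) = (x = y)" if "x \<in> D" "y \<in> D" for x y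
    using that quad_eq_0[of "x - y"] diff_mem by (simp add: form_dist_def)
  show "form_dist x z \<le> form_dist x y + form_dist y z" if "x \<in> D" "y \<in> D" "z \<in> D" for x y z
    using triangle_diff that by (simp add: form_dist_def)
qed

lemma limitin_form_dist:
  assumes "limitin (Metric_space.mtopology D form_dist) x l sequentially" "\<And>n. x n \<in> D"
  shows "l \<in> D" "(\<lambda>n. Re (q (x n - l) (x n - l))) \<longlonglongrightarrow> 0"
proof -
  interpret M: Metric_space D form_dist by (rule Metric_space_form_dist)
  from assms(1) have l: "l \<in> D" "(\<lambda>n. form_dist (x n) l) \<longlonglongrightarrow> 0"
    by (auto simp: M.limitin_metric_dist_null)
  show "l \<in> D" by fact
  have "(\<lambda>n. (form_dist (x n) l)\<^sup>2) \<longlonglongrightarrow> 0\<^sup>2" by (intro tendsto_power l)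
  moreover have "(form_dist (x n) l)\<^sup>2 = Re (q (x n - l) (x n - l))" for n
    using assms(2) l(1) diff_mem nonneg by (simp add: form_dist_def)
  ultimately show "(\<lambda>n. Re (q (x n - l) (x n - l))) \<longlonglongrightarrow> 0" by simp
qed

lemma mcomplete_form_dist: "Metric_space.mcomplete D form_dist"
proof -
  interpret M: Metric_space D form_dist by (rule Metric_space_form_dist)
  show ?thesis
    unfolding M.mcomplete_def
  proof (intro allI impI)
    fix x assume C: "M.MCauchy x"
    then have x: "x n \<in> D" for n by (auto simp: M.MCauchy_def)
    have "\<exists>l\<in>D. (\<lambda>n. Re (q (x n - l) (x n - l))) \<longlonglongrightarrow> 0"
    proof (rule complete[OF x])
      fix e :: real assume e: "e > 0"
      then have "sqrt e > 0" by simp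
      then obtain N where N: "\<And>m n. m \<ge> N \<Longrightarrow> n \<ge> N \<Longrightarrow> form_dist (x m) (x n) < sqrt e"
        using C unfolding M.MCauchy_def by metis
      then show "\<exists>N. \<forall>m\<ge>N. \<forall>n\<ge>N. Re (q (x m - x n) (x m - x n)) < e"
        using x by (auto simp: form_dist_def intro!: exI[of _ N])
    qed
    then obtain l where l: "l \<in> D" "(\<lambda>n. Re (q (x n - l) (x n - l))) \<longlonglongrightarrow> 0" by blast
    then have "(\<lambda>n. sqrt (Re (q (x n - l) (x n - l)))) \<longlonglongrightarrow> sqrt 0" by (intro tendsto_real_sqrt)
    then have "limitin M.mtopology x l sequentially"
      using l x by (simp add: M.limitin_metric_dist_null form_dist_def)
    then show "\<exists>l. limitin M.mtopology x l sequentially" by blast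
  qed
qed

text \<open>By Baire's theorem the forms are uniformly bounded on some ball \<open>B(x\<^sub>0, \<epsilon>)\<close>; the parallelogram
  law moves the bound to a ball around the origin.\<close>

lemma uniform_boundedness_closed:
  fixes F :: "'i \<Rightarrow> 'a \<Rightarrow> 'a \<Rightarrow> complex"
  assumes F: "\<And>i. i \<in> I \<Longrightarrow> hermitian_form D (F i)"
    and closed: "\<And>c x l i. (\<And>j. x j \<in> D) \<Longrightarrow> l \<in> D \<Longrightarrow> (\<lambda>j. Re (q (x j - l) (x j - l))) \<longlonglongrightarrow> 0 \<Longrightarrow>
        (\<And>j. \<bar>Re (F i (x j) (x j))\<bar> \<le> c) \<Longrightarrow> i \<in> I \<Longrightarrow> \<bar>Re (F i l l)\<bar> \<le> c"
    and pointwise: "\<And>x. x \<in> D \<Longrightarrow> \<exists>c. \<forall>i\<in>I. \<bar>Re (F i x x)\<bar> \<le> c"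
  obtains C where "C \<ge> 0" "\<And>i x. i \<in> I \<Longrightarrow> x \<in> D \<Longrightarrow> \<bar>Re (F i x x)\<bar> \<le> C * Re (q x x)"
proof -
  interpret M: Metric_space D form_dist by (rule Metric_space_form_dist)
  define S where "S n = {x \<in> D. \<forall>i\<in>I. \<bar>Re (F i x x)\<bar> \<le> real n}" for n
  have S_closed: "closedin M.mtopology (S n)" for n
    unfolding M.metric_closedin_iff_sequentially_closed
  proof (intro conjI allI impI)
    show "S n \<subseteq> D" by (auto simp: S_def)
    fix x l assume "range x \<subseteq> S n \<and> limitin M.mtopology x l sequentially"
    then have x: "range x \<subseteq> S n" and lim: "limitin M.mtopology x l sequentially" by auto
    have xS: "x j \<in> S n" for j using x by blast
    then have xD: "x j \<in> D" for j by (auto simp: S_def)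
    from limitin_form_dist[OF lim xD] closed[OF xD] xS show "l \<in> S n" by (auto simp: S_def)
  qed
  have "\<Union>(range S) = D"
  proof -
    have "\<exists>n. x \<in> S n" if x: "x \<in> D" for x
    proof -
      obtain c where c: "\<forall>i\<in>I. \<bar>Re (F i x x)\<bar> \<le> c" using pointwise[OF x] by blast
      obtain n :: nat where n: "c \<le> real n" using real_arch_simple by blast
      have "x \<in> S n" unfolding S_def using x c by (auto intro: order_trans[OF _ n])
      then show ?thesis ..
    qed
    then show ?thesis by (auto simp: S_def)
  qed
  then have "M.mtopology interior_of \<Union>(range S) \<noteq> {}"
    using interior_of_topspace[of M.mtopology] zero_mem by auto
  moreover have "M.mtopology interior_of \<Union>(range S) = {}" if "\<And>n. M.mtopology interior_of (S n) = {}"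
    using S_closed that by (intro M.metric_Baire_category_alt[OF mcomplete_form_dist]) auto
  ultimately obtain n where "M.mtopology interior_of (S n) \<noteq> {}" by blast
  then obtain x0 \<epsilon> where x0: "x0 \<in> D" "\<epsilon> > 0" "M.mball x0 \<epsilon> \<subseteq> S n"
    by (auto simp: M.metric_interior_of)
  have ball: "\<bar>Re (F i h h)\<bar> \<le> 2 * real n" if i: "i \<in> I" and h: "h \<in> D" "sqrt (Re (q h h)) < \<epsilon>" for i h
  proof -
    interpret Fi: hermitian_form D "F i" by (rule F[OF i])
    have "Re (q (- h) (- h)) = Re (q h h)" using quad_minus_commute[OF zero_mem h(1)] by simp
    then have "x0 + h \<in> M.mball x0 \<epsilon>" "x0 - h \<in> M.mball x0 \<epsilon>" "x0 \<in> M.mball x0 \<epsilon>"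
      using x0 h add_mem diff_mem zero_left[OF zero_mem] by (auto simp: form_dist_def)
    then have "x0 + h \<in> S n" "x0 - h \<in> S n" "x0 \<in> S n" using x0(3) by auto
    then have "\<bar>Re (F i (x0 + h) (x0 + h))\<bar> \<le> n" "\<bar>Re (F i (x0 - h) (x0 - h))\<bar> \<le> n" "\<bar>Re (F i x0 x0)\<bar> \<le> n"
      using i by (auto simp: S_def)
    \<comment> \<open>The second difference of \<open>F i\<close> at \<open>x0\<close> is twice the
      value at \<open>h\<close>, so twice that value is at most \<open>4 n\<close>.\<close>
    then show ?thesis using x0(1) h(1) by (simp add: Fi.quad_add Fi.quad_diff abs_le_iff)
  qed
  show ?thesis
  proof
    \<comment> \<open>Any nonzero \<open>x\<close> is rescaled to \<open>q\<close>-norm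
      \<open>\<epsilon> / 2\<close>, half the radius of the ball. The scaling factor satisfies
      \<open>c^2 = \<epsilon>^2 / (4 * Re (q x x))\<close>, and \<open>2 n / c^2\<close> yields the
      8.\<close>
    show "8 * real n / \<epsilon>\<^sup>2 \<ge> 0" by simp
    fix i x assume i: "i \<in> I" and x: "x \<in> D"
    interpret Fi: hermitian_form D "F i" by (rule F[OF i])
    show "\<bar>Re (F i x x)\<bar> \<le> 8 * real n / \<epsilon>\<^sup>2 * Re (q x x)"
    proof (cases "x = 0")
      case True then show ?thesis using zero_left[OF zero_mem] Fi.zero_left[OF zero_mem] by simp
    next
      case False
      then have Q: "Re (q x x) > 0" using nonneg[OF x] quad_eq_0[OF x] by simp
      define c where "c = \<epsilon> / (2 * sqrt (Re (q x x)))"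
      have c: "c > 0" "c\<^sup>2 * Re (q x x) = (\<epsilon> / 2)\<^sup>2"
        using Q x0(2) by (auto simp: c_def power_divide power_mult_distrib)
      have cx: "of_real c *\<^sub>C x \<in> D" using scale_mem x by blast
      have "Re (q (of_real c *\<^sub>C x) (of_real c *\<^sub>C x)) = (\<epsilon> / 2)\<^sup>2"
        using quad_scale[OF x, of "of_real c"] c by simp
      then have "sqrt (Re (q (of_real c *\<^sub>C x) (of_real c *\<^sub>C x))) = \<epsilon> / 2"
        using x0(2) by (simp add: real_sqrt_unique)
      then have "\<bar>Re (F i (of_real c *\<^sub>C x) (of_real c *\<^sub>C x))\<bar> \<le> 2 * real n"
        using x0(2) by (intro ball i cx) simp
      then have "c\<^sup>2 * \<bar>Re (F i x x)\<bar> \<le> 2 * real n"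
        using Fi.quad_scale[OF x, of "of_real c"] by (simp add: abs_mult)
      then have "\<bar>Re (F i x x)\<bar> \<le> 2 * real n / c\<^sup>2" using c by (simp add: field_simps)
      also have "\<dots> = 8 * real n / \<epsilon>\<^sup>2 * Re (q x x)"
        using Q x0(2) by (simp add: c_def field_simps)
      finally show ?thesis .
    qed
  qed
qed

text \<open>For forms already bounded one by one the closedness condition follows from continuity.
  The preceding version is kept apart because \<open>form_bounded_by\<close> applies it to a form
  that is only known to be semicontinuous.\<close>

lemma uniform_boundedness:
  fixes F :: "'i \<Rightarrow> 'a \<Rightarrow> 'a \<Rightarrow> complex"
  assumes F: "\<And>i. i \<in> I \<Longrightarrow> hermitian_form D (F i)"
    and bounded: "\<And>i. i \<in> I \<Longrightarrow> \<exists>C. \<forall>x\<in>D. \<bar>Re (F i x x)\<bar> \<le> C * Re (q x x)"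
    and pointwise: "\<And>x. x \<in> D \<Longrightarrow> \<exists>c. \<forall>i\<in>I. \<bar>Re (F i x x)\<bar> \<le> c"
  obtains C where "C \<ge> 0" "\<And>i x. i \<in> I \<Longrightarrow> x \<in> D \<Longrightarrow> \<bar>Re (F i x x)\<bar> \<le> C * Re (q x x)"
proof (rule uniform_boundedness_closed[OF F _ pointwise])
  fix c x l i
  assume x: "\<And>j. x j \<in> D" "l \<in> D" "(\<lambda>j. Re (q (x j - l) (x j - l))) \<longlonglongrightarrow> 0"
    and c: "\<And>j. \<bar>Re (F i (x j) (x j))\<bar> \<le> c" and i: "i \<in> I"
  obtain C where "\<And>x. x \<in> D \<Longrightarrow> \<bar>Re (F i x x)\<bar> \<le> C * Re (q x x)" using bounded[OF i] by blast
  from tendsto_rabs[OF tendsto_quad[OF F[OF i] this x]]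
  show "\<bar>Re (F i l l)\<bar> \<le> c" by (rule tendsto_upperbound) (use c in auto)
qed (use that in auto)

end

text \<open>A closed form is lower semicontinuous: the energy of \<open>l\<close> is a supremum, over \<open>y\<close> in the operator
  domain, of expressions that are continuous in \<open>l\<close> for the norm of the ambient space.\<close>

lemma (in form_operator) form_bounded_by:
  assumes "hilbert_form D q"
  obtains C where "\<And>x. x \<in> D \<Longrightarrow> \<bar>Re (a x x)\<bar> \<le> C * Re (q x x)"
proof -
  interpret q: hilbert_form D q by fact
  \<comment> \<open>With a one-element family, Baire plays the role of the closed graph theorem: a
    single semicontinuous form is bounded.\<close>
  obtain C where C: "C \<ge> 0" "\<And>i x. i \<in> {()} \<Longrightarrow> x \<in> D \<Longrightarrow> \<bar>Re (energy_form x x)\<bar> \<le> C * Re (q x x)"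
  proof (rule q.uniform_boundedness_closed[of "{()}" "\<lambda>_. energy_form"])
    show "hermitian_form D energy_form" by (rule energy.hermitian_form_axioms)
    show "\<exists>c. \<forall>i\<in>{()}. \<bar>Re (energy_form x x)\<bar> \<le> c" for x by auto
    fix c x l
    assume x: "\<And>j. x j \<in> D" "l \<in> D" "(\<lambda>j. Re (q (x j - l) (x j - l))) \<longlonglongrightarrow> 0"
      and c: "\<And>j. \<bar>Re (energy_form (x j) (x j))\<bar> \<le> c"
    have "(\<lambda>j. (norm (x j - l))\<^sup>2) \<longlonglongrightarrow> 0"
      by (rule tendsto_sandwich[OF _ _ tendsto_const x(3)])
        (use x q.norm_le diff_mem in \<open>auto intro!: always_eventually\<close>)
    then have xl: "x \<longlonglongrightarrow> l" by (rule tendsto_if_norm_squared)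
    have c0: "c \<ge> 0" using c[of 0] abs_ge_zero order_trans by blast
    \<comment> \<open>Against \<open>y\<close> in \<open>DA\<close> the energy form is an ambient
      inner product, so the Cauchy-Schwarz bound for \<open>x j\<close> survives the limit. Density
      of \<open>DA\<close> then allows \<open>y\<close> to approach \<open>l\<close>.\<close>
    have le: "cmod (energy_form l y) \<le> sqrt c * sqrt (energy y)" if y: "y \<in> DA" for y
    proof (rule tendsto_upperbound)
      have yD: "y \<in> D" using y domain_subset by blast
      have rep: "energy_form u y = cinner u (T y + of_real shift *\<^sub>C y)" if "u \<in> D" for u
      proof -
        have "a u y = cinner u (T y)"
          using represents[OF y that] sym[OF that yD] cinner_commute[of u "T y"] by simp
        then show ?thesis by (simp add: energy_form_def cinner_add_right cinner_scaleC_right)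
      qed
      show "(\<lambda>j. cmod (energy_form (x j) y)) \<longlonglongrightarrow> cmod (energy_form l y)"
        unfolding rep[OF x(1)] rep[OF x(2)] by (intro tendsto_norm tendsto_cinner_left xl)
      have "cmod (energy_form (x j) y) \<le> sqrt c * sqrt (energy y)" for j
      proof -
        have "cmod (energy_form (x j) y) \<le> sqrt (energy (x j)) * sqrt (energy y)"
          using energy.Cauchy_Schwarz[OF x(1) yD] by (simp add: Re_energy_form)
        also have "\<dots> \<le> sqrt c * sqrt (energy y)"
          using c[of j] energy_nonneg[OF yD] by (intro mult_right_mono) (auto simp: Re_energy_form)
        finally show ?thesis .
      qed
      then show "\<forall>\<^sub>F j in sequentially. cmod (energy_form (x j) y) \<le> sqrt c * sqrt (energy y)" by simp
    qed simp
    obtain u where u: "\<And>n. u n \<in> DA" "(\<lambda>n. energy (u n - l)) \<longlonglongrightarrow> 0"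
      using domain_energy_dense[OF x(2)] by blast
    have uD: "u n \<in> D" for n using u(1) domain_subset by blast
    have "(\<lambda>n. energy_form (u n) l) \<longlonglongrightarrow> energy_form l l"
      using uD x(2) u(2) by (intro energy.tendsto_form_left) (auto simp: Re_energy_form)
    then have "(\<lambda>n. cmod (energy_form (u n) l)) \<longlonglongrightarrow> cmod (energy_form l l)" by (rule tendsto_norm)
    moreover have "(\<lambda>n. sqrt c * sqrt (energy (u n))) \<longlonglongrightarrow> sqrt c * sqrt (energy l)"
      using energy.tendsto_quad[OF energy.hermitian_form_axioms, of 1 u l] uD x(2) u(2) energy_nonneg
      by (intro tendsto_intros) (auto simp: Re_energy_form)
    moreover have "cmod (energy_form (u n) l) \<le> sqrt c * sqrt (energy (u n))" for n
      using le[OF u(1)[of n]] energy.sym[OF uD[of n] x(2)] by simp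
    ultimately have "cmod (energy_form l l) \<le> sqrt c * sqrt (energy l)"
      by (intro LIMSEQ_le) auto
    then have "energy l \<le> sqrt c * sqrt (energy l)"
      using complex_Re_le_cmod[of "energy_form l l"] by (simp add: Re_energy_form)
    moreover have "energy l = sqrt (energy l) * sqrt (energy l)" using energy_nonneg[OF x(2)] by simp
    ultimately have "sqrt (energy l) * sqrt (energy l) \<le> sqrt c * sqrt (energy l)" by simp
    then have "sqrt (energy l) \<le> sqrt c"
    proof (cases "energy l = 0")
      case False
      then have "0 < sqrt (energy l)" using energy_nonneg[OF x(2)] by simp
      then show ?thesis by (rule mult_right_le_imp_le[rotated]) fact
    qed (use c0 in simp)
    then show "\<bar>Re (energy_form l l)\<bar> \<le> c"
      using energy_nonneg[OF x(2)] by (simp add: Re_energy_form)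
  qed auto
  show ?thesis
  proof
    fix x assume x: "x \<in> D"
    have "\<bar>Re (a x x)\<bar> \<le> (1 + shift) * energy x" by (rule abs_form_le_energy[OF x])
    also have "\<dots> \<le> (1 + shift) * (C * Re (q x x))"
      using C(2)[of "()" x] x shift_nonneg by (intro mult_left_mono) (auto simp: Re_energy_form)
    finally show "\<bar>Re (a x x)\<bar> \<le> (1 + shift) * C * Re (q x x)" by (simp add: mult.assoc)
  qed
qed

section \<open>First-order expansion of the forms\<close>

text \<open>The part of the holomorphic family that the asymptotics use: real parameters from 0 to
  \<open>\<rho>\<close>, and a second-order expansion whose constant \<open>M\<close> may depend on
  \<open>x\<close>.\<close>

locale perturbed_operator =
  fixes D :: "'a::complex_hilbert set" and a :: "real \<Rightarrow> 'a \<Rightarrow> 'a \<Rightarrow> complex"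
    and DA :: "real \<Rightarrow> 'a set" and A :: "real \<Rightarrow> 'a \<Rightarrow> 'a"
    and a1 :: "'a \<Rightarrow> 'a \<Rightarrow> complex" and \<rho> :: real
  assumes rho_pos: "\<rho> > 0"
    and operators: "0 \<le> t \<Longrightarrow> t \<le> \<rho> \<Longrightarrow> form_operator D (a t) (DA t) (A t)"
    and a1_form: "hermitian_form D a1"
    and expansion: "x \<in> D \<Longrightarrow> \<exists>M. \<forall>t. 0 \<le> t \<longrightarrow> t \<le> \<rho> \<longrightarrow>
        \<bar>Re (a t x x) - Re (a 0 x x) - t * Re (a1 x x)\<bar> \<le> M * t\<^sup>2"
begin

sublocale A0: form_operator D "a 0" "DA 0" "A 0"
  using operators[of 0] rho_pos by simp

sublocale a1: hermitian_form D a1 by (rule a1_form)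

definition increment :: "real \<Rightarrow> 'a \<Rightarrow> 'a \<Rightarrow> complex" where
  "increment t x y = a t x y - a 0 x y"

definition remainder :: "real \<Rightarrow> 'a \<Rightarrow> 'a \<Rightarrow> complex" where
  "remainder t x y = increment t x y - complex_of_real t * a1 x y"

lemma
  assumes "0 \<le> t" "t \<le> \<rho>"
  shows hermitian_increment: "hermitian_form D (increment t)"
    and hermitian_remainder: "hermitian_form D (remainder t)"
proof -
  interpret At: form_operator D "a t" "DA t" "A t" by (rule operators[OF assms])
  show 1: "hermitian_form D (increment t)"
    using hermitian_form_diff[OF At.hermitian_form_axioms A0.hermitian_form_axioms]
    by (simp add: increment_def[abs_def])
  show "hermitian_form D (remainder t)"
    using hermitian_form_diff[OF 1 hermitian_form_scale[OF a1_form]]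
    by (simp add: remainder_def[abs_def])
qed

abbreviation energy0 :: "'a \<Rightarrow> real" where "energy0 \<equiv> A0.energy"

text \<open>Closedness of \<open>a t\<close> and \<open>a 0\<close> on the same domain is what makes
  them comparable. The constant still depends on \<open>t\<close>; uniformity is the content of the
  next lemma.\<close>

lemma increment_bounded:
  assumes t: "0 \<le> t" "t \<le> \<rho>"
  shows "\<exists>C. \<forall>x\<in>D. \<bar>Re (increment t x x)\<bar> \<le> C * energy0 x"
proof -
  interpret At: form_operator D "a t" "DA t" "A t" by (rule operators[OF t])
  obtain C where C: "\<And>x. x \<in> D \<Longrightarrow> \<bar>Re (a t x x)\<bar> \<le> C * Re (A0.energy_form x x)"
    using At.form_bounded_by[OF A0.energy.hilbert_form_axioms] by blast
  have "\<bar>Re (increment t x x)\<bar> \<le> (C + (1 + A0.shift)) * energy0 x" if "x \<in> D" for x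
    using C[OF that] A0.abs_form_le_energy[OF that]
    by (auto simp: increment_def A0.Re_energy_form distrib_right)
  then show ?thesis by blast
qed

text \<open>Uniform boundedness applies to the increments divided by \<open>t\<close>, which the
  expansion bounds for each fixed \<open>x\<close>. The bound on \<open>a1\<close> follows as
  \<open>t\<close> tends to 0.\<close>

lemma first_order_bounds:
  obtains C where "C \<ge> 0" "\<And>t x. 0 \<le> t \<Longrightarrow> t \<le> \<rho> \<Longrightarrow> x \<in> D \<Longrightarrow> \<bar>Re (increment t x x)\<bar> \<le> C * t * energy0 x"
    "\<And>x. x \<in> D \<Longrightarrow> \<bar>Re (a1 x x)\<bar> \<le> C * energy0 x"
proof -
  define F where "F t x y = complex_of_real (1 / t) * increment t x y" for t x y
  have ReF: "\<bar>Re (F t x x)\<bar> = \<bar>Re (increment t x x)\<bar> / t" if "t > 0" for t x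
    using that by (simp add: F_def)
  obtain C where C: "C \<ge> 0" "\<And>t x. t \<in> {0<..\<rho>} \<Longrightarrow> x \<in> D \<Longrightarrow> \<bar>Re (F t x x)\<bar> \<le> C * Re (A0.energy_form x x)"
  proof (rule A0.energy.uniform_boundedness[of "{0<..\<rho>}" F])
    show "hermitian_form D (F t)" if "t \<in> {0<..\<rho>}" for t
      unfolding F_def[abs_def] using that by (intro hermitian_form_scale hermitian_increment) auto
    show "\<exists>C. \<forall>x\<in>D. \<bar>Re (F t x x)\<bar> \<le> C * Re (A0.energy_form x x)" if t: "t \<in> {0<..\<rho>}" for t
    proof -
      obtain C where "\<forall>x\<in>D. \<bar>Re (increment t x x)\<bar> \<le> C * energy0 x"
        using increment_bounded[of t] t by auto
      then have "\<forall>x\<in>D. \<bar>Re (F t x x)\<bar> \<le> C / t * Re (A0.energy_form x x)"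
        using t by (simp add: ReF A0.Re_energy_form divide_right_mono)
      then show ?thesis by blast
    qed
    show "\<exists>c. \<forall>t\<in>{0<..\<rho>}. \<bar>Re (F t x x)\<bar> \<le> c" if x: "x \<in> D" for x
    proof -
      obtain M where M: "\<And>t. 0 \<le> t \<Longrightarrow> t \<le> \<rho> \<Longrightarrow> \<bar>Re (a t x x) - Re (a 0 x x) - t * Re (a1 x x)\<bar> \<le> M * t\<^sup>2"
        using expansion[OF x] by blast
      have M0: "M \<ge> 0" using M[of \<rho>] rho_pos order_trans[OF abs_ge_zero]
        by (metis less_eq_real_def zero_le_mult_iff zero_less_power not_le)
      have "\<bar>Re (F t x x)\<bar> \<le> \<bar>Re (a1 x x)\<bar> + M * \<rho>" if t: "t \<in> {0<..\<rho>}" for t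
      proof -
        have "\<bar>Re (increment t x x)\<bar> \<le> \<bar>t * Re (a1 x x)\<bar> + M * t\<^sup>2"
          using M[of t] t by (simp add: increment_def)
        also have "\<dots> = t * (\<bar>Re (a1 x x)\<bar> + M * t)"
          using t by (simp add: abs_mult power2_eq_square algebra_simps)
        also have "\<dots> \<le> t * (\<bar>Re (a1 x x)\<bar> + M * \<rho>)"
          using t M0 by (intro mult_left_mono add_left_mono) auto
        finally show ?thesis using t by (simp add: ReF divide_le_eq mult.commute)
      qed
      then show ?thesis by blast
    qed
  qed auto
  have incr: "\<bar>Re (increment t x x)\<bar> \<le> C * t * energy0 x" if t: "0 \<le> t" "t \<le> \<rho>" and x: "x \<in> D" for t x
  proof (cases "t = 0")
    case True then show ?thesis by (simp add: increment_def)
  next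
    case False
    then show ?thesis using C(2)[of t x] t x by (simp add: ReF A0.Re_energy_form field_simps)
  qed
  have "\<bar>Re (a1 x x)\<bar> \<le> C * energy0 x" if x: "x \<in> D" for x
  proof -
    obtain M where M: "\<And>t. 0 \<le> t \<Longrightarrow> t \<le> \<rho> \<Longrightarrow> \<bar>Re (a t x x) - Re (a 0 x x) - t * Re (a1 x x)\<bar> \<le> M * t\<^sup>2"
      using expansion[OF x] by blast
    show ?thesis
    proof (rule tendsto_lowerbound)
      show "((\<lambda>t. C * energy0 x + M * t) \<longlongrightarrow> C * energy0 x) (at_right 0)"
        by (auto intro!: tendsto_eq_intros)
      have "\<bar>Re (a1 x x)\<bar> \<le> C * energy0 x + M * t" if t: "0 < t" "t \<le> \<rho>" for t
      proof -
        have "t * \<bar>Re (a1 x x)\<bar> = \<bar>t * Re (a1 x x)\<bar>" using t by (simp add: abs_mult)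
        also have "\<dots> \<le> \<bar>Re (increment t x x)\<bar> + M * t\<^sup>2"
          using M[of t] t unfolding increment_def by simp
        also have "\<dots> \<le> C * t * energy0 x + M * t\<^sup>2" using incr[of t x] t x by simp
        also have "\<dots> = t * (C * energy0 x + M * t)" by (simp add: power2_eq_square algebra_simps)
        finally show ?thesis using t by simp
      qed
      then show "\<forall>\<^sub>F t in at_right 0. \<bar>Re (a1 x x)\<bar> \<le> C * energy0 x + M * t"
        using rho_pos by (auto simp: eventually_at_right_field intro!: exI[of _ \<rho>])
    qed simp
  qed
  with incr C(1) that show ?thesis by blast
qed

text \<open>The same argument one order higher: the remainders divided by \<open>t^2\<close> are
  bounded one by one by the first-order bounds, and for each fixed \<open>x\<close> by the constant
  \<open>M\<close> of the expansion.\<close>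

lemma second_order_bound:
  obtains C where "C \<ge> 0" "\<And>t x. 0 \<le> t \<Longrightarrow> t \<le> \<rho> \<Longrightarrow> x \<in> D \<Longrightarrow> \<bar>Re (remainder t x x)\<bar> \<le> C * t\<^sup>2 * energy0 x"
proof -
  obtain C1 where C1: "C1 \<ge> 0" "\<And>t x. 0 \<le> t \<Longrightarrow> t \<le> \<rho> \<Longrightarrow> x \<in> D \<Longrightarrow> \<bar>Re (increment t x x)\<bar> \<le> C1 * t * energy0 x"
    "\<And>x. x \<in> D \<Longrightarrow> \<bar>Re (a1 x x)\<bar> \<le> C1 * energy0 x"
    using first_order_bounds by blast
  define F where "F t x y = complex_of_real (1 / t\<^sup>2) * remainder t x y" for t x y
  have ReF: "\<bar>Re (F t x x)\<bar> = \<bar>Re (remainder t x x)\<bar> / t\<^sup>2" for t x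
  proof -
    have "Re (F t x x) = Re (remainder t x x) / t\<^sup>2"
      unfolding F_def by (simp del: of_real_divide of_real_power)
    then show ?thesis by simp
  qed
  obtain C where C: "C \<ge> 0" "\<And>t x. t \<in> {0<..\<rho>} \<Longrightarrow> x \<in> D \<Longrightarrow> \<bar>Re (F t x x)\<bar> \<le> C * Re (A0.energy_form x x)"
  proof (rule A0.energy.uniform_boundedness[of "{0<..\<rho>}" F])
    show "hermitian_form D (F t)" if "t \<in> {0<..\<rho>}" for t
      unfolding F_def[abs_def] using that by (intro hermitian_form_scale hermitian_remainder) auto
    show "\<exists>C. \<forall>x\<in>D. \<bar>Re (F t x x)\<bar> \<le> C * Re (A0.energy_form x x)" if t: "t \<in> {0<..\<rho>}" for t
    proof -
      have "\<bar>Re (remainder t x x)\<bar> \<le> 2 * C1 * t * energy0 x" if x: "x \<in> D" for x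
      proof -
        have "\<bar>Re (remainder t x x)\<bar> \<le> \<bar>Re (increment t x x)\<bar> + t * \<bar>Re (a1 x x)\<bar>"
          using t abs_triangle_ineq4[of "Re (increment t x x)" "t * Re (a1 x x)"]
          by (simp add: remainder_def abs_mult)
        also have "\<dots> \<le> C1 * t * energy0 x + t * (C1 * energy0 x)"
          using t x C1 by (intro add_mono mult_left_mono) auto
        finally show ?thesis by (simp add: algebra_simps)
      qed
      then have "\<forall>x\<in>D. \<bar>Re (F t x x)\<bar> \<le> 2 * C1 * t / t\<^sup>2 * Re (A0.energy_form x x)"
        by (simp add: ReF A0.Re_energy_form divide_right_mono)
      then show ?thesis by blast
    qed
    show "\<exists>c. \<forall>t\<in>{0<..\<rho>}. \<bar>Re (F t x x)\<bar> \<le> c" if x: "x \<in> D" for x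
    proof -
      obtain M where M: "\<And>t. 0 \<le> t \<Longrightarrow> t \<le> \<rho> \<Longrightarrow> \<bar>Re (a t x x) - Re (a 0 x x) - t * Re (a1 x x)\<bar> \<le> M * t\<^sup>2"
        using expansion[OF x] by blast
      have "\<bar>Re (F t x x)\<bar> \<le> M" if t: "t \<in> {0<..\<rho>}" for t
        using M[of t] t by (simp add: ReF remainder_def increment_def divide_le_eq)
      then show ?thesis by blast
    qed
  qed auto
  show ?thesis
  proof (rule that[OF C(1)])
    fix t x assume t: "0 \<le> t" "t \<le> \<rho>" and x: "x \<in> D"
    show "\<bar>Re (remainder t x x)\<bar> \<le> C * t\<^sup>2 * energy0 x"
    proof (cases "t = 0")
      case True then show ?thesis by (simp add: remainder_def increment_def)
    next
      case False
      then show ?thesis using C(2)[of t x] t x by (simp add: ReF A0.Re_energy_form field_simps)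
    qed
  qed
qed

lemma polarized_bounds:
  obtains C where "C > 0"
    "\<And>t x y. 0 \<le> t \<Longrightarrow> t \<le> \<rho> \<Longrightarrow> x \<in> D \<Longrightarrow> y \<in> D \<Longrightarrow>
      cmod (increment t x y) \<le> C * t * (sqrt (energy0 x) * sqrt (energy0 y))"
    "\<And>x y. x \<in> D \<Longrightarrow> y \<in> D \<Longrightarrow> cmod (a1 x y) \<le> C * (sqrt (energy0 x) * sqrt (energy0 y))"
    "\<And>t x y. 0 \<le> t \<Longrightarrow> t \<le> \<rho> \<Longrightarrow> x \<in> D \<Longrightarrow> y \<in> D \<Longrightarrow>
      cmod (remainder t x y) \<le> C * t\<^sup>2 * (sqrt (energy0 x) * sqrt (energy0 y))"
proof -
  obtain C1 where C1: "C1 \<ge> 0" "\<And>t x. 0 \<le> t \<Longrightarrow> t \<le> \<rho> \<Longrightarrow> x \<in> D \<Longrightarrow> \<bar>Re (increment t x x)\<bar> \<le> C1 * t * energy0 x"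
    "\<And>x. x \<in> D \<Longrightarrow> \<bar>Re (a1 x x)\<bar> \<le> C1 * energy0 x"
    using first_order_bounds by blast
  obtain C2 where C2: "C2 \<ge> 0" "\<And>t x. 0 \<le> t \<Longrightarrow> t \<le> \<rho> \<Longrightarrow> x \<in> D \<Longrightarrow> \<bar>Re (remainder t x x)\<bar> \<le> C2 * t\<^sup>2 * energy0 x"
    using second_order_bound by blast
  define C where "C = 1 + C1 + C2"
  have C: "C > 0" "C1 \<le> C" "C2 \<le> C" using C1(1) C2(1) by (auto simp: C_def)
  have pos: "0 \<le> sqrt (energy0 x) * sqrt (energy0 y)" if "x \<in> D" "y \<in> D" for x y
    using A0.energy_nonneg that by simp
  show ?thesis
  proof
    show "C > 0" by fact
    show "cmod (a1 x y) \<le> C * (sqrt (energy0 x) * sqrt (energy0 y))" if xy: "x \<in> D" "y \<in> D" for x y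
    proof -
      have "cmod (a1 x y) \<le> C1 * (sqrt (energy0 x) * sqrt (energy0 y))"
        using A0.energy.form_bound_polarize[OF a1_form _ C1(1) xy] C1(3) by (simp add: A0.Re_energy_form)
      also have "\<dots> \<le> C * (sqrt (energy0 x) * sqrt (energy0 y))" by (intro mult_right_mono C pos xy)
      finally show ?thesis .
    qed
    fix t x y assume t: "0 \<le> t" "t \<le> \<rho>" and xy: "x \<in> D" "y \<in> D"
    have "cmod (increment t x y) \<le> C1 * t * (sqrt (energy0 x) * sqrt (energy0 y))"
      using A0.energy.form_bound_polarize[OF hermitian_increment[OF t] _ _ xy, of "C1 * t"] C1(1,2) t
      by (simp add: A0.Re_energy_form)
    also have "\<dots> \<le> C * t * (sqrt (energy0 x) * sqrt (energy0 y))" by (intro mult_right_mono C pos xy t)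
    finally show "cmod (increment t x y) \<le> C * t * (sqrt (energy0 x) * sqrt (energy0 y))" .
    have "cmod (remainder t x y) \<le> C2 * t\<^sup>2 * (sqrt (energy0 x) * sqrt (energy0 y))"
      using A0.energy.form_bound_polarize[OF hermitian_remainder[OF t] _ _ xy, of "C2 * t\<^sup>2"] C2(1,2) t
      by (simp add: A0.Re_energy_form)
    also have "\<dots> \<le> C * t\<^sup>2 * (sqrt (energy0 x) * sqrt (energy0 y))" by (intro mult_right_mono C pos xy) auto
    finally show "cmod (remainder t x y) \<le> C * t\<^sup>2 * (sqrt (energy0 x) * sqrt (energy0 y))" .
  qed
qed

end

text \<open>Bounded energy upgrades weak convergence in the ambient space to weak convergence in the
  energy space: for \<open>h\<close> in \<open>DA\<close> the energy form is an ambient inner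
  product, and such \<open>h\<close> approximate \<open>g\<close> in energy.\<close>

lemma (in form_operator) weakly_null_energy_form:
  assumes w: "\<And>n. w n \<in> D" "\<And>n. energy (w n) \<le> B" "weakly_convergent_to w 0" and g: "g \<in> D"
  shows "(\<lambda>n. energy_form (w n) g) \<longlonglongrightarrow> 0"
proof (rule LIMSEQ_I)
  fix e :: real assume e: "e > 0"
  have B: "B \<ge> 0" using w(2)[of 0] energy_nonneg[OF w(1)] order_trans by blast
  define \<delta> where "\<delta> = e / (2 * (sqrt B + 1))"
  have \<delta>: "\<delta> > 0" using e B by (simp add: \<delta>_def add_nonneg_pos)
  obtain u where u: "\<And>n. u n \<in> DA" "(\<lambda>n. energy (u n - g)) \<longlonglongrightarrow> 0"
    using domain_energy_dense[OF g] by blast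
  have "(\<lambda>n. sqrt (energy (u n - g))) \<longlonglongrightarrow> sqrt 0" using u(2) by (rule tendsto_real_sqrt)
  then have "\<forall>\<^sub>F n in sequentially. sqrt (energy (u n - g)) < \<delta>" using \<delta> by (intro order_tendstoD) auto
  then obtain h where h: "h \<in> DA" "sqrt (energy (h - g)) < \<delta>"
    using u(1) eventually_happens' trivial_limit_sequentially by blast
  have hD: "h \<in> D" using h domain_subset by blast
  have "energy_form (w n) h = cinner (w n) (T h) + of_real shift * cinner (w n) h" for n
    using represents[OF h(1) w(1)] sym[OF w(1) hD] cinner_commute[of "w n" "T h"]
    by (simp add: energy_form_def)
  moreover have "(\<lambda>n. cinner (w n) (T h) + of_real shift * cinner (w n) h) \<longlonglongrightarrow> cinner 0 (T h) + of_real shift * cinner 0 h"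
    using w(3) unfolding weakly_convergent_to_def by (intro tendsto_add tendsto_mult tendsto_const) blast+
  ultimately have "(\<lambda>n. energy_form (w n) h) \<longlonglongrightarrow> 0" by simp
  then obtain N where N: "\<And>n. n \<ge> N \<Longrightarrow> cmod (energy_form (w n) h) < e / 2"
    using LIMSEQ_D[of _ 0 "e / 2"] e by auto
  have "cmod (energy_form (w n) g) < e" if n: "n \<ge> N" for n
  proof -
    have "cmod (energy_form (w n) (h - g)) \<le> sqrt (energy (w n)) * sqrt (energy (h - g))"
      using energy.Cauchy_Schwarz[OF w(1), of "h - g" n] hD g diff_mem by (simp add: Re_energy_form)
    also have "\<dots> \<le> sqrt B * \<delta>"
      using w(2)[of n] h(2) energy_nonneg[OF diff_mem[OF hD g]] B by (intro mult_mono) auto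
    also have "\<dots> \<le> e / 2"
    proof -
      have "sqrt B * \<delta> \<le> (sqrt B + 1) * \<delta>" using \<delta> by (intro mult_right_mono) auto
      also have "\<dots> = e / 2"
      proof -
        have "c * (e / (2 * c)) = e / 2" if "c \<noteq> 0" for c :: real using that by simp
        moreover have "sqrt B + 1 \<noteq> 0" using real_sqrt_ge_zero[OF B] by linarith
        ultimately show ?thesis unfolding \<delta>_def by blast
      qed
      finally show ?thesis .
    qed
    finally have "cmod (energy_form (w n) (h - g)) \<le> e / 2" .
    moreover have "energy_form (w n) g = energy_form (w n) h - energy_form (w n) (h - g)"
      using w(1) hD g by (simp add: energy.diff_right)
    ultimately show ?thesis
      using N[OF n] norm_triangle_ineq4[of "energy_form (w n) h" "energy_form (w n) (h - g)"] by simp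
  qed
  then show "\<exists>N. \<forall>n\<ge>N. norm (energy_form (w n) g - 0) < e" by auto
qed

text \<open>Refining once per index suffices because each \<open>P i\<close> passes to subsequences,
  so later refinements keep what earlier ones achieved.\<close>

lemma common_subsequence:
  fixes P :: "'i \<Rightarrow> (nat \<Rightarrow> nat) \<Rightarrow> bool"
  assumes "finite I"
    and ex: "\<And>i (r :: nat \<Rightarrow> nat). i \<in> I \<Longrightarrow> strict_mono r \<Longrightarrow> \<exists>r' :: nat \<Rightarrow> nat. strict_mono r' \<and> P i (r \<circ> r')"
    and sub: "\<And>i (r :: nat \<Rightarrow> nat) (r' :: nat \<Rightarrow> nat). P i r \<Longrightarrow> strict_mono r' \<Longrightarrow> P i (r \<circ> r')"
  shows "\<exists>r. strict_mono r \<and> (\<forall>i\<in>I. P i r)"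
  using assms(1,2)
proof (induction I)
  case empty
  show ?case by (intro exI[of _ id]) (simp add: strict_mono_def)
next
  case (insert i I)
  then obtain r where r: "strict_mono r" "\<forall>i\<in>I. P i r" by blast
  obtain r' where r': "strict_mono r'" "P i (r \<circ> r')" using insert.prems[of i r] r(1) by blast
  have "strict_mono (r \<circ> r')" using r(1) r'(1) by (rule strict_mono_o)
  then show ?case using r(2) r' sub by blast
qed

section \<open>Eigenvectors whose slopes stay below the slope of the threshold\<close>

locale perturbed_threshold = perturbed_operator D a DA A a1 \<rho>
  for D :: "'a::complex_hilbert set" and a DA A a1 \<rho> +
  fixes \<Sigma> :: "real \<Rightarrow> real" and \<omega> :: real and N :: "'a set" and \<kappa> :: "'a \<Rightarrow> real"
  assumes below_threshold: "0 \<le> t \<Longrightarrow> t \<le> \<rho> \<Longrightarrow> r < \<Sigma> t \<Longrightarrow> complex_of_real r \<notin> essential_spectrum (DA t) (A t)"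
    and threshold_slope: "((\<lambda>t. \<Sigma> t / t) \<longlongrightarrow> \<omega>) (at_right 0)"
    and N: "orthonormal N" "finite N"
    and N_eigen: "\<And>e. e \<in> N \<Longrightarrow> e \<in> eigenspace (DA 0) (A 0) (\<kappa> e)" "\<And>e. e \<in> N \<Longrightarrow> \<kappa> e < 0"
    and N_compl: "\<And>x. x \<in> D \<Longrightarrow> x \<in> orth_compl N \<Longrightarrow> 0 \<le> Re (a 0 x x)"
begin

abbreviation K :: "'a set" where "K \<equiv> operator_kernel (DA 0) (A 0)"

lemma K_eq: "K = eigenspace (DA 0) (A 0) 0"
  by (auto simp: operator_kernel_def eigenspace_def)

lemma K_subset: "y \<in> K \<Longrightarrow> y \<in> D"
  using A0.eigenspace_subset K_eq by blast

lemma
  assumes "p \<in> K" "y \<in> D"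
  shows K_left: "a 0 p y = 0" and K_right: "a 0 y p = 0"
  using A0.eigenvector_form[of p 0 y] assms by (simp_all add: K_eq)

text \<open>The weak eigenvalue equation for the compression of \<open>a1\<close> to the kernel,
  that is for \<open>B\<^sub>0\<close> on \<open>K\<close>, phrased without the projection.\<close>

definition first_order_eigenvector :: "'a \<Rightarrow> real \<Rightarrow> bool" where
  "first_order_eigenvector z \<nu> \<longleftrightarrow> z \<in> K \<and> (\<forall>y\<in>K. a1 z y = of_real \<nu> * cinner z y)"

lemma form_decompose:
  "a t x y = a 0 x y + increment t x y"
  "a t x y = a 0 x y + of_real t * a1 x y + remainder t x y"
  by (simp_all add: increment_def remainder_def)

text \<open>With \<open>y\<close> fixed, \<open>a1\<close> is a bounded functional on the energy
  space, so Riesz turns it into the energy form against some \<open>g\<close>.\<close>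

lemma weakly_null_a1:
  assumes w: "\<And>n. w n \<in> D" "\<And>n. energy0 (w n) \<le> B" "weakly_convergent_to w 0" and y: "y \<in> D"
  shows "(\<lambda>n. a1 (w n) y) \<longlonglongrightarrow> 0"
proof -
  obtain C where C: "\<And>x y. x \<in> D \<Longrightarrow> y \<in> D \<Longrightarrow> cmod (a1 x y) \<le> C * (sqrt (energy0 x) * sqrt (energy0 y))"
    using polarized_bounds by metis
  have "\<exists>g\<in>D. \<forall>x\<in>D. a1 x y = A0.energy_form x g"
  proof (rule A0.energy.Riesz[where C = "C * sqrt (energy0 y)"])
    show "cmod (a1 x y) \<le> C * sqrt (energy0 y) * sqrt (Re (A0.energy_form x x))" if "x \<in> D" for x
      using C[OF that y] by (simp add: A0.Re_energy_form mult.commute mult.left_commute)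
  qed (use y in \<open>auto simp: a1.add_left a1.scale_left\<close>)
  then obtain g where "g \<in> D" "\<And>x. x \<in> D \<Longrightarrow> a1 x y = A0.energy_form x g" by blast
  with A0.weakly_null_energy_form[OF w] w(1) show ?thesis by simp
qed

text \<open>A weakly null sequence with vanishing \<open>a 0\<close>-energy is, for each fixed small \<open>t\<close>, asymptotically
  bounded below by the threshold \<open>\<Sigma> t\<close>. Dividing by \<open>t\<close> bounds \<open>a1\<close> along the sequence.\<close>

lemma weakly_null_a1_lower:
  assumes w: "\<And>n. w n \<in> D" "\<And>n. energy0 (w n) \<le> B" "weakly_convergent_to w 0"
    and a0: "(\<lambda>n. Re (a 0 (w n) (w n))) \<longlonglongrightarrow> 0" and norm: "(\<lambda>n. (norm (w n))\<^sup>2) \<longlonglongrightarrow> \<beta>" and e: "e > 0"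
  shows "\<forall>\<^sub>F n in sequentially. \<omega> * \<beta> - e < Re (a1 (w n) (w n))"
proof -
  obtain C where C: "C \<ge> 0" "\<And>t x. 0 \<le> t \<Longrightarrow> t \<le> \<rho> \<Longrightarrow> x \<in> D \<Longrightarrow> \<bar>Re (remainder t x x)\<bar> \<le> C * t\<^sup>2 * energy0 x"
    using second_order_bound by blast
  \<comment> \<open>This is the lower bound to come, divided by \<open>t\<close>. The
    \<open>- t\<close> stems from lowering the threshold to \<open>s = \<Sigma> t - t^2\<close>, so
    that all of \<open>{..s}\<close> avoids the essential spectrum; \<open>C * t * B\<close> stems
    from the remainder.\<close>
  have "((\<lambda>t. (\<Sigma> t / t - t) * \<beta> - C * t * B) \<longlongrightarrow> (\<omega> - 0) * \<beta> - C * 0 * B) (at_right 0)"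
    by (intro tendsto_intros threshold_slope)
  then have "\<forall>\<^sub>F t in at_right 0. \<omega> * \<beta> - e / 2 < (\<Sigma> t / t - t) * \<beta> - C * t * B"
    using e by (intro order_tendstoD) auto
  moreover have "\<forall>\<^sub>F t in at_right 0. 0 < t \<and> t \<le> \<rho>"
    using rho_pos by (auto simp: eventually_at_right_field intro!: exI[of _ \<rho>])
  ultimately have "\<forall>\<^sub>F t in at_right 0. \<omega> * \<beta> - e / 2 < (\<Sigma> t / t - t) * \<beta> - C * t * B \<and> 0 < t \<and> t \<le> \<rho>"
    by eventually_elim simp
  then obtain t where t: "\<omega> * \<beta> - e / 2 < (\<Sigma> t / t - t) * \<beta> - C * t * B" "0 < t" "t \<le> \<rho>"
    using eventually_happens' trivial_limit_at_right_real by blast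
  interpret At: form_operator D "a t" "DA t" "A t" using operators t by simp
  define s where "s = \<Sigma> t - t\<^sup>2"
  have ess: "complex_of_real r \<notin> essential_spectrum (DA t) (A t)" if "r \<le> s" for r
  proof -
    have "0 < t\<^sup>2" using t by simp
    then have "r < \<Sigma> t" using that unfolding s_def by linarith
    then show ?thesis using below_threshold t by simp
  qed
  have ev1: "\<forall>\<^sub>F n in sequentially. s * (norm (w n))\<^sup>2 - t * e / 4 < Re (a t (w n) (w n))"
    by (rule At.weakly_null_form_lower[OF ess w(1,3)]) (use t e in auto)
  have "(\<lambda>n. s * (norm (w n))\<^sup>2 - Re (a 0 (w n) (w n))) \<longlonglongrightarrow> s * \<beta> - 0"
    by (intro tendsto_intros norm a0)
  then have ev2: "\<forall>\<^sub>F n in sequentially. s * \<beta> - t * e / 4 < s * (norm (w n))\<^sup>2 - Re (a 0 (w n) (w n))"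
    using t e by (intro order_tendstoD) auto
  from ev1 ev2 show ?thesis
  proof eventually_elim
    case (elim n)
    have "\<bar>Re (remainder t (w n) (w n))\<bar> \<le> C * t\<^sup>2 * B"
      using C(2)[of t "w n"] t w(1) mult_left_mono[OF w(2)[of n], of "C * t\<^sup>2"] C(1) by fastforce
    moreover have "Re (a t (w n) (w n)) = Re (a 0 (w n) (w n)) + t * Re (a1 (w n) (w n)) + Re (remainder t (w n) (w n))"
      using form_decompose(2)[of t "w n" "w n"] by simp
    ultimately have "s * \<beta> - t * e / 2 - C * t\<^sup>2 * B < t * Re (a1 (w n) (w n))"
      using elim by argo
    moreover have "s * \<beta> - t * e / 2 - C * t\<^sup>2 * B = t * ((\<Sigma> t / t - t) * \<beta> - C * t * B - e / 2)"
      using t by (simp add: s_def field_simps power2_eq_square)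
    ultimately have "(\<Sigma> t / t - t) * \<beta> - C * t * B - e / 2 < Re (a1 (w n) (w n))"
      using t by (simp only: mult_less_cancel_left_pos)
    then show ?case using t(1) by linarith
  qed
qed

text \<open>Absorption: the energy is \<open>l n + shift\<close> minus the increment, and once
  \<open>C * t n < 1 / 2\<close> the increment is at most half the energy.\<close>

lemma eigenvector_energy_bounded:
  assumes t: "\<And>n. 0 < t n" "\<And>n. t n \<le> \<rho>" "t \<longlonglongrightarrow> 0"
    and x: "\<And>n. x n \<in> eigenspace (DA (t n)) (A (t n)) (l n)" "\<And>n. norm (x n) = 1" and l: "l \<longlonglongrightarrow> 0"
  shows "\<exists>B>0. \<forall>n. energy0 (x n) \<le> B"
proof -
  obtain C where C: "C \<ge> 0" "\<And>t x. 0 \<le> t \<Longrightarrow> t \<le> \<rho> \<Longrightarrow> x \<in> D \<Longrightarrow> \<bar>Re (increment t x x)\<bar> \<le> C * t * energy0 x"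
    using first_order_bounds by metis
  have op: "form_operator D (a (t n)) (DA (t n)) (A (t n))" for n
    using t(1,2)[of n] by (intro operators) auto
  have xD: "x n \<in> D" for n using form_operator.eigenspace_subset[OF op x(1)] .
  have axx: "Re (a (t n) (x n) (x n)) = l n" for n
    using form_operator.eigenvector_form(1)[OF op x(1) xD] x(2)[of n] by (simp add: cinner_self)
  have "(\<lambda>n. C * t n) \<longlonglongrightarrow> C * 0" by (intro tendsto_intros t)
  then have "\<forall>\<^sub>F n in sequentially. C * t n < 1 / 2" by (rule order_tendstoD) simp
  moreover have "\<forall>\<^sub>F n in sequentially. l n < 1" by (rule order_tendstoD[OF l]) simp
  ultimately have "\<forall>\<^sub>F n in sequentially. norm (energy0 (x n)) \<le> norm (2 * (1 + A0.shift))"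
  proof eventually_elim
    case (elim n)
    have "\<bar>Re (increment (t n) (x n) (x n))\<bar> \<le> C * t n * energy0 (x n)"
      by (rule C(2)) (use t(1,2)[of n] xD in auto)
    also have "\<dots> \<le> 1 / 2 * energy0 (x n)"
      using elim A0.energy_nonneg[OF xD] by (intro mult_right_mono) auto
    finally have "- Re (increment (t n) (x n) (x n)) \<le> 1 / 2 * energy0 (x n)" by (rule abs_le_D2)
    then have "energy0 (x n) \<le> 2 * (1 + A0.shift)"
      using axx[of n] x(2)[of n] elim by (simp add: increment_def A0.energy_def)
    then show ?case using A0.energy_nonneg[OF xD] A0.shift_nonneg by simp
  qed
  then have "Bseq (\<lambda>n. energy0 (x n))"
    by (rule Bseq_eventually_mono) (rule Bfun_const)
  then obtain B where "B > 0" "\<And>n. norm (energy0 (x n)) \<le> B" by (auto elim: BseqE)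
  then show ?thesis by (intro exI[of _ B]) (auto simp: abs_le_iff)
qed

text \<open>Stated for any sequence of eigenvalues with convergent slope because it serves twice:
  for every index from 0 to \<open>k\<close> when the slope of the \<open>k\<close>-th eigenvalue is
  bounded below, and for the limit points of the given eigenvectors.\<close>

lemma eigenvectors_converge:
  assumes t: "\<And>n. 0 < t n" "\<And>n. t n \<le> \<rho>" "t \<longlonglongrightarrow> 0"
    and x: "\<And>n. x n \<in> eigenspace (DA (t n)) (A (t n)) (l n)" "\<And>n. norm (x n) = 1"
    and slope: "(\<lambda>n. l n / t n) \<longlonglongrightarrow> \<nu>" and \<nu>: "\<nu> < \<omega>"
  shows "\<exists>r z. strict_mono r \<and> (x \<circ> r) \<longlonglongrightarrow> z \<and> norm z = 1 \<and> first_order_eigenvector z \<nu>"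
proof -
  have "(\<lambda>n. l n / t n * t n) \<longlonglongrightarrow> \<nu> * 0" by (intro tendsto_mult slope t)
  moreover have "l n / t n * t n = l n" for n using t(1)[of n] by simp
  ultimately have l: "l \<longlonglongrightarrow> 0" by simp
  obtain B where B: "B > 0" "\<And>n. energy0 (x n) \<le> B" using eigenvector_energy_bounded[OF t x l] by blast
  obtain C where C: "C > 0"
    "\<And>t x y. 0 \<le> t \<Longrightarrow> t \<le> \<rho> \<Longrightarrow> x \<in> D \<Longrightarrow> y \<in> D \<Longrightarrow>
      cmod (increment t x y) \<le> C * t * (sqrt (energy0 x) * sqrt (energy0 y))"
    "\<And>t x y. 0 \<le> t \<Longrightarrow> t \<le> \<rho> \<Longrightarrow> x \<in> D \<Longrightarrow> y \<in> D \<Longrightarrow>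
      cmod (remainder t x y) \<le> C * t\<^sup>2 * (sqrt (energy0 x) * sqrt (energy0 y))"
    using polarized_bounds by metis
  obtain r p where r: "strict_mono r" and weak: "weakly_convergent_to (x \<circ> r) p"
    using bounded_weakly_convergent_subsequence[of x 1] x(2) by auto
  define X \<tau> L where "X = x \<circ> r" and "\<tau> = t \<circ> r" and "L = l \<circ> r"
  have \<tau>: "0 < \<tau> n" "\<tau> n \<le> \<rho>" for n using t by (auto simp: \<tau>_def)
  have \<tau>0: "\<tau> \<longlonglongrightarrow> 0" using t(3) r by (simp add: \<tau>_def LIMSEQ_subseq_LIMSEQ)
  have L0: "L \<longlonglongrightarrow> 0" using l r by (simp add: L_def LIMSEQ_subseq_LIMSEQ)
  have slopeL: "(\<lambda>n. L n / \<tau> n) \<longlonglongrightarrow> \<nu>"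
    using LIMSEQ_subseq_LIMSEQ[OF slope r] by (simp add: L_def \<tau>_def o_def)
  have X: "X n \<in> eigenspace (DA (\<tau> n)) (A (\<tau> n)) (L n)" "norm (X n) = 1" "energy0 (X n) \<le> B" for n
    using x B by (auto simp: X_def \<tau>_def L_def)
  have weak: "(\<lambda>n. cinner (X n) y) \<longlonglongrightarrow> cinner p y" for y
    using weak by (simp add: X_def weakly_convergent_to_def)
  have op: "form_operator D (a (\<tau> n)) (DA (\<tau> n)) (A (\<tau> n))" for n
    using \<tau>[of n] by (intro operators) auto
  have XD: "X n \<in> D" for n using form_operator.eigenspace_subset[OF op X(1)] .
  have aX: "a (\<tau> n) (X n) y = of_real (L n) * cinner (X n) y" if "y \<in> D" for n y
    using form_operator.eigenvector_form(1)[OF op X(1) that] .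
  have sqrtB: "sqrt (energy0 (X n)) \<le> sqrt B" for n using X(3) by simp
  have inc: "cmod (increment (\<tau> n) (X n) y) \<le> \<tau> n * (C * sqrt B * sqrt (energy0 y))" if y: "y \<in> D" for n y
  proof -
    have "cmod (increment (\<tau> n) (X n) y) \<le> C * \<tau> n * (sqrt (energy0 (X n)) * sqrt (energy0 y))"
      by (rule C(2)) (use \<tau>[of n] XD y in auto)
    also have "\<dots> \<le> C * \<tau> n * (sqrt B * sqrt (energy0 y))"
      using C(1) \<tau>(1)[of n] A0.energy_nonneg[OF y] sqrtB by (intro mult_left_mono mult_right_mono) auto
    finally show ?thesis by (simp add: ac_simps)
  qed
  have rem: "cmod (remainder (\<tau> n) (X n) y) \<le> \<tau> n * (\<tau> n * (C * sqrt B * sqrt (energy0 y)))" if y: "y \<in> D" for n y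
  proof -
    have "cmod (remainder (\<tau> n) (X n) y) \<le> C * (\<tau> n)\<^sup>2 * (sqrt (energy0 (X n)) * sqrt (energy0 y))"
      by (rule C(3)) (use \<tau>[of n] XD y in auto)
    also have "\<dots> \<le> C * (\<tau> n)\<^sup>2 * (sqrt B * sqrt (energy0 y))"
      using C(1) A0.energy_nonneg[OF y] sqrtB by (intro mult_left_mono mult_right_mono) auto
    finally show ?thesis by (simp add: ac_simps power2_eq_square)
  qed
  have inc0: "(\<lambda>n. increment (\<tau> n) (X n) y) \<longlonglongrightarrow> 0" if y: "y \<in> D" for y
  proof (rule Lim_null_comparison[OF always_eventually, OF allI])
    show "norm (increment (\<tau> n) (X n) y) \<le> \<tau> n * (C * sqrt B * sqrt (energy0 y))" for n by (rule inc[OF y])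
    show "(\<lambda>n. \<tau> n * (C * sqrt B * sqrt (energy0 y))) \<longlonglongrightarrow> 0" by (intro tendsto_mult_left_zero \<tau>0)
  qed
  \<comment> \<open>The equation is tested on fixed \<open>u\<close> in \<open>DA 0\<close>, since
    \<open>X n\<close> need not lie there; self-adjointness of \<open>A 0\<close> then gives both
    membership in the domain and \<open>A 0 p = 0\<close>.\<close>
  have pK: "p \<in> K"
  proof -
    have "cinner (A 0 u) p = cinner u 0" if u: "u \<in> DA 0" for u
    proof -
      have uD: "u \<in> D" using u A0.domain_subset by blast
      have "cinner (X n) (A 0 u) = of_real (L n) * cinner (X n) u - increment (\<tau> n) (X n) u" for n
        using aX[OF uD] A0.represents[OF u XD] A0.sym[OF XD uD] cinner_commute[of "X n" "A 0 u"]
        by (simp add: increment_def)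
      moreover have "(\<lambda>n. of_real (L n) * cinner (X n) u - increment (\<tau> n) (X n) u) \<longlonglongrightarrow> of_real 0 * cinner p u - 0"
        by (intro tendsto_intros L0 weak inc0 uD)
      ultimately have "cinner p (A 0 u) = 0"
        using weak[of "A 0 u"] LIMSEQ_unique by simp
      then show ?thesis using cinner_commute[of "A 0 u" p] by simp
    qed
    from A0.adjoint_imp[OF this] show ?thesis by (simp add: operator_kernel_def)
  qed
  have pD: "p \<in> D" using pK by (rule K_subset)
  define w where "w n = X n - p" for n
  have wD: "w n \<in> D" for n using XD pD A0.diff_mem by (simp add: w_def)
  have weak_w: "weakly_convergent_to w 0"
    using weak unfolding weakly_convergent_to_def w_def cinner_diff_left by (auto simp: LIM_zero_iff)
  have a0X: "Re (a 0 (X n) (X n)) = L n - Re (increment (\<tau> n) (X n) (X n))" for n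
    using aX[OF XD] X(2)[of n] by (simp add: increment_def cinner_self)
  \<comment> \<open>Subtracting a kernel vector does not change the value of
    \<open>a 0\<close>.\<close>
  have a0w: "Re (a 0 (w n) (w n)) = Re (a 0 (X n) (X n))" for n
    using XD pD K_left[OF pK] K_right[OF pK] by (simp add: w_def A0.quad_diff)
  have incXX: "cmod (increment (\<tau> n) (X n) (X n)) \<le> \<tau> n * (C * B)" for n
  proof -
    have "sqrt B * sqrt (energy0 (X n)) \<le> sqrt B * sqrt B" using sqrtB B(1) by (intro mult_left_mono) auto
    then have "\<tau> n * (C * (sqrt B * sqrt (energy0 (X n)))) \<le> \<tau> n * (C * B)"
      using \<tau>(1)[of n] C(1) B(1) by (intro mult_left_mono) auto
    then show ?thesis using inc[OF XD, of n n] by (simp add: ac_simps)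
  qed
  have "(\<lambda>n. increment (\<tau> n) (X n) (X n)) \<longlonglongrightarrow> 0"
    by (rule Lim_null_comparison[OF always_eventually, OF allI, OF incXX])
      (intro tendsto_mult_left_zero \<tau>0)
  then have "(\<lambda>n. L n - Re (increment (\<tau> n) (X n) (X n))) \<longlonglongrightarrow> 0 - Re 0"
    by (intro tendsto_diff tendsto_Re L0)
  then have a0w_lim: "(\<lambda>n. Re (a 0 (w n) (w n))) \<longlonglongrightarrow> 0" by (simp add: a0w a0X)
  have energy_w: "energy0 (w n) \<le> 2 * B + 2 * energy0 p" for n
    using A0.energy_nonneg[OF A0.add_mem[OF XD pD], of n] X(3)[of n]
      A0.energy.quad_add[OF XD pD, of n] A0.energy.quad_diff[OF XD pD, of n]
    by (simp add: w_def A0.Re_energy_form)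
  \<comment> \<open>\<open>\<beta>\<close> is the mass lost in the weak limit; strong convergence
    means \<open>\<beta> = 0\<close>.\<close>
  define \<beta> where "\<beta> = 1 - (norm p)\<^sup>2"
  have norm_w: "(\<lambda>n. (norm (w n))\<^sup>2) \<longlonglongrightarrow> \<beta>"
  proof -
    have "(\<lambda>n. 1 - 2 * Re (cinner (X n) p) + (norm p)\<^sup>2) \<longlonglongrightarrow> 1 - 2 * Re (cinner p p) + (norm p)\<^sup>2"
      by (intro tendsto_intros weak)
    then show ?thesis by (simp add: w_def norm_diff_squared X(2) \<beta>_def cinner_self)
  qed
  have a1_w: "(\<lambda>n. a1 (w n) y) \<longlonglongrightarrow> 0" if "y \<in> D" for y
    by (rule weakly_null_a1[OF wD energy_w weak_w that])
  \<comment> \<open>For \<open>y\<close> in the kernel the \<open>a 0\<close> term drops out, so the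
    equation can be divided by \<open>\<tau> n\<close>; the remainder is quadratic in
    \<open>\<tau> n\<close> and disappears.\<close>
  have eigen: "a1 p y = of_real \<nu> * cinner p y" if y: "y \<in> K" for y
  proof -
    have yD: "y \<in> D" using K_subset y by blast
    define R where "R n = remainder (\<tau> n) (X n) y / of_real (\<tau> n)" for n
    have "R \<longlonglongrightarrow> 0"
    proof (rule Lim_null_comparison[OF always_eventually, OF allI])
      show "norm (R n) \<le> \<tau> n * (C * sqrt B * sqrt (energy0 y))" for n
        using rem[OF yD, of n] \<tau>(1)[of n] by (simp add: R_def norm_divide divide_le_eq ac_simps)
      show "(\<lambda>n. \<tau> n * (C * sqrt B * sqrt (energy0 y))) \<longlonglongrightarrow> 0" by (intro tendsto_mult_left_zero \<tau>0)
    qed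
    then have "(\<lambda>n. of_real (L n / \<tau> n) * cinner (X n) y - R n - a1 (w n) y) \<longlonglongrightarrow> of_real \<nu> * cinner p y - 0 - 0"
      by (intro tendsto_diff tendsto_mult tendsto_of_real slopeL weak a1_w yD)
    moreover have "of_real (L n / \<tau> n) * cinner (X n) y - R n - a1 (w n) y = a1 p y" for n
    proof -
      have "of_real (L n) * cinner (X n) y = of_real (\<tau> n) * a1 (X n) y + remainder (\<tau> n) (X n) y"
        using aX[OF yD, of n] form_decompose(2)[of "\<tau> n" "X n" y] K_right[OF y XD] by simp
      then have "of_real (L n / \<tau> n) * cinner (X n) y = a1 (X n) y + R n"
        using \<tau>(1)[of n] by (simp add: R_def field_simps)
      then show ?thesis using XD pD yD by (simp add: w_def a1.diff_left)
    qed
    ultimately show ?thesis using LIMSEQ_unique[OF tendsto_const] by simp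
  qed
  have a1_p: "Re (a1 p p) = \<nu> * (norm p)\<^sup>2" using eigen[OF pK] by (simp add: cinner_self)
  text \<open>The negative eigenvectors contribute only at second order in \<open>t\<close>.\<close>
  define G where "G n = (\<Sum>e\<in>N. \<kappa> e * (cmod (cinner (X n) e))\<^sup>2 / \<tau> n)" for n
  have "G \<longlonglongrightarrow> (\<Sum>e\<in>N. 0)"
    unfolding G_def
  proof (rule tendsto_sum)
    fix e assume e: "e \<in> N"
    have eD: "e \<in> D" using A0.eigenspace_subset N_eigen(1)[OF e] by blast
    have pe: "cinner p e = 0"
      using A0.operator.eigenvectors_orthogonal[of p 0 e "\<kappa> e"] pK N_eigen[OF e] by (simp add: K_eq)
    have c0: "(\<lambda>n. cmod (cinner (X n) e)) \<longlonglongrightarrow> 0"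
      using tendsto_norm[OF weak[of e]] by (simp add: pe)
    \<comment> \<open>Tested with \<open>e\<close>, the eigenvalue equation gives
      \<open>\<kappa> e * c = L n * c - increment\<close> for the overlap \<open>c\<close>. Hence
      one factor \<open>c\<close> compensates the division by \<open>\<tau> n\<close>, and the other
      tends to 0.\<close>
    have est: "norm (\<kappa> e * (cmod (cinner (X n) e))\<^sup>2 / \<tau> n)
        \<le> (\<bar>L n / \<tau> n\<bar> * cmod (cinner (X n) e) + C * sqrt B * sqrt (energy0 e)) * cmod (cinner (X n) e)" for n
    proof -
      have "of_real (\<kappa> e) * cinner (X n) e = of_real (L n) * cinner (X n) e - increment (\<tau> n) (X n) e"
        using aX[OF eD, of n] A0.eigenvector_form(2)[OF N_eigen(1)[OF e] XD] by (simp add: increment_def)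
      then have "\<bar>\<kappa> e\<bar> * cmod (cinner (X n) e) \<le> \<bar>L n\<bar> * cmod (cinner (X n) e) + cmod (increment (\<tau> n) (X n) e)"
        using norm_triangle_ineq4[of "of_real (L n) * cinner (X n) e" "increment (\<tau> n) (X n) e"]
        by (metis norm_mult norm_of_real)
      also have "\<dots> \<le> \<bar>L n\<bar> * cmod (cinner (X n) e) + \<tau> n * (C * sqrt B * sqrt (energy0 e))"
        using inc[OF eD] by simp
      also have "\<dots> = \<tau> n * (\<bar>L n / \<tau> n\<bar> * cmod (cinner (X n) e) + C * sqrt B * sqrt (energy0 e))"
        using \<tau>(1)[of n] by (simp add: field_simps)
      finally have "\<bar>\<kappa> e\<bar> * cmod (cinner (X n) e) * cmod (cinner (X n) e)
          \<le> \<tau> n * (\<bar>L n / \<tau> n\<bar> * cmod (cinner (X n) e) + C * sqrt B * sqrt (energy0 e)) * cmod (cinner (X n) e)"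
        by (rule mult_right_mono) simp
      then show ?thesis
        using \<tau>(1)[of n] by (simp add: abs_mult power2_eq_square divide_le_eq ac_simps)
    qed
    show "(\<lambda>n. \<kappa> e * (cmod (cinner (X n) e))\<^sup>2 / \<tau> n) \<longlonglongrightarrow> 0"
    proof (rule Lim_null_comparison[OF always_eventually, OF allI, OF est])
      have "(\<lambda>n. (\<bar>L n / \<tau> n\<bar> * cmod (cinner (X n) e) + C * sqrt B * sqrt (energy0 e)) * cmod (cinner (X n) e))
          \<longlonglongrightarrow> (\<bar>\<nu>\<bar> * 0 + C * sqrt B * sqrt (energy0 e)) * 0"
        by (intro tendsto_add tendsto_mult tendsto_rabs tendsto_const slopeL c0)
      then show "(\<lambda>n. (\<bar>L n / \<tau> n\<bar> * cmod (cinner (X n) e) + C * sqrt B * sqrt (energy0 e)) * cmod (cinner (X n) e)) \<longlonglongrightarrow> 0"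
        by simp
    qed
  qed
  then have G0: "G \<longlonglongrightarrow> 0" by simp
  \<comment> \<open>The energy balance divided by \<open>\<tau> n\<close>: \<open>a 0\<close> is
    bounded below by its part along \<open>N\<close>, and \<open>a1\<close> is expanded at
    \<open>X n = w n + p\<close>.\<close>
  have lower: "G n + Re (a1 p p) + 2 * Re (a1 (w n) p) + Re (a1 (w n) (w n)) - \<tau> n * (C * B) \<le> L n / \<tau> n" for n
  proof -
    have "(\<Sum>e\<in>N. \<kappa> e * (cmod (cinner (X n) e))\<^sup>2) \<le> Re (a 0 (X n) (X n))"
      using A0.form_oproj[OF N N_eigen(1) XD, of n] N_compl diff_oproj_mem[OF N, of "X n"] by simp
    moreover have "(\<Sum>e\<in>N. \<kappa> e * (cmod (cinner (X n) e))\<^sup>2) = \<tau> n * G n"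
      using \<tau>(1)[of n] by (simp add: G_def sum_distrib_left)
    moreover have "L n = Re (a 0 (X n) (X n)) + \<tau> n * Re (a1 (X n) (X n)) + Re (remainder (\<tau> n) (X n) (X n))"
      using arg_cong[OF aX[OF XD, of n n], of Re] arg_cong[OF form_decompose(2)[of "\<tau> n" "X n" "X n"], of Re]
      by (simp add: cinner_self X(2))
    moreover have "\<bar>Re (remainder (\<tau> n) (X n) (X n))\<bar> \<le> \<tau> n * (\<tau> n * (C * B))"
    proof -
      have "sqrt B * sqrt (energy0 (X n)) \<le> sqrt B * sqrt B" using sqrtB B(1) by (intro mult_left_mono) auto
      then have "\<tau> n * (\<tau> n * (C * (sqrt B * sqrt (energy0 (X n))))) \<le> \<tau> n * (\<tau> n * (C * B))"
        using \<tau>(1)[of n] C(1) B(1) by (intro mult_left_mono) auto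
      then show ?thesis
        using rem[OF XD, of n n] abs_Re_le_cmod[of "remainder (\<tau> n) (X n) (X n)"] by (simp add: ac_simps)
    qed
    moreover have "Re (a1 (X n) (X n)) = Re (a1 (w n) (w n)) + 2 * Re (a1 (w n) p) + Re (a1 p p)"
      using a1.quad_add[OF wD pD, of n] by (simp add: w_def)
    ultimately have "\<tau> n * (G n + Re (a1 p p) + 2 * Re (a1 (w n) p) + Re (a1 (w n) (w n)) - \<tau> n * (C * B)) \<le> L n"
      by (simp add: algebra_simps)
    then show ?thesis using \<tau>(1)[of n] by (simp add: le_divide_eq mult.commute)
  qed
  \<comment> \<open>To first order the lost mass costs at least \<open>\<omega>\<close> per unit,
    while the whole unit vector costs only \<open>\<nu> < \<omega>\<close>.\<close>
  have almost: "\<nu> * (norm p)\<^sup>2 + \<omega> * \<beta> - e \<le> \<nu>" if e: "e > 0" for e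
  proof (rule tendsto_le[OF trivial_limit_sequentially slopeL])
    show "(\<lambda>n. G n + Re (a1 p p) + 2 * Re (a1 (w n) p) + (\<omega> * \<beta> - e) - \<tau> n * (C * B)) \<longlonglongrightarrow> \<nu> * (norm p)\<^sup>2 + \<omega> * \<beta> - e"
    proof -
      have "(\<lambda>n. G n + Re (a1 p p) + 2 * Re (a1 (w n) p) + (\<omega> * \<beta> - e) - \<tau> n * (C * B)) \<longlonglongrightarrow>
          0 + Re (a1 p p) + 2 * Re 0 + (\<omega> * \<beta> - e) - 0 * (C * B)"
        by (intro tendsto_add tendsto_diff tendsto_mult tendsto_const tendsto_Re G0 a1_w pD \<tau>0)
      then show ?thesis by (simp add: a1_p add_diff_eq)
    qed
    show "\<forall>\<^sub>F n in sequentially. G n + Re (a1 p p) + 2 * Re (a1 (w n) p) + (\<omega> * \<beta> - e) - \<tau> n * (C * B) \<le> L n / \<tau> n"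
      using weakly_null_a1_lower[OF wD energy_w weak_w a0w_lim norm_w e]
      by eventually_elim (use lower in \<open>smt (verit)\<close>)
  qed
  have "\<nu> * (norm p)\<^sup>2 + \<omega> * \<beta> \<le> \<nu>"
  proof (rule field_le_epsilon)
    fix e :: real assume "0 < e"
    from almost[OF this] show "\<nu> * (norm p)\<^sup>2 + \<omega> * \<beta> \<le> \<nu> + e" by linarith
  qed
  then have "(\<omega> - \<nu>) * \<beta> \<le> 0" by (simp add: \<beta>_def algebra_simps)
  then have "\<beta> \<le> 0" using \<nu> by (simp add: mult_le_0_iff)
  moreover have "\<beta> \<ge> 0"
    by (rule tendsto_lowerbound[OF norm_w]) auto
  ultimately have \<beta>: "\<beta> = 0" by simp
  have "X \<longlonglongrightarrow> p" using norm_w unfolding \<beta> w_def by (rule tendsto_if_norm_squared)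
  moreover have "norm p = 1"
  proof (rule power2_eq_imp_eq)
    show "(norm p)\<^sup>2 = 1\<^sup>2" using \<beta> by (simp add: \<beta>_def)
  qed auto
  moreover have "first_order_eigenvector p \<nu>" using pK eigen by (simp add: first_order_eigenvector_def)
  ultimately show ?thesis using r by (intro exI[of _ r] exI[of _ p]) (simp add: X_def)
qed

end

section \<open>Asymptotics of the eigenvalues\<close>

text \<open>\<open>n\<close> and \<open>v\<close> stand for the norms of the components along
  \<open>N\<close> and in the kernel. Half of \<open>c * n^2\<close> absorbs the mixed term by
  completing a square, at the price \<open>2 * G^2 / c * t^2 * v^2\<close>; the other half absorbs
  \<open>t * (G - \<mu>) * n^2\<close> for small \<open>t\<close>. The \<open>+ 1\<close> makes the
  inequality strict.\<close>

lemma two_block_estimate: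
  fixes c G \<mu> t n v :: real
  assumes c: "c > 0" and G: "G \<ge> 0" and t: "0 < t" "t \<le> c / (2 * (G + \<bar>\<mu>\<bar> + 1))"
    and nv: "n\<^sup>2 + v\<^sup>2 > 0"
  shows "- c * n\<^sup>2 + t * (G * n\<^sup>2 + 2 * G * n * v + \<mu> * v\<^sup>2) + G * t\<^sup>2 * (n\<^sup>2 + v\<^sup>2)
    < (t * \<mu> + (2 * G\<^sup>2 / c + G + 1) * t\<^sup>2) * (n\<^sup>2 + v\<^sup>2)"
proof -
  have "0 \<le> (c * n - 2 * t * G * v)\<^sup>2 / (2 * c)" using c by simp
  also have "\<dots> = c / 2 * n\<^sup>2 - 2 * t * G * n * v + 2 * G\<^sup>2 / c * t\<^sup>2 * v\<^sup>2"
    using c by (simp add: power2_diff power_mult_distrib field_simps) (simp add: power2_eq_square)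
  finally have 1: "2 * t * G * n * v \<le> c / 2 * n\<^sup>2 + 2 * G\<^sup>2 / c * t\<^sup>2 * v\<^sup>2" by simp
  have "t * (G - \<mu>) \<le> t * (G + \<bar>\<mu>\<bar> + 1)" using t(1) by (intro mult_left_mono) auto
  also have "\<dots> \<le> c / 2"
  proof -
    have pos: "2 * (G + \<bar>\<mu>\<bar> + 1) > 0" using G by (simp add: add_nonneg_pos)
    have "t * (2 * (G + \<bar>\<mu>\<bar> + 1)) \<le> c" using t(2) unfolding pos_le_divide_eq[OF pos] .
    then show ?thesis by (simp add: algebra_simps)
  qed
  finally have "t * (G - \<mu>) * n\<^sup>2 \<le> c / 2 * n\<^sup>2" by (rule mult_right_mono) simp
  then have 2: "t * G * n\<^sup>2 - t * \<mu> * n\<^sup>2 \<le> c / 2 * n\<^sup>2" by (simp add: algebra_simps)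
  have 3: "0 \<le> 2 * G\<^sup>2 / c * t\<^sup>2 * n\<^sup>2" using c by simp
  have 4: "0 < t\<^sup>2 * (n\<^sup>2 + v\<^sup>2)" using nv t(1) by simp
  have "(t * \<mu> + (2 * G\<^sup>2 / c + G + 1) * t\<^sup>2) * (n\<^sup>2 + v\<^sup>2) =
    t * \<mu> * n\<^sup>2 + t * \<mu> * v\<^sup>2 + 2 * G\<^sup>2 / c * t\<^sup>2 * n\<^sup>2 + 2 * G\<^sup>2 / c * t\<^sup>2 * v\<^sup>2
      + G * t\<^sup>2 * (n\<^sup>2 + v\<^sup>2) + t\<^sup>2 * (n\<^sup>2 + v\<^sup>2)"
    by (simp add: distrib_left distrib_right)
  moreover have "- c * n\<^sup>2 + t * (G * n\<^sup>2 + 2 * G * n * v + \<mu> * v\<^sup>2) =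
    - c * n\<^sup>2 + t * G * n\<^sup>2 + 2 * t * G * n * v + t * \<mu> * v\<^sup>2"
    by (simp add: distrib_left mult.assoc mult.left_commute)
  ultimately show ?thesis using 1 2 3 4 by linarith
qed

section \<open>Two-sided bounds and the slope of the eigenvalues\<close>

context perturbed_threshold
begin

text \<open>The increment is at least \<open>- C * t\<close> times the energy. For
  \<open>C * t\<close> at most 1 the nonnegative \<open>a 0\<close> covers its own share of that
  energy, and only the share of the shift is left.\<close>

lemma form_lower_bound:
  obtains C \<delta> where "C \<ge> 0" "0 < \<delta>" "\<delta> \<le> \<rho>"
    "\<And>t x. 0 \<le> t \<Longrightarrow> t < \<delta> \<Longrightarrow> x \<in> D \<Longrightarrow> x \<in> orth_compl N \<Longrightarrow> - C * t * (norm x)\<^sup>2 \<le> Re (a t x x)"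
proof -
  obtain C where C: "C \<ge> 0" "\<And>t x. 0 \<le> t \<Longrightarrow> t \<le> \<rho> \<Longrightarrow> x \<in> D \<Longrightarrow> \<bar>Re (increment t x x)\<bar> \<le> C * t * energy0 x"
    using first_order_bounds by metis
  define \<delta> where "\<delta> = min \<rho> (1 / (C + 1))"
  show ?thesis
  proof (rule that[of "C * A0.shift" \<delta>])
    show "0 < \<delta>" "\<delta> \<le> \<rho>" using rho_pos C(1) by (auto simp: \<delta>_def)
    fix t x assume t: "0 \<le> t" "t < \<delta>" and x: "x \<in> D" "x \<in> orth_compl N"
    have t1: "t \<le> \<rho>" "t \<le> 1 / (C + 1)" using t by (auto simp: \<delta>_def)
    have "C * t \<le> C * (1 / (C + 1))" using t1(2) C(1) by (rule mult_left_mono)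
    also have "\<dots> \<le> 1" using C(1) by (simp add: divide_le_eq)
    finally have "C * t * Re (a 0 x x) \<le> 1 * Re (a 0 x x)" using N_compl[OF x] by (rule mult_right_mono)
    moreover have "- Re (increment t x x) \<le> C * t * energy0 x"
      by (rule abs_le_D2) (rule C(2)[OF t(1) t1(1) x(1)])
    moreover have "C * t * energy0 x = C * t * Re (a 0 x x) + C * A0.shift * t * (norm x)\<^sup>2"
      by (simp add: A0.energy_def algebra_simps)
    ultimately show "- (C * A0.shift) * t * (norm x)\<^sup>2 \<le> Re (a t x x)"
      by (simp add: increment_def)
  qed (use C(1) A0.shift_nonneg in simp)
qed

lemma first_order_eigenvector_mem: "first_order_eigenvector z \<nu> \<Longrightarrow> z \<in> K"
  by (simp add: first_order_eigenvector_def)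

lemma N_K_orthogonal:
  assumes "e \<in> N" "v \<in> K"
  shows "cinner e v = 0" "cinner v e = 0"
  using A0.operator.eigenvectors_orthogonal[of e "\<kappa> e" v 0] A0.operator.eigenvectors_orthogonal[of v 0 e "\<kappa> e"]
    N_eigen[OF assms(1)] assms(2) by (auto simp: K_eq)

text \<open>On the span of the negative eigenvectors of \<open>A 0\<close> and of eigenvectors of the first-order form
  with eigenvalues at most \<open>\<mu>\<close>, the form \<open>a t\<close> is at most \<open>t * \<mu> + O(t\<^sup>2)\<close>: the negative part
  of \<open>a 0\<close> absorbs the mixed terms.\<close>

lemma form_upper_bound:
  assumes V: "orthonormal V" "finite V" "\<And>v. v \<in> V \<Longrightarrow> first_order_eigenvector v (\<eta> v)" "\<And>v. v \<in> V \<Longrightarrow> \<eta> v \<le> \<mu>"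
  obtains C \<delta> where "0 < \<delta>" "\<delta> \<le> \<rho>"
    "\<And>t x. 0 < t \<Longrightarrow> t < \<delta> \<Longrightarrow> x \<in> cvec.span (N \<union> V) \<Longrightarrow> x \<noteq> 0 \<Longrightarrow>
      Re (a t x x) < (t * \<mu> + C * t\<^sup>2) * (norm x)\<^sup>2"
    and "orthonormal (N \<union> V)" "N \<inter> V = {}" "N \<union> V \<subseteq> D"
proof -
  have VK: "v \<in> K" if "v \<in> V" for v using V(3)[OF that] by (rule first_order_eigenvector_mem)
  have subK: "cvec.subspace K" unfolding K_eq by (rule A0.operator.subspace_eigenspaces)
  have disj: "N \<inter> V = {}"
  proof (rule ccontr)
    assume "N \<inter> V \<noteq> {}"
    then obtain e where e: "e \<in> N" "e \<in> V" by blast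
    then have "cinner e e = 0" using N_K_orthogonal VK by blast
    moreover have "norm e = 1" using orthonormal_norm[OF N(1) e(1)] .
    ultimately show False by (simp add: cinner_self)
  qed
  have on: "orthonormal (N \<union> V)"
    unfolding orthonormal_def
  proof (intro ballI)
    fix x y assume "x \<in> N \<union> V" "y \<in> N \<union> V"
    then show "cinner x y = (if x = y then 1 else 0)"
      using N(1) V(1) N_K_orthogonal VK disj unfolding orthonormal_def by (elim UnE) auto
  qed
  have sub: "N \<union> V \<subseteq> D" using N_eigen(1) A0.eigenspace_subset VK K_subset by blast
  obtain C where C: "C > 0"
    "\<And>x y. x \<in> D \<Longrightarrow> y \<in> D \<Longrightarrow> cmod (a1 x y) \<le> C * (sqrt (energy0 x) * sqrt (energy0 y))"
    "\<And>t x y. 0 \<le> t \<Longrightarrow> t \<le> \<rho> \<Longrightarrow> x \<in> D \<Longrightarrow> y \<in> D \<Longrightarrow>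
      cmod (remainder t x y) \<le> C * t\<^sup>2 * (sqrt (energy0 x) * sqrt (energy0 y))"
    using polarized_bounds by metis
  \<comment> \<open>Where \<open>a 0\<close> is nonpositive the energy is at most
    \<open>A0.shift\<close> times the squared norm, so bounds in energy become bounds in norm with
    constant \<open>G\<close>.\<close>
  define G where "G = C * A0.shift"
  have G: "G \<ge> 0" using C(1) A0.shift_nonneg by (simp add: G_def)
  \<comment> \<open>The gap between 0 and the negative eigenvalues; the inserted 1 keeps the minimum
    defined when \<open>N\<close> is empty.\<close>
  obtain c where c: "c > 0" "\<And>e. e \<in> N \<Longrightarrow> \<kappa> e \<le> - c"
  proof
    let ?M = "insert 1 ((\<lambda>e. - \<kappa> e) ` N)"
    show "Min ?M > 0" using N(2) N_eigen(2) by (auto simp: Min_gr_iff)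
    fix e assume "e \<in> N"
    then have "Min ?M \<le> - \<kappa> e" using N(2) by (intro Min_le) auto
    then show "\<kappa> e \<le> - Min ?M" by simp
  qed
  define \<delta> where "\<delta> = min \<rho> (c / (2 * (G + \<bar>\<mu>\<bar> + 1)))"
  show ?thesis
  proof (rule that[OF _ _ _ on disj sub])
    show "0 < \<delta>" "\<delta> \<le> \<rho>" using rho_pos c(1) G by (auto simp: \<delta>_def)
    fix t x assume t: "0 < t" "t < \<delta>" and x: "x \<in> cvec.span (N \<union> V)" "x \<noteq> 0"
    have t': "t \<le> \<rho>" "t \<le> c / (2 * (G + \<bar>\<mu>\<bar> + 1))" using t by (auto simp: \<delta>_def)
    define n v where "n = oproj N x" and "v = x - oproj N x"
    have x_eq: "x = n + v" by (simp add: n_def v_def)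
    have "x = oproj (N \<union> V) x" using oproj_span[OF on _ x(1)] N(2) V(2) by simp
    also have "\<dots> = oproj N x + oproj V x"
      unfolding oproj_def using N(2) V(2) disj by (intro sum.union_disjoint)
    finally have vV: "v = oproj V x" by (simp add: v_def algebra_simps)
    have v_span: "v \<in> cvec.span V" unfolding vV by (rule oproj_in_span)
    have vK: "v \<in> K" using v_span cvec.span_minimal[OF _ subK, of V] VK by blast
    have vD: "v \<in> D" using vK K_subset by blast
    have xD: "x \<in> D" using x(1) sub A0.subspace cvec.span_minimal by blast
    have nD: "n \<in> D" using A0.form_oproj(1)[OF N N_eigen(1) xD] by (simp add: n_def)
    have norm_x: "(norm x)\<^sup>2 = (norm n)\<^sup>2 + (norm v)\<^sup>2"
      unfolding n_def v_def by (rule norm_squared_oproj(2)[OF N])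
    have a0v: "Re (a 0 v v) = 0" using K_left[OF vK vD] by simp
    have sum_le: "(\<Sum>e\<in>N. \<kappa> e * (cmod (cinner y e))\<^sup>2) \<le> - c * (norm (oproj N y))\<^sup>2" for y
    proof -
      have "(\<Sum>e\<in>N. \<kappa> e * (cmod (cinner y e))\<^sup>2) \<le> (\<Sum>e\<in>N. - c * (cmod (cinner y e))\<^sup>2)"
        by (intro sum_mono mult_right_mono c) auto
      then show ?thesis unfolding norm_squared_oproj(1)[OF N] by (simp add: sum_distrib_left)
    qed
    have a0x: "Re (a 0 x x) \<le> - c * (norm n)\<^sup>2"
      using A0.form_oproj(3)[OF N N_eigen(1) xD] sum_le[of x] a0v by (simp add: n_def v_def)
    have "oproj N n = n" unfolding n_def by (rule oproj_span[OF N oproj_in_span])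
    then have a0n: "Re (a 0 n n) \<le> 0"
      using A0.form_oproj(3)[OF N N_eigen(1) nD] sum_le[of n] A0.zero_left[OF A0.zero_mem] c(1)
      by simp (smt (verit) mult_nonneg_nonneg zero_le_power2)
    have sqrt_energy: "sqrt (energy0 y) \<le> sqrt A0.shift * norm y" if "Re (a 0 y y) \<le> 0" for y
    proof -
      have "sqrt (energy0 y) \<le> sqrt (A0.shift * (norm y)\<^sup>2)" using that by (simp add: A0.energy_def)
      then show ?thesis by (simp add: real_sqrt_mult)
    qed
    have prod: "sqrt (energy0 y) * sqrt (energy0 z) \<le> A0.shift * (norm y * norm z)"
      if "Re (a 0 y y) \<le> 0" "Re (a 0 z z) \<le> 0" "z \<in> D" for y z
    proof -
      have "sqrt (energy0 y) * sqrt (energy0 z) \<le> (sqrt A0.shift * norm y) * (sqrt A0.shift * norm z)"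
        using that A0.energy_nonneg A0.shift_nonneg by (intro mult_mono sqrt_energy) auto
      also have "\<dots> = (sqrt A0.shift * sqrt A0.shift) * (norm y * norm z)" by (simp only: ac_simps)
      finally show ?thesis using A0.shift_nonneg by simp
    qed
    have a1_le: "Re (a1 y z) \<le> G * (norm y * norm z)"
      if "Re (a 0 y y) \<le> 0" "Re (a 0 z z) \<le> 0" "y \<in> D" "z \<in> D" for y z
    proof -
      have "Re (a1 y z) \<le> C * (sqrt (energy0 y) * sqrt (energy0 z))"
        using C(2)[OF that(3,4)] complex_Re_le_cmod order_trans by blast
      also have "\<dots> \<le> C * (A0.shift * (norm y * norm z))"
        using C(1) that by (intro mult_left_mono prod) auto
      finally show ?thesis by (simp add: G_def mult.assoc)
    qed
    have a1v: "Re (a1 v v) \<le> \<mu> * (norm v)\<^sup>2"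
    proof -
      have v_eq: "oproj V v = v" by (rule oproj_span[OF V(1,2) v_span])
      have "a1 v v = a1 (oproj V v) v" by (simp add: v_eq)
      also have "\<dots> = (\<Sum>e\<in>V. a1 (cinner v e *\<^sub>C e) v)"
        unfolding oproj_def using vD VK K_subset a1.scale_mem by (intro a1.sum_left) auto
      also have "\<dots> = (\<Sum>e\<in>V. of_real (\<eta> e * (cmod (cinner v e))\<^sup>2))"
      proof (intro sum.cong refl)
        fix e assume e: "e \<in> V"
        have "a1 (cinner v e *\<^sub>C e) v = cinner v e * (of_real (\<eta> e) * cinner e v)"
          using V(3)[OF e] vK vD VK[OF e] K_subset by (simp add: a1.scale_left first_order_eigenvector_def)
        also have "\<dots> = of_real (\<eta> e) * (cinner v e * cnj (cinner v e))"
          using cinner_commute[of e v] by simp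
        finally show "a1 (cinner v e *\<^sub>C e) v = of_real (\<eta> e * (cmod (cinner v e))\<^sup>2)"
          by (simp add: complex_norm_square del: of_real_power)
      qed
      finally have "Re (a1 v v) = (\<Sum>e\<in>V. \<eta> e * (cmod (cinner v e))\<^sup>2)" by (simp del: of_real_mult)
      also have "\<dots> \<le> (\<Sum>e\<in>V. \<mu> * (cmod (cinner v e))\<^sup>2)" by (intro sum_mono mult_right_mono V) auto
      also have "\<dots> = \<mu> * (norm (oproj V v))\<^sup>2"
        by (simp add: norm_squared_oproj(1)[OF V(1,2)] sum_distrib_left)
      finally show ?thesis by (simp add: v_eq)
    qed
    have a0x0: "Re (a 0 x x) \<le> 0" using a0x c(1) by (smt (verit) mult_nonneg_nonneg zero_le_power2 mult_minus_left)
    have "Re (remainder t x x) \<le> G * t\<^sup>2 * (norm x)\<^sup>2"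
    proof -
      have "Re (remainder t x x) \<le> C * t\<^sup>2 * (sqrt (energy0 x) * sqrt (energy0 x))"
        using C(3)[OF less_imp_le[OF t(1)] t'(1) xD xD] complex_Re_le_cmod order_trans by blast
      also have "\<dots> \<le> C * t\<^sup>2 * (A0.shift * (norm x * norm x))"
        using C(1) a0x0 xD by (intro mult_left_mono prod) auto
      finally show ?thesis by (simp add: G_def power2_eq_square ac_simps)
    qed
    moreover have "Re (a1 x x) \<le> G * (norm n)\<^sup>2 + 2 * G * norm n * norm v + \<mu> * (norm v)\<^sup>2"
    proof -
      have "Re (a1 x x) = Re (a1 n n) + 2 * Re (a1 n v) + Re (a1 v v)"
        unfolding x_eq by (rule a1.quad_add[OF nD vD])
      then show ?thesis
        using a1_le[OF a0n a0n nD nD] a1_le[OF a0n _ nD vD] a0v a1v by (simp add: power2_eq_square)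
    qed
    then have "t * Re (a1 x x) \<le> t * (G * (norm n)\<^sup>2 + 2 * G * norm n * norm v + \<mu> * (norm v)\<^sup>2)"
      using t(1) by (intro mult_left_mono) auto
    moreover have "Re (a t x x) = Re (a 0 x x) + t * Re (a1 x x) + Re (remainder t x x)"
      using arg_cong[OF form_decompose(2)[of t x x], of Re] by simp
    ultimately have "Re (a t x x) \<le> - c * (norm n)\<^sup>2
        + t * (G * (norm n)\<^sup>2 + 2 * G * norm n * norm v + \<mu> * (norm v)\<^sup>2)
        + G * t\<^sup>2 * ((norm n)\<^sup>2 + (norm v)\<^sup>2)"
      using a0x unfolding norm_x by linarith
    also have "\<dots> < (t * \<mu> + (2 * G\<^sup>2 / c + G + 1) * t\<^sup>2) * ((norm n)\<^sup>2 + (norm v)\<^sup>2)"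
    proof (rule two_block_estimate[OF c(1) G t(1) t'(2)])
      show "0 < (norm n)\<^sup>2 + (norm v)\<^sup>2" unfolding norm_x[symmetric] using x(2) by simp
    qed
    finally show "Re (a t x x) < (t * \<mu> + (2 * G\<^sup>2 / c + G + 1) * t\<^sup>2) * (norm x)\<^sup>2"
      unfolding norm_x .
  qed
qed

text \<open>The trial set \<open>N \<union> V\<close> has \<open>m + k + 1\<close> elements, one per
  listed index, and its bound \<open>t * \<mu> + C1 * t^2\<close> stays below
  \<open>\<Sigma> t\<close> for small \<open>t\<close> because \<open>\<mu> < \<omega>\<close>;
  min-max then gives existence of the list as well as the upper bound. Index 0 has exactly
  \<open>m = card N\<close> predecessors, which suits the lower bound on the complement of
  \<open>N\<close>.\<close>

lemma smallest_eigenvalues_bounds: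
  fixes \<Lambda> :: "int \<Rightarrow> real \<Rightarrow> real"
  assumes V: "orthonormal V" "finite V" "card V = Suc k"
      "\<And>v. v \<in> V \<Longrightarrow> first_order_eigenvector v (\<eta> v)" "\<And>v. v \<in> V \<Longrightarrow> \<eta> v \<le> \<mu>"
    and card_N: "card N = m" and \<mu>: "\<mu> < \<omega>"
    and \<Lambda>: "\<And>t. 0 < t \<Longrightarrow> t \<le> \<rho> \<Longrightarrow> \<exists>\<nu>. smallest_eigenvalues (DA t) (A t) (- int m) (int k) \<nu> \<Longrightarrow>
        smallest_eigenvalues (DA t) (A t) (- int m) (int k) (\<lambda>i. \<Lambda> i t)"
  shows "\<exists>b C. 0 < b \<and> b \<le> \<rho> \<and> (\<forall>t. 0 < t \<longrightarrow> t < b \<longrightarrow>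
    smallest_eigenvalues (DA t) (A t) (- int m) (int k) (\<lambda>i. \<Lambda> i t) \<and>
    \<Lambda> (int k) t / t < \<mu> + C * t \<and> - C \<le> \<Lambda> 0 t / t)"
proof -
  obtain C1 \<delta>1 where up: "0 < \<delta>1" "\<delta>1 \<le> \<rho>"
    "\<And>t x. 0 < t \<Longrightarrow> t < \<delta>1 \<Longrightarrow> x \<in> cvec.span (N \<union> V) \<Longrightarrow> x \<noteq> 0 \<Longrightarrow>
      Re (a t x x) < (t * \<mu> + C1 * t\<^sup>2) * (norm x)\<^sup>2"
    and NV: "orthonormal (N \<union> V)" "N \<inter> V = {}" "N \<union> V \<subseteq> D"
    using form_upper_bound[OF V(1,2,4,5)] by metis
  obtain C2 \<delta>2 where low: "C2 \<ge> 0" "0 < \<delta>2" "\<delta>2 \<le> \<rho>"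
    "\<And>t x. 0 \<le> t \<Longrightarrow> t < \<delta>2 \<Longrightarrow> x \<in> D \<Longrightarrow> x \<in> orth_compl N \<Longrightarrow> - C2 * t * (norm x)\<^sup>2 \<le> Re (a t x x)"
    using form_lower_bound by metis
  have "((\<lambda>t. \<mu> + C1 * t) \<longlongrightarrow> \<mu> + C1 * 0) (at_right 0)" by (intro tendsto_intros)
  then have "((\<lambda>t. \<Sigma> t / t - (\<mu> + C1 * t)) \<longlongrightarrow> \<omega> - (\<mu> + C1 * 0)) (at_right 0)"
    by (rule tendsto_diff[OF threshold_slope])
  then have "\<forall>\<^sub>F t in at_right 0. 0 < \<Sigma> t / t - (\<mu> + C1 * t)"
    using \<mu> by (intro order_tendstoD) auto
  then obtain \<delta>3 where \<delta>3: "\<delta>3 > 0" "\<And>t. 0 < t \<Longrightarrow> t < \<delta>3 \<Longrightarrow> \<mu> + C1 * t < \<Sigma> t / t"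
    by (auto simp: eventually_at_right_field)
  define b where "b = min \<delta>1 (min \<delta>2 \<delta>3)"
  define C where "C = max C1 C2"
  have card_NV: "card (N \<union> V) = nat (int k - - int m + 1)"
    using card_Un_disjoint[OF N(2) V(2) NV(2)] V(3) card_N by simp
  have main: "smallest_eigenvalues (DA t) (A t) (- int m) (int k) (\<lambda>i. \<Lambda> i t) \<and>
      \<Lambda> (int k) t / t < \<mu> + C * t \<and> - C \<le> \<Lambda> 0 t / t" if t: "0 < t" "t < b" for t
  proof -
    have tb: "t < \<delta>1" "t < \<delta>2" "t < \<delta>3" "t \<le> \<rho>" using t up(2) by (auto simp: b_def)
    interpret At: form_operator D "a t" "DA t" "A t" using operators t tb by simp
    define s where "s = t * \<mu> + C1 * t\<^sup>2"
    have "t * (\<mu> + C1 * t) < \<Sigma> t" using \<delta>3(2)[OF t(1) tb(3)] t(1) by (simp add: less_divide_eq mult.commute)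
    then have "s < \<Sigma> t" by (simp add: s_def power2_eq_square algebra_simps)
    then have ess: "complex_of_real r \<notin> essential_spectrum (DA t) (A t)" if "r \<le> s" for r
      using below_threshold[of t r] t tb that by simp
    have small: "Re (a t x x) < s * (norm x)\<^sup>2" if "x \<in> cvec.span (N \<union> V)" "x \<noteq> 0" for x
      using up(3)[OF t(1) tb(1) that] by (simp add: s_def)
    have mk: "- int m \<le> int k" by simp
    note upper = At.smallest_eigenvalues_upper[OF _ orthonormal_independent[OF NV(1)] card_NV mk NV(3)]
    have "\<exists>\<nu>. smallest_eigenvalues (DA t) (A t) (- int m) (int k) \<nu>"
      by (rule upper(1)) (fact ess small)+
    then have sm: "smallest_eigenvalues (DA t) (A t) (- int m) (int k) (\<lambda>i. \<Lambda> i t)"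
      by (rule \<Lambda>[OF t(1) tb(4)])
    have "\<Lambda> (int k) t < s" by (rule upper(2)[OF _ _ sm]) (fact ess small)+
    also have "s = (\<mu> + C1 * t) * t" by (simp add: s_def power2_eq_square algebra_simps)
    finally have "\<Lambda> (int k) t / t < \<mu> + C1 * t" using t(1) by (simp add: divide_less_eq)
    also have "\<dots> \<le> \<mu> + C * t" using t(1) by (simp add: C_def mult_right_mono)
    finally have 1: "\<Lambda> (int k) t / t < \<mu> + C * t" .
    have "- C2 * t \<le> \<Lambda> 0 t"
      by (rule At.smallest_eigenvalues_lower[OF sm N]) (use low(4)[of t] t tb card_N in auto)
    then have "- C2 \<le> \<Lambda> 0 t / t" using t(1) by (simp add: le_divide_eq)
    then have "- C \<le> \<Lambda> 0 t / t" by (simp add: C_def)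
    with sm 1 show ?thesis by blast
  qed
  have "0 < b" "b \<le> \<rho>" using up(1,2) low(2) \<delta>3(1) by (auto simp: b_def)
  with main show ?thesis by blast
qed

text \<open>The lower bound on \<open>\<Lambda> 0\<close> confines the slopes of all indices from 0
  to \<open>k\<close> to a compact interval, so each has convergent subsequences. Strong convergence
  keeps the \<open>k + 1\<close> limits orthonormal, and this is what \<open>count\<close> forbids
  for slopes below \<open>\<mu>\<close>.\<close>

lemma eigenvalue_slope:
  fixes \<Lambda> :: "int \<Rightarrow> real \<Rightarrow> real"
  assumes b: "0 < b" "b \<le> \<rho>"
    and \<Lambda>: "\<And>t. 0 < t \<Longrightarrow> t < b \<Longrightarrow> smallest_eigenvalues (DA t) (A t) (- int m) (int k) (\<lambda>i. \<Lambda> i t)"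
    and upper: "\<And>t. 0 < t \<Longrightarrow> t < b \<Longrightarrow> \<Lambda> (int k) t / t < \<mu> + C * t"
    and lower: "\<And>t. 0 < t \<Longrightarrow> t < b \<Longrightarrow> - C \<le> \<Lambda> 0 t / t"
    and \<mu>: "\<mu> < \<omega>"
    and count: "\<And>S. orthonormal S \<Longrightarrow> finite S \<Longrightarrow> (\<And>z. z \<in> S \<Longrightarrow> \<exists>\<nu><\<mu>. first_order_eigenvector z \<nu>) \<Longrightarrow> card S \<le> k"
  shows "((\<lambda>t. \<Lambda> (int k) t / t) \<longlongrightarrow> \<mu>) (at_right 0)"
proof (rule order_tendstoI)
  fix y assume "\<mu> < y"
  moreover have "((\<lambda>t. \<mu> + C * t) \<longlongrightarrow> \<mu> + C * 0) (at_right 0)" by (intro tendsto_intros)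
  ultimately have "\<forall>\<^sub>F t in at_right 0. \<mu> + C * t < y" by (intro order_tendstoD) auto
  moreover have "\<forall>\<^sub>F t in at_right 0. \<Lambda> (int k) t / t < \<mu> + C * t"
    using upper b(1) by (auto simp: eventually_at_right_field)
  ultimately show "\<forall>\<^sub>F t in at_right 0. \<Lambda> (int k) t / t < y" by eventually_elim simp
next
  fix y assume y: "y < \<mu>"
  show "\<forall>\<^sub>F t in at_right 0. y < \<Lambda> (int k) t / t"
  proof (rule sequentially_imp_eventually_at_right[OF b(1)])
    fix f :: "nat \<Rightarrow> real"
    assume f: "\<And>n. 0 < f n" "\<And>n. f n < b" "f \<longlonglongrightarrow> 0"
    show "\<forall>\<^sub>F n in sequentially. y < \<Lambda> (int k) (f n) / f n"
    proof (rule ccontr)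
      assume "\<not> ?thesis"
      then obtain q :: "nat \<Rightarrow> nat" where q: "strict_mono q" "\<And>n. \<not> y < \<Lambda> (int k) (f (q n)) / f (q n)"
        using not_eventually_sequentiallyD by blast
      define t where "t = f \<circ> q"
      have t: "0 < t n" "t n < b" "t n \<le> \<rho>" for n using f(1,2)[of "q n"] b(2) by (auto simp: t_def)
      have t0: "t \<longlonglongrightarrow> 0" using LIMSEQ_subseq_LIMSEQ[OF f(3) q(1)] by (simp add: t_def)
      have tk: "\<Lambda> (int k) (t n) / t n \<le> y" for n using q(2)[of n] by (simp add: t_def)
      have "\<exists>e. \<forall>i\<in>{- int m..int k}. e i \<in> eigenspace (DA (t n)) (A (t n)) (\<Lambda> i (t n)) \<and>
          (\<forall>j\<in>{- int m..int k}. cinner (e i) (e j) = (if i = j then 1 else 0))" for n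
      proof -
        interpret At: form_operator D "a (t n)" "DA (t n)" "A (t n)" using operators t[of n] by simp
        show ?thesis using At.operator.smallest_eigenvalues_orthonormal[OF \<Lambda>[OF t(1,2)]] by metis
      qed
      then obtain e where e: "\<And>n i. i \<in> {- int m..int k} \<Longrightarrow> e n i \<in> eigenspace (DA (t n)) (A (t n)) (\<Lambda> i (t n))"
        "\<And>n i j. i \<in> {- int m..int k} \<Longrightarrow> j \<in> {- int m..int k} \<Longrightarrow> cinner (e n i) (e n j) = (if i = j then 1 else 0)"
        by metis
      have norm_e: "norm (e n i) = 1" if "i \<in> {- int m..int k}" for n i
      proof -
        have "complex_of_real ((norm (e n i))\<^sup>2) = 1" using e(2)[OF that that] cinner_self[of "e n i"] by simp
        then have "(norm (e n i))\<^sup>2 = 1\<^sup>2" unfolding of_real_eq_1_iff by simp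
        then show ?thesis by (rule power2_eq_imp_eq) auto
      qed
      \<comment> \<open>Limit and slope are quantified inside \<open>P\<close>, which makes the
        property inherited by subsequences.\<close>
      define P where "P i r \<longleftrightarrow> (\<exists>\<nu> z. (\<lambda>n. e (r n) i) \<longlonglongrightarrow> z \<and> \<nu> \<le> y \<and> first_order_eigenvector z \<nu>)"
        for i and r :: "nat \<Rightarrow> nat"
      have "\<exists>r. strict_mono r \<and> (\<forall>i\<in>{0..int k}. P i r)"
      proof (rule common_subsequence)
        show "P i (r \<circ> r')" if "P i r" "strict_mono r'" for i r r'
          using that LIMSEQ_subseq_LIMSEQ[OF _ that(2)] unfolding P_def o_def by blast
        fix i and r :: "nat \<Rightarrow> nat" assume i: "i \<in> {0..int k}" and r: "strict_mono r"
        have im: "i \<in> {- int m..int k}" using i by auto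
        have "\<Lambda> i (t (r n)) / t (r n) \<in> {- C..y}" for n
        proof -
          have mono: "mono_on {- int m..int k} (\<lambda>i. \<Lambda> i (t (r n)))"
            using \<Lambda>[OF t(1,2)] by (simp add: smallest_eigenvalues_def)
          have "\<Lambda> 0 (t (r n)) \<le> \<Lambda> i (t (r n))" "\<Lambda> i (t (r n)) \<le> \<Lambda> (int k) (t (r n))"
            by (rule mono_onD[OF mono]; use i in simp)+
          then have "\<Lambda> 0 (t (r n)) / t (r n) \<le> \<Lambda> i (t (r n)) / t (r n)"
            "\<Lambda> i (t (r n)) / t (r n) \<le> \<Lambda> (int k) (t (r n)) / t (r n)"
            using t(1)[of "r n"] by (auto intro!: divide_right_mono)
          then show ?thesis using lower[OF t(1,2), of "r n"] tk[of "r n"] by simp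
        qed
        then obtain \<nu> r1 where r1: "\<nu> \<in> {- C..y}" "strict_mono r1"
          "((\<lambda>n. \<Lambda> i (t (r n)) / t (r n)) \<circ> r1) \<longlonglongrightarrow> \<nu>"
          using compact_Icc[of "- C" y, unfolded compact_def, rule_format,
              of "\<lambda>n. \<Lambda> i (t (r n)) / t (r n)"] by blast
        define R where "R = r \<circ> r1"
        have R: "strict_mono R" unfolding R_def using r r1(2) by (rule strict_mono_o)
        have "\<exists>r2 z. strict_mono r2 \<and> ((\<lambda>n. e (R n) i) \<circ> r2) \<longlonglongrightarrow> z \<and> norm z = 1 \<and> first_order_eigenvector z \<nu>"
        proof (rule eigenvectors_converge[where t = "\<lambda>n. t (R n)" and l = "\<lambda>n. \<Lambda> i (t (R n))"])
          show "(\<lambda>n. t (R n)) \<longlonglongrightarrow> 0" using LIMSEQ_subseq_LIMSEQ[OF t0 R] by (simp add: o_def)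
          show "(\<lambda>n. \<Lambda> i (t (R n)) / t (R n)) \<longlonglongrightarrow> \<nu>" using r1(3) by (simp add: R_def o_def)
          show "\<nu> < \<omega>" using r1(1) y \<mu> by simp
        qed (use t e(1)[OF im] norm_e[OF im] in auto)
        then obtain r2 z where r2: "strict_mono r2" "((\<lambda>n. e (R n) i) \<circ> r2) \<longlonglongrightarrow> z" "first_order_eigenvector z \<nu>"
          by blast
        have "strict_mono (r1 \<circ> r2)" using r1(2) r2(1) by (rule strict_mono_o)
        moreover have "P i (r \<circ> (r1 \<circ> r2))"
          unfolding P_def using r2(2,3) r1(1) by (intro exI[of _ \<nu>] exI[of _ z]) (simp add: R_def o_def)
        ultimately show "\<exists>r'. strict_mono r' \<and> P i (r \<circ> r')" by blast
      qed simp
      then obtain r where r: "\<And>i. i \<in> {0..int k} \<Longrightarrow> P i r" by blast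
      then obtain \<nu> z where z: "\<And>i. i \<in> {0..int k} \<Longrightarrow> (\<lambda>n. e (r n) i) \<longlonglongrightarrow> z i"
        "\<And>i. i \<in> {0..int k} \<Longrightarrow> \<nu> i \<le> y" "\<And>i. i \<in> {0..int k} \<Longrightarrow> first_order_eigenvector (z i) (\<nu> i)"
        unfolding P_def by metis
      have orth: "cinner (z i) (z j) = (if i = j then 1 else 0)" if ij: "i \<in> {0..int k}" "j \<in> {0..int k}" for i j
      proof -
        have "(\<lambda>n. cinner (e (r n) i) (e (r n) j)) \<longlonglongrightarrow> cinner (z i) (z j)"
          by (rule tendsto_cinner[OF z(1)[OF ij(1)] z(1)[OF ij(2)]])
        moreover have "cinner (e (r n) i) (e (r n) j) = (if i = j then 1 else 0)" for n
          by (rule e(2)) (use ij in auto)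
        ultimately show ?thesis using LIMSEQ_unique[OF tendsto_const] by fastforce
      qed
      have inj: "inj_on z {0..int k}" by (rule inj_onI) (metis orth zero_neq_one)
      have "orthonormal (z ` {0..int k})"
        using orth inj by (auto simp: orthonormal_def dest: inj_onD)
      then have "card (z ` {0..int k}) \<le> k"
      proof (rule count)
        fix x assume "x \<in> z ` {0..int k}"
        then obtain i where "i \<in> {0..int k}" "x = z i" by blast
        then show "\<exists>\<nu><\<mu>. first_order_eigenvector x \<nu>" using z(2,3)[of i] y by (intro exI[of _ "\<nu> i"]) auto
      qed simp
      then show False using card_image[OF inj] by simp
    qed
  qed
qed

end

section \<open>From the power series to real parameters, and the conclusion\<close>

lemma power_series_second_order:
  fixes c :: "nat \<Rightarrow> complex"
  assumes sums: "\<And>t::complex. norm t < R \<Longrightarrow> (\<lambda>j. t ^ j * c j) sums f t" and \<rho>: "0 < \<rho>" "\<rho> < R"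
  shows "\<exists>M. \<forall>t::real. 0 \<le> t \<longrightarrow> t \<le> \<rho> \<longrightarrow>
    \<bar>Re (f (of_real t)) - Re (f 0) - t * Re (c 1)\<bar> \<le> M * t\<^sup>2"
proof -
  \<comment> \<open>Convergence at a point beyond \<open>\<rho>\<close> gives absolute convergence
    at \<open>\<rho>\<close>.\<close>
  obtain S where S: "\<rho> < S" "S < R" using dense[OF \<rho>(2)] by blast
  have "summable (\<lambda>j. c j * complex_of_real S ^ j)"
    using sums_summable[OF sums[of "of_real S"]] S \<rho>(1) by (simp add: mult.commute)
  then have "summable (\<lambda>j. norm (c j * complex_of_real \<rho> ^ j))"
    by (rule powser_insidea) (use S \<rho> in simp)
  then have summ: "summable (\<lambda>j. norm (c (j + 2) * complex_of_real \<rho> ^ (j + 2)))"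
    by (rule summable_ignore_initial_segment)
  \<comment> \<open>For \<open>t\<close> up to \<open>\<rho>\<close>, \<open>t^(j+2)\<close> is at
    most \<open>\<rho>^(j+2) * (t / \<rho>)^2\<close>; this takes \<open>t^2\<close> out of the
    whole tail, and the final constant is \<open>M / \<rho>^2\<close>.\<close>
  define M where "M = (\<Sum>j. norm (c (j + 2) * complex_of_real \<rho> ^ (j + 2)))"
  have f0: "f 0 = c 0"
    using sums[of 0] \<rho> powser_sums_zero[of c] sums_unique2 by (fastforce simp: mult.commute)
  have "\<bar>Re (f (of_real t)) - Re (f 0) - t * Re (c 1)\<bar> \<le> M / \<rho>\<^sup>2 * t\<^sup>2" if t: "0 \<le> t" "t \<le> \<rho>" for t
  proof -
    have "(\<lambda>j. complex_of_real t ^ j * c j) sums f (of_real t)" by (rule sums) (use t \<rho> in simp)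
    from sums_split_initial_segment[OF this, of 2]
    have tail: "(\<lambda>j. complex_of_real t ^ (j + 2) * c (j + 2)) sums (f (of_real t) - c 0 - of_real t * c 1)"
      by (simp add: eval_nat_numeral algebra_simps)
    have le: "norm (complex_of_real t ^ (j + 2) * c (j + 2))
        \<le> norm (c (j + 2) * complex_of_real \<rho> ^ (j + 2)) * (t\<^sup>2 / \<rho>\<^sup>2)" for j
    proof -
      have "t ^ (j + 2) * \<rho>\<^sup>2 = (t ^ j * \<rho>\<^sup>2) * t\<^sup>2" by (simp add: power_add power2_eq_square)
      also have "\<dots> \<le> (\<rho> ^ j * \<rho>\<^sup>2) * t\<^sup>2"
        using t by (intro mult_right_mono power_mono) auto
      finally have "t ^ (j + 2) \<le> (\<rho> ^ j * \<rho>\<^sup>2) * t\<^sup>2 / \<rho>\<^sup>2"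
        using \<rho>(1) by (simp only: pos_le_divide_eq zero_less_power)
      then have "t ^ (j + 2) \<le> \<rho> ^ (j + 2) * (t\<^sup>2 / \<rho>\<^sup>2)"
        unfolding power_add by (simp only: times_divide_eq_right)
      then have "norm (c (j + 2)) * t ^ (j + 2) \<le> norm (c (j + 2)) * (\<rho> ^ (j + 2) * (t\<^sup>2 / \<rho>\<^sup>2))"
        by (rule mult_left_mono) simp
      then show ?thesis using t \<rho> by (simp add: norm_mult norm_power ac_simps)
    qed
    have "norm (f (of_real t) - c 0 - of_real t * c 1) \<le> M * (t\<^sup>2 / \<rho>\<^sup>2)"
      unfolding sums_unique[OF tail] M_def suminf_mult2[OF summ]
      by (rule norm_suminf_le[OF le summable_mult2[OF summ]])
    then have "\<bar>Re (f (of_real t) - c 0 - of_real t * c 1)\<bar> \<le> M * (t\<^sup>2 / \<rho>\<^sup>2)"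
      using abs_Re_le_cmod order_trans by blast
    then show ?thesis by (simp add: f0)
  qed
  then show ?thesis by blast
qed

theorem theorem4p4:
  fixes U :: "complex set"
    and D :: "'a::complex_hilbert set"
    and a :: "complex \<Rightarrow> 'a \<Rightarrow> 'a \<Rightarrow> complex"
    and ak :: "nat \<Rightarrow> 'a \<Rightarrow> 'a \<Rightarrow> complex"
    and DA :: "real \<Rightarrow> 'a set"
    and A :: "real \<Rightarrow> 'a \<Rightarrow> 'a"
    and \<Sigma> lam :: "real \<Rightarrow> real"
    and \<epsilon> \<omega> :: real
    and m k :: nat
    and P B\<^sub>0 :: "'a \<Rightarrow> 'a"
    and \<mu> :: "int \<Rightarrow> real"
    and \<Lambda> :: "int \<Rightarrow> real \<Rightarrow> real"
  assumes family: "self_adjoint_type_B U D a DA A"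
    and expansion: "form_expansion D a ak"
    and eps: "\<epsilon> > 0"
    and eps_U: "\<And>t. 0 \<le> t \<Longrightarrow> t < \<epsilon> \<Longrightarrow> complex_of_real t \<in> U"
    and Sigma: "\<And>t. 0 \<le> t \<Longrightarrow> t < \<epsilon> \<Longrightarrow> is_min_essential_spectrum (DA t) (A t) (\<Sigma> t)"
    and Sigma_0: "\<Sigma> 0 = 0"
    and lam_eigenvalue: "\<And>t. 0 < t \<Longrightarrow> t < \<epsilon> \<Longrightarrow> is_eigenvalue (DA t) (A t) (lam t)"
    and lam_less: "\<And>t. 0 < t \<Longrightarrow> t < \<epsilon> \<Longrightarrow> lam t < \<Sigma> t"
    and lam_continuous: "continuous_on {0<..<\<epsilon>} lam"
    and lam_limit: "(lam \<longlongrightarrow> 0) (at_right 0)"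
    and lam_liminf: "Liminf (at_right 0) (\<lambda>t. ereal ((lam t - \<Sigma> t) / t)) < 0"
    and negative: "num_negative_eigenvalues (DA 0) (A 0) m"
    and omega: "((\<lambda>t. \<Sigma> t / t) \<longlongrightarrow> \<omega>) (at_right 0)"
    and P: "orthogonal_projection P (operator_kernel (DA 0) (A 0))"
    and B0: "first_order_operator (ak 1) P B\<^sub>0"
    and mu: "smallest_eigenvalues (operator_kernel (DA 0) (A 0)) B\<^sub>0 0 (int k) \<mu>"
    and mu_less: "\<And>i. 0 \<le> i \<Longrightarrow> i \<le> int k \<Longrightarrow> \<mu> i < \<omega>"
    and Lambda: "\<And>t. 0 < t \<Longrightarrow> t < \<epsilon> \<Longrightarrow>
        (\<exists>\<nu>. smallest_eigenvalues (DA t) (A t) (- int m) (int k) \<nu>) \<Longrightarrow>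
        smallest_eigenvalues (DA t) (A t) (- int m) (int k) (\<lambda>i. \<Lambda> i t)"
  shows "(\<forall>\<^sub>F t in at_right 0.
            smallest_eigenvalues (DA t) (A t) (- int m) (int k) (\<lambda>i. \<Lambda> i t)) \<and>
    ((\<lambda>t. \<Lambda> (int k) t / t) \<longlongrightarrow> \<mu> (int k)) (at_right 0) \<and>
    (\<forall>x :: real \<Rightarrow> 'a.
       (\<forall>\<^sub>F t in at_right 0. x t \<in> eigenspace (DA t) (A t) (\<Lambda> (int k) t) \<and> norm (x t) = 1) \<longrightarrow>
       (\<forall>s :: nat \<Rightarrow> real. filterlim s (at_right 0) sequentially \<longrightarrow>
          (\<exists>(r :: nat \<Rightarrow> nat) z. strict_mono r \<and> (\<lambda>n. x (s (r n))) \<longlonglongrightarrow> z \<and>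
             z \<in> eigenspace (operator_kernel (DA 0) (A 0)) B\<^sub>0 (\<mu> (int k)) \<and> norm z = 1)))"
proof -
  let ?K = "operator_kernel (DA 0) (A 0)"
  obtain R where R: "R > 0" and sums: "\<And>x y t. x \<in> D \<Longrightarrow> y \<in> D \<Longrightarrow> norm t < R \<Longrightarrow>
      (\<lambda>j. t ^ j * ak j x y) sums a t x y"
    using expansion unfolding form_expansion_def by metis
  \<comment> \<open>Strictly below both bounds, so that the closed interval up to
    \<open>\<rho>\<close> remains in the parameter range and in the disc of convergence.\<close>
  define \<rho> where "\<rho> = min \<epsilon> R / 2"
  have \<rho>: "0 < \<rho>" "\<rho> < \<epsilon>" "\<rho> < R" using eps R by (auto simp: \<rho>_def min_def)
  have op: "form_operator D (a (of_real t)) (DA t) (A t)" if t: "0 \<le> t" "t \<le> \<rho>" for t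
  proof -
    have U: "complex_of_real t \<in> U" using eps_U t \<rho> by simp
    have B: "symmetric_form D (a (of_real t))" "self_adjoint_operator (DA t) (A t)"
      "form_core D (a (of_real t)) (DA t)"
      "\<And>x y. x \<in> DA t \<Longrightarrow> y \<in> DA t \<Longrightarrow> cinner (A t x) y = a (of_real t) x y"
      using family U unfolding self_adjoint_type_B_def by blast+
    have "closed_sectorial_form D (a (of_real t))"
      using family U unfolding self_adjoint_type_B_def holomorphic_type_a_def by blast
    with B show ?thesis by unfold_locales
  qed
  interpret pert: perturbed_operator D "\<lambda>t. a (of_real t)" DA A "ak 1" \<rho>
  proof (rule perturbed_operator.intro)
    show "0 < \<rho>" by fact
    show "form_operator D (a (of_real t)) (DA t) (A t)" if "0 \<le> t" "t \<le> \<rho>" for t by (rule op[OF that])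
    show "hermitian_form D (ak 1)"
      using expansion unfolding form_expansion_def by (blast intro: hermitian_form.intro)
    show "\<exists>M. \<forall>t. 0 \<le> t \<longrightarrow> t \<le> \<rho> \<longrightarrow>
        \<bar>Re (a (of_real t) x x) - Re (a (of_real 0) x x) - t * Re (ak 1 x x)\<bar> \<le> M * t\<^sup>2" if x: "x \<in> D" for x
      using power_series_second_order[OF sums[OF x x] \<rho>(1,3)] by simp
  qed
  have ess: "complex_of_real r \<notin> essential_spectrum (DA t) (A t)" if "0 \<le> t" "t \<le> \<rho>" "r < \<Sigma> t" for r t
    using Sigma[of t] that \<rho>(2) unfolding is_min_essential_spectrum_def by fastforce
  obtain N \<kappa> where N: "orthonormal N" "finite N" "card N = m"
    and N_eigen: "\<And>e. e \<in> N \<Longrightarrow> e \<in> eigenspace (DA 0) (A 0) (\<kappa> e)" "\<And>e. e \<in> N \<Longrightarrow> \<kappa> e < 0"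
    and N_complete: "\<And>r x. r < 0 \<Longrightarrow> x \<in> eigenspace (DA 0) (A 0) r \<Longrightarrow> x \<in> orth_compl N \<Longrightarrow> x = 0"
    using pert.A0.operator.negative_eigenvectors[OF negative] by metis
  interpret thr: perturbed_threshold D "\<lambda>t. a (of_real t)" DA A "ak 1" \<rho> \<Sigma> \<omega> N \<kappa>
  proof (rule perturbed_threshold.intro[OF pert.perturbed_operator_axioms perturbed_threshold_axioms.intro])
    \<comment> \<open>As \<open>\<Sigma> 0 = 0\<close> leaves no essential spectrum below 0, a
      negative value would produce a negative eigenvector orthogonal to the complete set
      \<open>N\<close>.\<close>
    show "0 \<le> Re (a (of_real 0) x x)" if x: "x \<in> D" "x \<in> orth_compl N" for x
    proof (rule ccontr)
      assume "\<not> ?thesis"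
      then have "Re (a (of_real 0) x x) < 0 * (norm x)\<^sup>2" by simp
      from pert.A0.exists_eigenvector_below[OF N(1,2) N_eigen(1) x this] ess[of 0] Sigma_0 \<rho>(1)
      obtain r e where "r < 0" "e \<in> eigenspace (DA 0) (A 0) r" "norm e = 1" "e \<in> orth_compl N" by auto
      then show False using N_complete by fastforce
    qed
  qed (use ess omega N N_eigen in auto)
  have PK: "P x \<in> ?K" and P_orth: "v \<in> ?K \<Longrightarrow> cinner (x - P x) v = 0" for x v
    using P unfolding orthogonal_projection_def by blast+
  have subK: "cvec.subspace ?K" unfolding thr.K_eq by (rule pert.A0.operator.subspace_eigenspaces)
  have P_id: "P x = x" if "x \<in> ?K" for x
  proof -
    have "cinner (x - P x) (x - P x) = 0" by (intro P_orth cvec.subspace_diff subK that PK)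
    then show ?thesis by simp
  qed
  have cinner_P: "cinner z (P y) = cinner z y" if "z \<in> ?K" for z y
    using P_orth[OF that, of y] cinner_commute[of z "y - P y"] by (simp add: cinner_diff_right)
  have B0_form: "cinner (B\<^sub>0 x) y = ak 1 (P x) (P y)" for x y
    using B0 unfolding first_order_operator_def by blast
  interpret B0: symmetric_operator ?K B\<^sub>0
  proof
    show "linear_operator ?K B\<^sub>0"
      using B0 subK unfolding first_order_operator_def self_adjoint_operator_def linear_operator_def by blast
    show "cinner (B\<^sub>0 x) y = cinner x (B\<^sub>0 y)" for x y
      using B0_form[of x y] B0_form[of y x] pert.a1.sym[of "P x" "P y"] PK thr.K_subset
        cinner_commute[of x "B\<^sub>0 y"] by simp
  qed
  \<comment> \<open>One side is tested against all vectors, the other only against the kernel.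
    \<open>P\<close> mediates: it is the identity on the kernel and does not change inner products
    with kernel vectors.\<close>
  have eigen_iff: "thr.first_order_eigenvector z \<nu> \<longleftrightarrow> z \<in> eigenspace ?K B\<^sub>0 \<nu>" for z \<nu>
  proof
    assume z: "thr.first_order_eigenvector z \<nu>"
    then have zK: "z \<in> ?K" by (rule thr.first_order_eigenvector_mem)
    have "cinner (B\<^sub>0 z) y = cinner (of_real \<nu> *\<^sub>C z) y" for y
      using z PK[of y] unfolding thr.first_order_eigenvector_def
      by (simp add: B0_form P_id[OF zK] cinner_scaleC_left cinner_P[OF zK])
    then show "z \<in> eigenspace ?K B\<^sub>0 \<nu>" using zK cinner_eq_imp_eq unfolding eigenspace_def by blast
  next
    assume z: "z \<in> eigenspace ?K B\<^sub>0 \<nu>"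
    then have zK: "z \<in> ?K" and Bz: "B\<^sub>0 z = of_real \<nu> *\<^sub>C z" by (auto simp: eigenspace_def)
    have "ak 1 z y = of_real \<nu> * cinner z y" if "y \<in> ?K" for y
      using B0_form[of z y] by (simp add: P_id[OF zK] P_id[OF that] Bz cinner_scaleC_left)
    with zK show "thr.first_order_eigenvector z \<nu>" unfolding thr.first_order_eigenvector_def by blast
  qed
  obtain v where v: "\<And>i. i \<in> {0..int k} \<Longrightarrow> v i \<in> eigenspace ?K B\<^sub>0 (\<mu> i)"
    "\<And>i j. i \<in> {0..int k} \<Longrightarrow> j \<in> {0..int k} \<Longrightarrow> cinner (v i) (v j) = (if i = j then 1 else 0)"
    using B0.smallest_eigenvalues_orthonormal[OF mu] by metis
  define V where "V = v ` {0..int k}"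
  have inj: "inj_on v {0..int k}" by (rule inj_onI) (metis v(2) zero_neq_one)
  have V: "orthonormal V" "finite V" "card V = Suc k"
    using v(2) inj by (auto simp: V_def orthonormal_def card_image dest: inj_onD)
  define \<eta> where "\<eta> u = \<mu> (inv_into {0..int k} v u)" for u
  have \<eta>: "thr.first_order_eigenvector u (\<eta> u)" "\<eta> u \<le> \<mu> (int k)" if "u \<in> V" for u
  proof -
    from that obtain i where i: "i \<in> {0..int k}" "u = v i" unfolding V_def by blast
    then have "\<eta> u = \<mu> i" using inj by (simp add: \<eta>_def)
    moreover have "\<mu> i \<le> \<mu> (int k)"
      using mu i unfolding smallest_eigenvalues_def by (auto dest: mono_onD[of _ _ i "int k"])
    ultimately show "thr.first_order_eigenvector u (\<eta> u)" "\<eta> u \<le> \<mu> (int k)"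
      using i v(1) eigen_iff by auto
  qed
  have \<mu>\<omega>: "\<mu> (int k) < \<omega>" using mu_less by simp
  have \<Lambda>: "smallest_eigenvalues (DA t) (A t) (- int m) (int k) (\<lambda>i. \<Lambda> i t)"
    if "0 < t" "t \<le> \<rho>" "\<exists>\<nu>. smallest_eigenvalues (DA t) (A t) (- int m) (int k) \<nu>" for t
    using Lambda[of t] that \<rho>(2) by simp
  obtain b C where b: "0 < b" "b \<le> \<rho>"
    and bounds: "\<forall>t. 0 < t \<longrightarrow> t < b \<longrightarrow>
      smallest_eigenvalues (DA t) (A t) (- int m) (int k) (\<lambda>i. \<Lambda> i t) \<and>
      \<Lambda> (int k) t / t < \<mu> (int k) + C * t \<and> - C \<le> \<Lambda> 0 t / t"
    using thr.smallest_eigenvalues_bounds[OF V \<eta> N(3) \<mu>\<omega> \<Lambda>] by blast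
  have sm: "smallest_eigenvalues (DA t) (A t) (- int m) (int k) (\<lambda>i. \<Lambda> i t)"
    and upper: "\<Lambda> (int k) t / t < \<mu> (int k) + C * t"
    and lower: "- C \<le> \<Lambda> 0 t / t" if "0 < t" "t < b" for t
    using bounds that by blast+
  have slope: "((\<lambda>t. \<Lambda> (int k) t / t) \<longlongrightarrow> \<mu> (int k)) (at_right 0)"
  proof (rule thr.eigenvalue_slope[OF b sm upper lower \<mu>\<omega>])
    fix S assume S: "orthonormal S" "finite S"
      "\<And>z. z \<in> S \<Longrightarrow> \<exists>\<nu><\<mu> (int k). thr.first_order_eigenvector z \<nu>"
    then obtain \<nu> where "\<And>z. z \<in> S \<Longrightarrow> \<nu> z < \<mu> (int k) \<and> thr.first_order_eigenvector z (\<nu> z)" by metis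
    then have "card S \<le> nat (int k - 0)"
      using eigen_iff by (intro B0.card_eigenvectors_below[OF mu S(1,2)]) auto
    then show "card S \<le> k" by simp
  qed
  have limit_point: "\<exists>r z. strict_mono r \<and> (\<lambda>n. x (s (r n))) \<longlonglongrightarrow> z \<and>
      z \<in> eigenspace ?K B\<^sub>0 (\<mu> (int k)) \<and> norm z = 1"
    if x: "\<forall>\<^sub>F t in at_right 0. x t \<in> eigenspace (DA t) (A t) (\<Lambda> (int k) t) \<and> norm (x t) = 1"
      and s: "filterlim s (at_right 0) sequentially" for x :: "real \<Rightarrow> 'a" and s :: "nat \<Rightarrow> real"
  proof -
    have "\<forall>\<^sub>F t in at_right 0. 0 < t \<and> t \<le> \<rho>"
      using \<rho>(1) by (auto simp: eventually_at_right_field intro!: exI[of _ \<rho>])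
    with x have "\<forall>\<^sub>F t in at_right 0. (x t \<in> eigenspace (DA t) (A t) (\<Lambda> (int k) t) \<and> norm (x t) = 1) \<and> 0 < t \<and> t \<le> \<rho>"
      by (rule eventually_conj)
    from eventually_compose_filterlim[OF this s] obtain n0 where n0: "\<And>n. n \<ge> n0 \<Longrightarrow>
        (x (s n) \<in> eigenspace (DA (s n)) (A (s n)) (\<Lambda> (int k) (s n)) \<and> norm (x (s n)) = 1) \<and> 0 < s n \<and> s n \<le> \<rho>"
      by (auto simp: eventually_sequentially)
    \<comment> \<open>The conditions on \<open>x\<close> hold only near 0, so the first
      \<open>n0\<close> terms of \<open>s\<close> are dropped and the offset is restored in the
      final subsequence.\<close>
    define t where "t n = s (n + n0)" for n
    have t: "x (t n) \<in> eigenspace (DA (t n)) (A (t n)) (\<Lambda> (int k) (t n))" "norm (x (t n)) = 1" "0 < t n" "t n \<le> \<rho>" for n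
      using n0[of "n + n0"] by (auto simp: t_def)
    have t_lim: "filterlim t (at_right 0) sequentially"
      unfolding t_def using filterlim_compose[OF s filterlim_add_const_nat_at_top] .
    have "\<exists>r z. strict_mono r \<and> ((\<lambda>n. x (t n)) \<circ> r) \<longlonglongrightarrow> z \<and> norm z = 1 \<and> thr.first_order_eigenvector z (\<mu> (int k))"
    proof (rule thr.eigenvectors_converge[OF t(3,4) _ t(1,2) _ \<mu>\<omega>])
      show "t \<longlonglongrightarrow> 0" using t_lim by (simp add: filterlim_at)
      show "(\<lambda>n. \<Lambda> (int k) (t n) / t n) \<longlonglongrightarrow> \<mu> (int k)" by (rule filterlim_compose[OF slope t_lim])
    qed
    then obtain r z where r: "strict_mono r" "((\<lambda>n. x (t n)) \<circ> r) \<longlonglongrightarrow> z" "norm z = 1"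
      "thr.first_order_eigenvector z (\<mu> (int k))" by blast
    have "strict_mono (\<lambda>n. r n + n0)" using r(1) by (simp add: strict_mono_def)
    moreover have "(\<lambda>n. x (s (r n + n0))) \<longlonglongrightarrow> z" using r(2) by (simp add: t_def o_def)
    ultimately show ?thesis using r(3,4) eigen_iff by (intro exI[of _ "\<lambda>n. r n + n0"] exI[of _ z]) simp
  qed
  have "\<forall>\<^sub>F t in at_right 0. smallest_eigenvalues (DA t) (A t) (- int m) (int k) (\<lambda>i. \<Lambda> i t)"
    using sm b(1) by (auto simp: eventually_at_right_field)
  with slope limit_point show ?thesis by blast
qed

end
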